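(* Let $\mathcal{H}$ be a Hilbert space and $\mathcal{A}=\mathcal{K}(\mathcal{H})$ the $C^*$-algebra of compact operators on $\mathcal{H}$, whose uniform Kähler bundle has a single fiber $\mathcal{P}$. Let $\mathcal{B}\subseteq\mathcal{A}$ be a $C^*$-subalgebra. Then $\mathcal{B}$ is a hereditary $C^*$-subalgebra of $\mathcal{A}$ if and only if the uniform Kähler bundle associated with $\mathcal{B}$ has only one fiber $\mathcal{P}'$, which is (regarded inside $\mathcal{P}$) a closed Kähler submanifold of $\mathcal{P}$ satisfying $$\pi\Big(\Big[\sum_{x\in\mathcal{P}'}T_{\Phi(x)}\Phi(\mathcal{P}')\Big]\Big)\subset\Phi(\mathcal{P}').$$ Moreover, in this case one has $\mathcal{P}'=\Phi^{-1}(\mathcal{P}_{\mathcal{M}})$ and $\mathcal{B}=\mathcal{K}(\mathcal{M})$, where $\mathcal{M}:=\big[\sum_{x\in\mathcal{P}'}T_{\Phi(x)}\Phi(\mathcal{P}')\big]$.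
   Context: Hilbert spaces are complex, with inner product $\langle\cdot|\cdot\rangle$ conjugate-linear in the first variable. $\mathcal{P}_{\mathcal{H}}$ is the projective space of $\mathcal{H}$, with elements $[x]$, $x$ a unit vector; it is a Kähler (Hilbert) manifold with charts, for each unit vector $\xi$: $\mathcal{V}_\xi=\{[x]:\langle\xi|x\rangle\ne0\}$, $b_\xi([x])=x/\langle\xi|x\rangle-\xi\in\{\xi\}^\perp$, and with the Fubini–Study metric normalized so that its distance is $\sqrt2\arccos|\langle x|y\rangle|$. $\pi:\mathcal{H}\to\mathcal{P}_{\mathcal{H}}$ is the quotient map (defined on nonzero vectors), $[S]$ denotes the closed linear span of a set $S\subset\mathcal{H}$, and $\{\xi\}^\perp=\{x\in\mathcal{H}:\langle\xi|x\rangle=0\}$. For a $C^*$-algebra $\mathcal{B}$, its uniform Kähler bundle is $(\mathcal{P}(\mathcal{B}),p_{\mathcal{B}},\hat{\mathcal{B}})$: $\mathcal{P}(\mathcal{B})$ is the set of pure states with the $w^*$-topology, $\hat{\mathcal{B}}$ the spectrum with the Jacobson topology, $p_{\mathcal{B}}$ maps a pure state to the class of its GNS representation, and each fiber $p_{\mathcal{B}}^{-1}([\sigma])$ has the Kähler structure of $\mathcal{P}_{\mathcal{H}_\sigma}$ via $\omega\mapsto[x_\omega]$, where $x_\omega$ is a unit vector with $\omega(b)=\langle x_\omega|\sigma(b)x_\omega\rangle$. For $\mathcal{A}=\mathcal{K}(\mathcal{H})$ the spectrum is the single class of the inclusion $\mathcal{K}(\mathcal{H})\to\mathcal{L}(\mathcal{H})$;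 its unique fiber is $\mathcal{P}=\mathcal{P}(\mathcal{A})$, and $\Phi:\mathcal{P}\to\mathcal{P}_{\mathcal{H}}$ is the canonical Kähler isomorphism sending the state $a\mapsto\langle x|ax\rangle$ to $[x]$. The fiber $\mathcal{P}'=\mathcal{P}(\mathcal{B})$ is regarded as a subset of $\mathcal{P}$ by identifying pure states of $\mathcal{B}$ with their unique extensions to (pure) states of $\mathcal{A}$. $T_{[\xi]}\Phi(\mathcal{P})$ is the holomorphic tangent space at $[\xi]$ and is identified with $\{\xi\}^\perp\subset\mathcal{H}$ (via the chart $b_\xi$); for a Kähler submanifold $\mathcal{P}'$ of $\mathcal{P}$ and $[\xi]\in\Phi(\mathcal{P}')$, $T_{[\xi]}\Phi(\mathcal{P}')$ is accordingly a subspace of $\{\xi\}^\perp\subset\mathcal{H}$. A closed subset $\mathcal{N}$ of a Kähler Hilbert manifold is a closed (Kähler) submanifold if for any $x\in\mathcal{N}$ there exist a chart $(\mathcal{V},b_{\mathcal{V}},\mathcal{H}_{\mathcal{V}})$ at $x$ and a closed subspace $\mathcal{F}$ of $\mathcal{H}_{\mathcal{V}}$ with $b_{\mathcal{V}}(\mathcal{N}\cap\mathcal{V})=\mathcal{F}\cap b_{\mathcal{V}}(\mathcal{V})$. For a closed subspace $\mathcal{M}\subseteq\mathcal{H}$, $\mathcal{K}(\mathcal{M})$ is regarded as the subalgebra of $\mathcal{K}(\mathcal{H})$ of compact operators mapping $\mathcal{M}$ into $\mathcal{M}$ and vanishing on $\mathcal{M}^\perp$, and $\mathcal{P}_{\m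athcal{M}}\subseteq\mathcal{P}_{\mathcal{H}}$.
   Formalization: B is assumed nonzero ({0} is hereditary but has no fiber); the "moreover" part assumes P' is not a single point (for B=C|ξ><ξ| all tangent spaces vanish, so M=0 and the claim fails); unique extension of pure states of B, presupposed in regarding P' inside P, is stated explicitly. *)

theory Defs
  imports "HOL-Analysis.Analysis"
begin

section \<open>Complex Hilbert spaces\<close>

class complex_vector = real_vector +
  fixes scaleC :: "complex \<Rightarrow> 'a \<Rightarrow> 'a"  (infixr "*\<^sub>C" 75)
  assumes scaleC_add_right: "a *\<^sub>C (x + y) = a *\<^sub>C x + a *\<^sub>C y"
    and scaleC_add_left: "(a + b) *\<^sub>C x = a *\<^sub>C x + b *\<^sub>C x"
    and scaleC_scaleC: "a *\<^sub>C b *\<^sub>C x = (a * b) *\<^sub>C x"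
    and scaleC_one: "1 *\<^sub>C x = x"
    and scaleR_scaleC: "r *\<^sub>R x = complex_of_real r *\<^sub>C x"

class complex_normed_vector = complex_vector + real_normed_vector +
  assumes norm_scaleC: "norm (a *\<^sub>C x) = cmod a * norm x"

text \<open>The inner product is conjugate-linear in the first argument.\<close>

class complex_inner = complex_normed_vector +
  fixes cinner :: "'a \<Rightarrow> 'a \<Rightarrow> complex"
  assumes cinner_commute: "cinner x y = cnj (cinner y x)"
    and cinner_add_right: "cinner x (y + z) = cinner x y + cinner x z"
    and cinner_scaleC_right: "cinner x (a *\<^sub>C y) = a * cinner x y"
    and cinner_self: "cinner x x = complex_of_real ((norm x)\<^sup>2)"

class chilbert_space = complex_inner + complete_space

definition csubspace :: "'a::complex_vector set \<Rightarrow> bool" where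
  "csubspace S \<longleftrightarrow> 0 \<in> S \<and> (\<forall>x\<in>S. \<forall>y\<in>S. x + y \<in> S) \<and> (\<forall>c. \<forall>x\<in>S. c *\<^sub>C x \<in> S)"

definition closed_csubspace :: "'a::complex_normed_vector set \<Rightarrow> bool" where
  "closed_csubspace S \<longleftrightarrow> csubspace S \<and> closed S"

definition closed_cspan :: "'a::complex_normed_vector set \<Rightarrow> 'a set" where
  "closed_cspan S = closed_csubspace hull S"

definition orth_compl :: "'a::complex_inner set \<Rightarrow> 'a set" where
  "orth_compl S = {x. \<forall>y\<in>S. cinner y x = 0}"


section \<open>Operators\<close>

text \<open>
  Bounded operators are the complex-linear elements of the library type of bounded
  real-linear maps, which supplies the operator norm and composition.
\<close>

instantiation blinfun :: (real_normed_vector, complex_normed_vector) complex_vector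
begin

lift_definition scaleC_blinfun :: "complex \<Rightarrow> 'a \<Rightarrow>\<^sub>L 'b \<Rightarrow> 'a \<Rightarrow>\<^sub>L 'b" is "\<lambda>c f x. c *\<^sub>C f x"
proof -
  fix c :: complex and f :: "'a \<Rightarrow> 'b"
  assume "bounded_linear f"
  then interpret bounded_linear f .
  have scaleR_comm: "c *\<^sub>C r *\<^sub>R y = r *\<^sub>R c *\<^sub>C y" for r and y :: 'b
    by (simp add: scaleR_scaleC scaleC_scaleC mult.commute)
  obtain K where K: "\<And>x. norm (f x) \<le> norm x * K"
    using bounded by blast
  show "bounded_linear (\<lambda>x. c *\<^sub>C f x)"
  proof (rule bounded_linear_intro[where K = "cmod c * K"])
    fix x
    show "norm (c *\<^sub>C f x) \<le> norm x * (cmod c * K)"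
      using mult_left_mono[OF K[of x] norm_ge_zero[of c]]
      by (simp add: norm_scaleC mult.left_commute)
  qed (simp_all add: add scaleR scaleC_add_right scaleR_comm)
qed

instance
  by standard
    (transfer, simp add: scaleC_add_right scaleC_add_left scaleC_scaleC scaleC_one scaleR_scaleC)+

end

definition clinear_op :: "('a::complex_normed_vector \<Rightarrow>\<^sub>L 'a) \<Rightarrow> bool" where
  "clinear_op T \<longleftrightarrow> (\<forall>c x. T (c *\<^sub>C x) = c *\<^sub>C T x)"

definition adj :: "('a::chilbert_space \<Rightarrow>\<^sub>L 'a) \<Rightarrow> 'a \<Rightarrow>\<^sub>L 'a" where
  "adj T = (THE S :: 'a \<Rightarrow>\<^sub>L 'a. \<forall>x y. cinner (T x) y = cinner x (S y))"

definition positive_op :: "('a::chilbert_space \<Rightarrow>\<^sub>L 'a) \<Rightarrow> bool" where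
  "positive_op T \<longleftrightarrow> (\<forall>x. cinner x (T x) \<in> \<real>\<^sub>\<ge>\<^sub>0)"

definition compact_ops :: "('a::chilbert_space \<Rightarrow>\<^sub>L 'a) set" where
  "compact_ops = {T. clinear_op T \<and> compact (closure (blinfun_apply T ` cball 0 1))}"

definition compact_ops_on :: "'a::chilbert_space set \<Rightarrow> ('a \<Rightarrow>\<^sub>L 'a) set" where
  "compact_ops_on M =
     {T \<in> compact_ops. blinfun_apply T ` M \<subseteq> M \<and> (\<forall>x\<in>orth_compl M. T x = 0)}"

definition cstar_subalgebra :: "('a::chilbert_space \<Rightarrow>\<^sub>L 'a) set \<Rightarrow> ('a \<Rightarrow>\<^sub>L 'a) set \<Rightarrow> bool" where
  "cstar_subalgebra B A \<longleftrightarrow> B \<subseteq> A \<and> csubspace B \<and> closed B \<and>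
     (\<forall>S\<in>B. \<forall>T\<in>B. S o\<^sub>L T \<in> B) \<and> (\<forall>T\<in>B. adj T \<in> B)"

definition hereditary :: "('a::chilbert_space \<Rightarrow>\<^sub>L 'a) set \<Rightarrow> ('a \<Rightarrow>\<^sub>L 'a) set \<Rightarrow> bool" where
  "hereditary B A \<longleftrightarrow>
     (\<forall>a\<in>A. \<forall>b\<in>B. positive_op a \<and> positive_op (b - a) \<longrightarrow> a \<in> B)"


section \<open>Pure states\<close>

text \<open>
  Functionals on an algebra \<open>B\<close> of operators are extensional functions, so that
  distinct elements of \<open>states B\<close> differ on \<open>B\<close>, and \<open>restrict \<phi> B\<close> is the
  restriction of \<open>\<phi>\<close> to \<open>B\<close>. The last two conditions say that the functional is
  bounded and has norm one; this is the normalization also when \<open>B\<close> has no unit.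
\<close>

definition states :: "('a::chilbert_space \<Rightarrow>\<^sub>L 'a) set \<Rightarrow> (('a \<Rightarrow>\<^sub>L 'a) \<Rightarrow> complex) set" where
  "states B = {\<omega> \<in> extensional B.
     (\<forall>a\<in>B. \<forall>b\<in>B. \<omega> (a + b) = \<omega> a + \<omega> b) \<and>
     (\<forall>c. \<forall>b\<in>B. \<omega> (c *\<^sub>C b) = c * \<omega> b) \<and>
     (\<forall>b\<in>B. \<omega> (adj b o\<^sub>L b) \<in> \<real>\<^sub>\<ge>\<^sub>0) \<and>
     bdd_above ((\<lambda>b. cmod (\<omega> b)) ` {b \<in> B. norm b \<le> 1}) \<and>
     (SUP b\<in>{b \<in> B. norm b \<le> 1}. cmod (\<omega> b)) = 1}"

definition pure_states :: "('a::chilbert_space \<Rightarrow>\<^sub>L 'a) set \<Rightarrow> (('a \<Rightarrow>\<^sub>L 'a) \<Rightarrow> complex) set" where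
  "pure_states B = {\<omega> \<in> states B.
     \<forall>\<phi>\<in>states B. \<forall>\<psi>\<in>states B. \<forall>t::real. 0 < t \<and> t < 1 \<and>
       (\<forall>b\<in>B. \<omega> b = of_real t * \<phi> b + of_real (1 - t) * \<psi> b) \<longrightarrow> \<phi> = \<omega> \<and> \<psi> = \<omega>}"

definition unique_state_extensions ::
  "('a::chilbert_space \<Rightarrow>\<^sub>L 'a) set \<Rightarrow> ('a \<Rightarrow>\<^sub>L 'a) set \<Rightarrow> (('a \<Rightarrow>\<^sub>L 'a) \<Rightarrow> complex) set \<Rightarrow> bool" where
  "unique_state_extensions B A X \<longleftrightarrow> (\<forall>\<omega>\<in>X. \<exists>!\<phi>. \<phi> \<in> states A \<and> restrict \<phi> B = \<omega>)"

definition state_extension ::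
  "('a::chilbert_space \<Rightarrow>\<^sub>L 'a) set \<Rightarrow> ('a \<Rightarrow>\<^sub>L 'a) set \<Rightarrow> (('a \<Rightarrow>\<^sub>L 'a) \<Rightarrow> complex) \<Rightarrow> ('a \<Rightarrow>\<^sub>L 'a) \<Rightarrow> complex" where
  "state_extension B A \<omega> = (THE \<phi>. \<phi> \<in> states A \<and> restrict \<phi> B = \<omega>)"


section \<open>GNS representations and the fibers of the uniform Kaehler bundle\<close>

text \<open>
  The GNS space of \<open>\<omega>\<close> is the completion of \<open>B\<close> for the form \<open>\<omega>(a\<^sup>* b)\<close>, realized as
  the set of classes of Cauchy sequences; dividing by the null sequences also divides
  by the left kernel of \<open>\<omega>\<close>. The algebra acts by left multiplication.
\<close>

definition gns_form ::
  "(('a::chilbert_space \<Rightarrow>\<^sub>L 'a) \<Rightarrow> complex) \<Rightarrow> ('a \<Rightarrow>\<^sub>L 'a) \<Rightarrow> ('a \<Rightarrow>\<^sub>L 'a) \<Rightarrow> complex" where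
  "gns_form \<omega> a b = \<omega> (adj a o\<^sub>L b)"

definition gns_Cauchy ::
  "('a::chilbert_space \<Rightarrow>\<^sub>L 'a) set \<Rightarrow> (('a \<Rightarrow>\<^sub>L 'a) \<Rightarrow> complex) \<Rightarrow> (nat \<Rightarrow> 'a \<Rightarrow>\<^sub>L 'a) set" where
  "gns_Cauchy B \<omega> = {s. (\<forall>n. s n \<in> B) \<and>
     (\<forall>e>0. \<exists>N. \<forall>m\<ge>N. \<forall>n\<ge>N. cmod (gns_form \<omega> (s m - s n) (s m - s n)) < e)}"

definition gns_rel ::
  "('a::chilbert_space \<Rightarrow>\<^sub>L 'a) set \<Rightarrow> (('a \<Rightarrow>\<^sub>L 'a) \<Rightarrow> complex) \<Rightarrow> (nat \<Rightarrow> 'a \<Rightarrow>\<^sub>L 'a) rel" where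
  "gns_rel B \<omega> = {(s, t). s \<in> gns_Cauchy B \<omega> \<and> t \<in> gns_Cauchy B \<omega> \<and>
     (\<lambda>n. gns_form \<omega> (s n - t n) (s n - t n)) \<longlonglongrightarrow> 0}"

definition gns_space ::
  "('a::chilbert_space \<Rightarrow>\<^sub>L 'a) set \<Rightarrow> (('a \<Rightarrow>\<^sub>L 'a) \<Rightarrow> complex) \<Rightarrow> (nat \<Rightarrow> 'a \<Rightarrow>\<^sub>L 'a) set set" where
  "gns_space B \<omega> = gns_Cauchy B \<omega> // gns_rel B \<omega>"

definition gns_inner ::
  "(('a::chilbert_space \<Rightarrow>\<^sub>L 'a) \<Rightarrow> complex) \<Rightarrow>
    (nat \<Rightarrow> 'a \<Rightarrow>\<^sub>L 'a) set \<Rightarrow> (nat \<Rightarrow> 'a \<Rightarrow>\<^sub>L 'a) set \<Rightarrow> complex" where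
  "gns_inner \<omega> X Y = (THE z. \<exists>s\<in>X. \<exists>t\<in>Y. (\<lambda>n. gns_form \<omega> (s n) (t n)) \<longlonglongrightarrow> z)"

definition gns_rep ::
  "('a::chilbert_space \<Rightarrow>\<^sub>L 'a) set \<Rightarrow> (('a \<Rightarrow>\<^sub>L 'a) \<Rightarrow> complex) \<Rightarrow>
    ('a \<Rightarrow>\<^sub>L 'a) \<Rightarrow> (nat \<Rightarrow> 'a \<Rightarrow>\<^sub>L 'a) set \<Rightarrow> (nat \<Rightarrow> 'a \<Rightarrow>\<^sub>L 'a) set" where
  "gns_rep B \<omega> b X = gns_rel B \<omega> `` ((\<lambda>s n. b o\<^sub>L s n) ` X)"

text \<open>
  A bijection between Hilbert spaces that preserves inner products is automatically
  linear, so \<open>U\<close> below is a unitary operator intertwining the two GNS representations.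
\<close>

definition gns_equiv ::
  "('a::chilbert_space \<Rightarrow>\<^sub>L 'a) set \<Rightarrow> (('a \<Rightarrow>\<^sub>L 'a) \<Rightarrow> complex) \<Rightarrow> (('a \<Rightarrow>\<^sub>L 'a) \<Rightarrow> complex) \<Rightarrow> bool" where
  "gns_equiv B \<omega> \<omega>' \<longleftrightarrow>
     (\<exists>U. bij_betw U (gns_space B \<omega>) (gns_space B \<omega>') \<and>
       (\<forall>X\<in>gns_space B \<omega>. \<forall>Y\<in>gns_space B \<omega>. gns_inner \<omega>' (U X) (U Y) = gns_inner \<omega> X Y) \<and>
       (\<forall>b\<in>B. \<forall>X\<in>gns_space B \<omega>. U (gns_rep B \<omega> b X) = gns_rep B \<omega>' b (U X)))"

text \<open>
  Every irreducible representation is unitarily equivalent to the GNS representation of a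
  pure state. A point of the spectrum is therefore represented by the set of all pure states
  whose GNS representation belongs to the given equivalence class, and \<open>bundle_proj\<close> maps
  a pure state to the class of its GNS representation.
\<close>

definition bundle_proj ::
  "('a::chilbert_space \<Rightarrow>\<^sub>L 'a) set \<Rightarrow> (('a \<Rightarrow>\<^sub>L 'a) \<Rightarrow> complex) \<Rightarrow> (('a \<Rightarrow>\<^sub>L 'a) \<Rightarrow> complex) set" where
  "bundle_proj B \<omega> = {\<omega>' \<in> pure_states B. gns_equiv B \<omega> \<omega>'}"

definition spectrum ::
  "('a::chilbert_space \<Rightarrow>\<^sub>L 'a) set \<Rightarrow> (('a \<Rightarrow>\<^sub>L 'a) \<Rightarrow> complex) set set" where
  "spectrum B = bundle_proj B ` pure_states B"

definition bundle_fiber ::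
  "('a::chilbert_space \<Rightarrow>\<^sub>L 'a) set \<Rightarrow> (('a \<Rightarrow>\<^sub>L 'a) \<Rightarrow> complex) set \<Rightarrow> (('a \<Rightarrow>\<^sub>L 'a) \<Rightarrow> complex) set" where
  "bundle_fiber B \<sigma> = {\<omega> \<in> pure_states B. bundle_proj B \<omega> = \<sigma>}"

definition only_fiber ::
  "('a::chilbert_space \<Rightarrow>\<^sub>L 'a) set \<Rightarrow> (('a \<Rightarrow>\<^sub>L 'a) \<Rightarrow> complex) set \<Rightarrow> bool" where
  "only_fiber B X \<longleftrightarrow> (\<exists>\<sigma>. spectrum B = {\<sigma>} \<and> X = bundle_fiber B \<sigma>)"


section \<open>The projective space as a Kaehler manifold\<close>

text \<open>The class \<open>[x]\<close> of a nonzero vector is the complex line through it.\<close>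

definition line :: "'a::complex_vector \<Rightarrow> 'a set" where
  "line x = range (\<lambda>c. c *\<^sub>C x)"

definition proj_of :: "'a::chilbert_space set \<Rightarrow> 'a set set" where
  "proj_of M = line ` {x \<in> M. norm x = 1}"

abbreviation proj_space :: "'a::chilbert_space set set" where
  "proj_space \<equiv> proj_of UNIV"

definition fs_dist :: "'a::chilbert_space set \<Rightarrow> 'a set \<Rightarrow> real" where
  "fs_dist p q = (if p \<in> proj_space \<and> q \<in> proj_space
     then THE d. \<exists>x y. norm x = 1 \<and> norm y = 1 \<and> p = line x \<and> q = line y \<and>
       d = sqrt 2 * arccos (cmod (cinner x y))
     else 0)"

abbreviation proj_topology :: "'a::chilbert_space set topology" where
  "proj_topology \<equiv> Metric_space.mtopology proj_space fs_dist"

definition std_dom :: "'a::chilbert_space \<Rightarrow> 'a set set" where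
  "std_dom \<xi> = line ` {x. norm x = 1 \<and> cinner \<xi> x \<noteq> 0}"

definition std_chart :: "'a::chilbert_space \<Rightarrow> 'a set \<Rightarrow> 'a" where
  "std_chart \<xi> p = (THE v. \<exists>x. norm x = 1 \<and> p = line x \<and> v = inverse (cinner \<xi> x) *\<^sub>C x - \<xi>)"

definition holomorphic_map_on :: "('a::complex_normed_vector \<Rightarrow> 'a) \<Rightarrow> 'a set \<Rightarrow> bool" where
  "holomorphic_map_on f S \<longleftrightarrow>
     (\<forall>x\<in>S. \<exists>D. (f has_derivative D) (at x within S) \<and> (\<forall>c v. D (c *\<^sub>C v) = c *\<^sub>C D v))"

text \<open>
  The charts of the manifold are those of the maximal holomorphic atlas containing all
  \<open>std_chart \<xi>\<close>. The model space \<open>E\<close> is taken to be a closed subspace of the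
  Hilbert space itself: the model space of any chart with nonempty domain is isomorphic, hence
  isometric, to \<open>{\<xi>}\<^sup>\<bottom>\<close>.
\<close>

definition proj_chart :: "'a::chilbert_space set set \<Rightarrow> ('a set \<Rightarrow> 'a) \<Rightarrow> 'a set \<Rightarrow> bool" where
  "proj_chart V b E \<longleftrightarrow>
     openin proj_topology V \<and> closed_csubspace E \<and> inj_on b V \<and> b ` V \<subseteq> E \<and>
     (\<forall>\<xi>. norm \<xi> = 1 \<longrightarrow>
        openin (top_of_set E) (b ` (V \<inter> std_dom \<xi>)) \<and>
        holomorphic_map_on (b \<circ> inv_into (std_dom \<xi>) (std_chart \<xi>)) (std_chart \<xi> ` (V \<inter> std_dom \<xi>)) \<and>
        holomorphic_map_on (std_chart \<xi> \<circ> inv_into V b) (b ` (V \<inter> std_dom \<xi>)))"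

definition straightens :: "'a::chilbert_space set set \<Rightarrow> 'a set set \<Rightarrow> ('a set \<Rightarrow> 'a) \<Rightarrow> 'a set \<Rightarrow> bool" where
  "straightens N V b F \<longleftrightarrow>
     (\<exists>E. proj_chart V b E \<and> closed_csubspace F \<and> F \<subseteq> E \<and> b ` (N \<inter> V) = F \<inter> b ` V)"

definition closed_kaehler_submanifold :: "'a::chilbert_space set set \<Rightarrow> bool" where
  "closed_kaehler_submanifold N \<longleftrightarrow>
     closedin proj_topology N \<and> (\<forall>p\<in>N. \<exists>V b F. p \<in> V \<and> straightens N V b F)"

text \<open>
  The tangent space of a submanifold \<open>N\<close> at \<open>[\<xi>]\<close>, read in the chart \<open>std_chart \<xi>\<close>:
  the image of \<open>F\<close> under the derivative of the coordinate change from a chart in which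
  \<open>N\<close> becomes the closed subspace \<open>F\<close>. Replacing the unit vector \<open>\<xi>\<close>
  by another one on the same line multiplies the chart, but does not change the tangent space.
\<close>

definition tangent_space :: "'a::chilbert_space set set \<Rightarrow> 'a \<Rightarrow> 'a set" where
  "tangent_space N \<xi> = {v. \<exists>V b F D w. line \<xi> \<in> V \<and> straightens N V b F \<and> w \<in> F \<and> v = D w \<and>
     (std_chart \<xi> \<circ> inv_into V b has_derivative D) (at (b (line \<xi>)) within b ` (V \<inter> std_dom \<xi>))}"

definition tangent_span :: "'a::chilbert_space set set \<Rightarrow> 'a set" where
  "tangent_span N = closed_cspan (\<Union>\<xi>\<in>{\<xi>. norm \<xi> = 1 \<and> line \<xi> \<in> N}. tangent_space N \<xi>)"


section \<open>The bundle of the compact operators\<close>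

definition state_to_proj :: "(('a::chilbert_space \<Rightarrow>\<^sub>L 'a) \<Rightarrow> complex) \<Rightarrow> 'a set" where
  "state_to_proj \<phi> = (THE p. \<exists>x. norm x = 1 \<and> p = line x \<and> (\<forall>a\<in>compact_ops. \<phi> a = cinner x (a x)))"

end

theory Submission
  imports Defs
begin

text \<open>
  Both sides of the equivalence force \<open>B\<close> to be \<open>compact_ops_on M\<close> for a closed subspace \<open>M\<close>. Take a
  minimal projection \<open>p\<close> of \<open>B\<close>; then \<open>pBp = \<complex>p\<close>, and every unit vector in the range of \<open>p\<close> induces the
  same pure state of \<open>B\<close>. Uniqueness of its extension to the compact operators, or heredity, gives
  a rank-one projection \<open>|x\<rangle>\<langle>x|\<close> in \<open>B\<close>. With \<open>M = {y. |y\<rangle>\<langle>x| \<in> B}\<close>, finite-rank approximation yields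
  \<open>compact_ops_on M \<subseteq> B\<close>. If the inclusion were strict, \<open>B\<close> would have a minimal projection vanishing
  on \<open>M\<close>, hence either a pure state whose GNS representation is inequivalent to the first one, or a unit
  vector \<open>y \<bottom> M\<close> with \<open>|x + y\<rangle>\<langle>x + y| \<in> B\<close> by heredity, contrary to the definition of \<open>M\<close>.

  Conversely, the pure states of \<open>compact_ops_on M\<close> are exactly the vector states of unit vectors of
  \<open>M\<close>; their GNS spaces are all \<open>M\<close>, and the chart at \<open>[\<xi>]\<close> with \<open>\<xi> \<in> M\<close> straightens the corresponding set of
  lines to \<open>M \<inter> {\<xi>}\<^sup>\<bottom>\<close>, which is its tangent space.
\<close>

section \<open>Inner products and orthogonal projections\<close>

text \<open>The algebra need not have a unit, and no spectral theorem is invoked. Minimal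
  projections come from one extremal fact: a compact operator attains its norm, so each nonzero
  element b yields, inside the algebra, the projection onto the top eigenspace of b* b; compactness
  then forbids infinite descent among projections. In the same spirit the norm of a positive
  functional, which cannot be read off at a unit, is controlled by its values at finite-rank
  projections. Two degenerate cases shape the final statement. The zero algebra is hereditary but
  carries no functional of norm one, so it has no fiber at all. If M is a line, P' is a single point
  whose tangent space is zero; the closed tangent span is then {0} rather than M.\<close>

instance blinfun :: (real_normed_vector, complex_normed_vector) complex_normed_vector
proof
  fix a :: complex and f :: "'a \<Rightarrow>\<^sub>L 'b"
  have le: "norm (c *\<^sub>C g) \<le> cmod c * norm g" for c and g :: "'a \<Rightarrow>\<^sub>L 'b"
  proof (rule norm_blinfun_bound)
    show "norm ((c *\<^sub>C g) x) \<le> cmod c * norm g * norm x" for x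
      using mult_left_mono[OF norm_blinfun[of g x] norm_ge_zero[of c]]
      by (simp add: scaleC_blinfun.rep_eq norm_scaleC mult.assoc)
  qed simp
  show "norm (a *\<^sub>C f) = cmod a * norm f"
  proof (cases "a = 0")
    case True
    then show ?thesis using le[of a f] by simp
  next
    case False
    have "f = inverse a *\<^sub>C a *\<^sub>C f"
      using False by (simp add: scaleC_scaleC scaleC_one)
    then have "norm f \<le> inverse (cmod a) * norm (a *\<^sub>C f)"
      using le[of "inverse a" "a *\<^sub>C f"] by (simp add: norm_inverse)
    then have "cmod a * norm f \<le> norm (a *\<^sub>C f)"
      using False by (simp add: field_simps)
    then show ?thesis using le[of a f] by simp
  qed
qed

lemma scaleC_zero_left [simp]: "0 *\<^sub>C (x::'a::complex_vector) = 0"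
  using scaleC_add_left[of 0 0 x] by simp

lemma scaleC_zero_right [simp]: "c *\<^sub>C (0::'a::complex_vector) = 0"
  using scaleC_add_right[of c 0 0] by simp

lemma scaleC_minus_left [simp]: "(- c) *\<^sub>C (x::'a::complex_vector) = - (c *\<^sub>C x)"
  using scaleC_add_left[of c "-c" x] by (simp add: eq_neg_iff_add_eq_0 add.commute)

lemma scaleC_minus_right [simp]: "c *\<^sub>C (- (x::'a::complex_vector)) = - (c *\<^sub>C x)"
  using scaleC_add_right[of c x "-x"] by (simp add: eq_neg_iff_add_eq_0 add.commute)

lemma scaleC_diff_left: "(a - b) *\<^sub>C (x::'a::complex_vector) = a *\<^sub>C x - b *\<^sub>C x"
  using scaleC_add_left[of a "-b" x] by simp

lemma scaleC_diff_right: "c *\<^sub>C (x - (y::'a::complex_vector)) = c *\<^sub>C x - c *\<^sub>C y"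
  using scaleC_add_right[of c x "-y"] by simp

lemma scaleC_eq_0_iff [simp]: "c *\<^sub>C (x::'a::complex_normed_vector) = 0 \<longleftrightarrow> c = 0 \<or> x = 0"
  by (metis mult_eq_0_iff norm_eq_zero norm_scaleC)

lemma scaleC_left_commute: "a *\<^sub>C b *\<^sub>C (x::'a::complex_vector) = b *\<^sub>C a *\<^sub>C x"
  by (simp add: scaleC_scaleC mult.commute)

lemma bounded_bilinear_scaleC:
  "bounded_bilinear (\<lambda>c (x::'a::complex_normed_vector). c *\<^sub>C x)"
proof
  show "\<exists>K. \<forall>a (b::'a). norm (a *\<^sub>C b) \<le> norm a * norm b * K"
    by (rule exI[of _ 1]) (simp add: norm_scaleC)
qed (simp_all add: scaleC_add_left scaleC_add_right scaleR_scaleC scaleC_scaleC scaleR_conv_of_real mult.commute)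

lemmas continuous_on_scaleC [continuous_intros] = bounded_bilinear.continuous_on[OF bounded_bilinear_scaleC]

lemma csubspace_0: "csubspace S \<Longrightarrow> 0 \<in> S"
  and csubspace_add: "csubspace S \<Longrightarrow> x \<in> S \<Longrightarrow> y \<in> S \<Longrightarrow> x + y \<in> S"
  and csubspace_scaleC: "csubspace S \<Longrightarrow> x \<in> S \<Longrightarrow> c *\<^sub>C x \<in> S"
  by (simp_all add: csubspace_def)

lemma csubspace_uminus: "csubspace S \<Longrightarrow> x \<in> S \<Longrightarrow> - x \<in> S"
  using csubspace_scaleC[of S x "-1"] by (simp add: scaleC_one)

lemma csubspace_diff: "csubspace S \<Longrightarrow> x \<in> S \<Longrightarrow> y \<in> S \<Longrightarrow> x - y \<in> S"
  using csubspace_add[of S x "-y"] csubspace_uminus[of S y] by simp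

lemma csubspace_scaleR: "csubspace S \<Longrightarrow> x \<in> S \<Longrightarrow> r *\<^sub>R x \<in> S"
  by (simp add: scaleR_scaleC csubspace_scaleC)

text \<open>One argument serves three forms: the inner product, <x|ay> for a positive operator a,
  and the form given by a positive functional on an operator algebra. Hermitian symmetry is derived:
  over the complex numbers it follows from positivity.\<close>

lemma positive_form_Cauchy_Schwarz:
  fixes g :: "'v::complex_vector \<Rightarrow> 'v \<Rightarrow> complex"
  assumes S: "csubspace S"
    and add_l: "\<And>a b c. \<lbrakk>a \<in> S; b \<in> S; c \<in> S\<rbrakk> \<Longrightarrow> g (a + b) c = g a c + g b c"
    and add_r: "\<And>a b c. \<lbrakk>a \<in> S; b \<in> S; c \<in> S\<rbrakk> \<Longrightarrow> g a (b + c) = g a b + g a c"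
    and scale_l: "\<And>t a b. \<lbrakk>a \<in> S; b \<in> S\<rbrakk> \<Longrightarrow> g (t *\<^sub>C a) b = cnj t * g a b"
    and scale_r: "\<And>t a b. \<lbrakk>a \<in> S; b \<in> S\<rbrakk> \<Longrightarrow> g a (t *\<^sub>C b) = t * g a b"
    and pos: "\<And>a. a \<in> S \<Longrightarrow> g a a \<in> \<real>\<^sub>\<ge>\<^sub>0"
    and a: "a \<in> S" and b: "b \<in> S"
  shows "g b a = cnj (g a b)"
    and "(cmod (g a b))\<^sup>2 \<le> Re (g a a) * Re (g b b)"
proof -
  have expand: "g (t *\<^sub>C a + b) (t *\<^sub>C a + b)
      = t * cnj t * g a a + cnj t * g a b + t * g b a + g b b" for t
    using a b S by (simp add: add_l add_r scale_l scale_r csubspace_add csubspace_scaleC algebra_simps)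
  have nonneg: "t * cnj t * g a a + cnj t * g a b + t * g b a + g b b \<in> \<real>\<^sub>\<ge>\<^sub>0" for t
    unfolding expand[symmetric] using a b S by (intro pos csubspace_add csubspace_scaleC)
  have ra: "Im (g a a) = 0" "Re (g a a) \<ge> 0" and rb: "Im (g b b) = 0" "Re (g b b) \<ge> 0"
    using pos[OF a] pos[OF b] by (auto simp: complex_nonneg_Reals_iff)
  \<comment> \<open>Reality of the quadratic form at t = 1 compares the imaginary parts, at t = i
    the real parts.\<close>
  show herm: "g b a = cnj (g a b)"
    using nonneg[of 1] nonneg[of \<i>] ra rb
    by (auto simp: complex_nonneg_Reals_iff complex_eq_iff)
  define \<alpha> \<beta> m where "\<alpha> = Re (g a a)" and "\<beta> = Re (g b b)" and "m = (cmod (g a b))\<^sup>2"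
  have m_eq: "complex_of_real m = g a b * cnj (g a b)"
    by (simp only: m_def complex_norm_square)
  have quad: "0 \<le> s\<^sup>2 * m * \<alpha> - 2 * s * m + \<beta>" for s :: real
  proof -
    \<comment> \<open>With this phase both cross terms equal -s times the squared modulus of
      \<open>g a b\<close>, which leaves a real quadratic in s.\<close>
    define t where "t = - complex_of_real s * g a b"
    have "Re (t * cnj t * g a a + cnj t * g a b + t * g b a + g b b) \<ge> 0"
      using nonneg[of t] by (simp add: complex_nonneg_Reals_iff)
    also have "t * cnj t * g a a + cnj t * g a b + t * g b a + g b b
        = of_real (s\<^sup>2 * m) * g a a - of_real (2 * s * m) + g b b"
      by (simp add: t_def herm m_eq algebra_simps power2_eq_square)
    finally show ?thesis unfolding \<alpha>_def \<beta>_def using ra rb by simp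
  qed
  have "m \<ge> 0" by (simp add: m_def)
  have "m \<le> \<alpha> * \<beta>"
  proof (cases "\<alpha> = 0")
    case True
    have "m = 0"
    proof (rule ccontr)
      assume "m \<noteq> 0"
      \<comment> \<open>At this s the expression, now linear in s, equals -1.\<close>
      then show False using quad[of "(\<beta> + 1) / (2 * m)"] True by simp
    qed
    then show ?thesis using True by simp
  next
    case False
    then have "\<alpha> > 0" using ra by (simp add: \<alpha>_def)
    \<comment> \<open>The quadratic has its minimum at this s.\<close>
    then show ?thesis using quad[of "1 / \<alpha>"] by (simp add: field_simps power2_eq_square)
  qed
  then show "(cmod (g a b))\<^sup>2 \<le> Re (g a a) * Re (g b b)"
    by (simp add: \<alpha>_def \<beta>_def m_def)
qed

lemma cinner_add_left: "cinner (x + y) (z::'a::complex_inner) = cinner x z + cinner y z"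
  by (metis cinner_add_right cinner_commute complex_cnj_add)

lemma cinner_scaleC_left: "cinner (c *\<^sub>C x) (y::'a::complex_inner) = cnj c * cinner x y"
  by (metis cinner_commute cinner_scaleC_right complex_cnj_mult)

lemma cinner_cmod_le: "cmod (cinner x y) \<le> norm x * norm (y::'a::complex_inner)"
proof -
  have "(cmod (cinner x y))\<^sup>2 \<le> Re (cinner x x) * Re (cinner y y)"
    by (rule positive_form_Cauchy_Schwarz(2)[where S = UNIV])
      (auto simp: csubspace_def cinner_add_left cinner_add_right cinner_scaleC_left
        cinner_scaleC_right cinner_self complex_nonneg_Reals_iff simp del: of_real_power)
  then have "(cmod (cinner x y))\<^sup>2 \<le> (norm x * norm y)\<^sup>2"
    by (simp add: cinner_self power_mult_distrib del: of_real_power)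
  then show ?thesis by (rule power2_le_imp_le) simp
qed

lemma bounded_bilinear_cinner: "bounded_bilinear (cinner :: 'a::complex_inner \<Rightarrow> 'a \<Rightarrow> complex)"
proof
  show "\<exists>K. \<forall>a (b::'a). norm (cinner a b) \<le> norm a * norm b * K"
    by (rule exI[of _ 1]) (simp add: cinner_cmod_le)
qed (simp_all add: cinner_add_left cinner_add_right scaleR_scaleC cinner_scaleC_left
    cinner_scaleC_right scaleR_conv_of_real)

lemmas tendsto_cinner [tendsto_intros] = bounded_bilinear.tendsto[OF bounded_bilinear_cinner]
lemmas continuous_on_cinner [continuous_intros] = bounded_bilinear.continuous_on[OF bounded_bilinear_cinner]

interpretation cinner: bounded_bilinear "cinner :: 'a::complex_inner \<Rightarrow> 'a \<Rightarrow> complex"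
  by (rule bounded_bilinear_cinner)

lemmas cinner_simps = cinner_add_left cinner_add_right cinner_scaleC_left cinner_scaleC_right
  cinner.diff_left cinner.diff_right cinner.minus_left cinner.minus_right

lemma cinner_zero_left [simp]: "cinner 0 (y::'a::complex_inner) = 0"
  and cinner_zero_right [simp]: "cinner (y::'a::complex_inner) 0 = 0"
  by (rule cinner.zero_left, rule cinner.zero_right)

lemma cinner_eq_zero_iff [simp]: "cinner x x = 0 \<longleftrightarrow> (x::'a::complex_inner) = 0"
  by (simp add: cinner_self del: of_real_power)

lemma cinner_eq_zero_commute: "cinner x y = 0 \<longleftrightarrow> cinner y (x::'a::complex_inner) = 0"
  by (metis cinner_commute complex_cnj_zero)

lemma cinner_self_unit: "norm (x::'a::complex_inner) = 1 \<Longrightarrow> cinner x x = 1"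
  by (simp add: cinner_self)

lemma cinner_extensionality:
  assumes "\<And>z. cinner z x = cinner z (y::'a::complex_inner)" shows "x = y"
  using assms[of "x - y"] cinner_eq_zero_iff[of "x - y"] by (simp add: cinner.diff_right)

lemma norm_add_square:
  "(norm (x + y))\<^sup>2 = (norm x)\<^sup>2 + (norm y)\<^sup>2 + 2 * Re (cinner x (y::'a::complex_inner))"
proof -
  have "complex_of_real ((norm (x + y))\<^sup>2)
      = of_real ((norm x)\<^sup>2) + of_real ((norm y)\<^sup>2) + (cinner x y + cnj (cinner x y))"
    unfolding cinner_self[symmetric] cinner_commute[of y x, symmetric]
    by (simp add: cinner_simps algebra_simps)
  then have "Re (complex_of_real ((norm (x + y))\<^sup>2))
      = Re (of_real ((norm x)\<^sup>2) + of_real ((norm y)\<^sup>2) + (cinner x y + cnj (cinner x y)))"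
    by (rule arg_cong)
  then show ?thesis by (simp del: of_real_power)
qed

lemma norm_diff_square:
  "(norm (x - y))\<^sup>2 = (norm x)\<^sup>2 + (norm y)\<^sup>2 - 2 * Re (cinner x (y::'a::complex_inner))"
  using norm_add_square[of x "-y"] by (simp add: cinner.minus_right)

lemma cinner_component:
  "cinner z (cinner w z *\<^sub>C w) = of_real ((cmod (cinner w (z::'a::complex_inner)))\<^sup>2)"
  unfolding complex_norm_square by (simp add: cinner_simps flip: cinner_commute)

lemma norm_diff_component:
  assumes "norm (y::'a::complex_inner) = 1"
  shows "(norm (w - cinner y w *\<^sub>C y))\<^sup>2 = (norm w)\<^sup>2 - (cmod (cinner y w))\<^sup>2"
  using assms by (simp add: norm_diff_square norm_scaleC cinner_component)

lemma parallelogram_law: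
  "(norm (x + y))\<^sup>2 + (norm (x - y))\<^sup>2 = 2 * (norm x)\<^sup>2 + 2 * (norm (y::'a::complex_inner))\<^sup>2"
  by (simp add: norm_add_square norm_diff_square)

lemma csubspace_orth_compl: "csubspace (orth_compl (S::'a::complex_inner set))"
  by (auto simp: csubspace_def orth_compl_def cinner_simps)

lemma closed_orth_compl: "closed (orth_compl (S::'a::complex_inner set))"
proof -
  have "orth_compl S = (\<Inter>y\<in>S. {x. cinner y x = 0})"
    by (auto simp: orth_compl_def)
  also have "closed \<dots>"
    by (intro closed_INT ballI closed_Collect_eq continuous_intros)
  finally show ?thesis .
qed

lemma closed_csubspace_orth_compl: "closed_csubspace (orth_compl (S::'a::complex_inner set))"
  by (simp add: closed_csubspace_def csubspace_orth_compl closed_orth_compl)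

text \<open>A minimizing sequence is Cauchy by the parallelogram law, and its limit m is nearest to
  x; a component of x - m along M could be subtracted to come closer still.\<close>

lemma orthogonal_decomposition:
  fixes x :: "'a::chilbert_space"
  assumes M: "closed_csubspace M"
  shows "\<exists>m\<in>M. x - m \<in> orth_compl M"
proof -
  have sub: "csubspace M" and cl: "closed M" using M by (auto simp: closed_csubspace_def)
  define d where "d = (INF y\<in>M. (norm (x - y))\<^sup>2)"
  have bdd: "bdd_below ((\<lambda>y. (norm (x - y))\<^sup>2) ` M)" by (rule bdd_belowI2[of _ 0]) simp
  have ne: "M \<noteq> {}" using csubspace_0[OF sub] by auto
  have d_le: "d \<le> (norm (x - y))\<^sup>2" if "y \<in> M" for y
    unfolding d_def by (rule cINF_lower[OF bdd that])
  have "\<exists>y\<in>M. (norm (x - y))\<^sup>2 < d + 1 / (real n + 1)" for n :: nat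
    using cINF_less_iff[OF ne bdd, of "d + 1 / (real n + 1)"] by (simp add: d_def)
  then obtain s where s: "s n \<in> M" "(norm (x - s n))\<^sup>2 < d + 1 / (real n + 1)" for n by metis
  have dist_sq: "(norm (s m - s n))\<^sup>2 \<le> 2 / (real m + 1) + 2 / (real n + 1)" for m n
  proof -
    \<comment> \<open>The midpoint of two members of the sequence lies in M, so its distance from x
      is bounded below through d. This limits the diagonal \<open>s m - s n\<close> of the
      parallelogram.\<close>
    have mid: "(1/2) *\<^sub>R (s m + s n) \<in> M"
      using s sub by (intro csubspace_scaleR csubspace_add)
    have "(x - s n) + (x - s m) = 2 *\<^sub>R (x - (1/2) *\<^sub>R (s m + s n))"
      by (simp add: algebra_simps scaleR_2)
    then have "(norm ((x - s n) + (x - s m)))\<^sup>2 = 4 * (norm (x - (1/2) *\<^sub>R (s m + s n)))\<^sup>2"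
      by (simp add: power_mult_distrib)
    then have "4 * d \<le> (norm ((x - s n) + (x - s m)))\<^sup>2" using d_le[OF mid] by simp
    moreover have "(norm ((x - s n) + (x - s m)))\<^sup>2 + (norm (s m - s n))\<^sup>2
        = 2 * (norm (x - s n))\<^sup>2 + 2 * (norm (x - s m))\<^sup>2"
      using parallelogram_law[of "x - s n" "x - s m"] by simp
    ultimately show ?thesis using s(2)[of m] s(2)[of n] by simp
  qed
  have "Cauchy s"
  proof (rule metric_CauchyI)
    fix e :: real assume e: "e > 0"
    obtain N :: nat where N: "4 / e\<^sup>2 < real N" using reals_Archimedean2 by blast
    have "dist (s m) (s n) < e" if "m \<ge> N" "n \<ge> N" for m n
    proof -
      have "2 / (real k + 1) < e\<^sup>2 / 2" if "k \<ge> N" for k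
      proof -
        have "4 / e\<^sup>2 < real k + 1" using N that by linarith
        then show ?thesis using e by (simp add: field_simps)
      qed
      then have "(norm (s m - s n))\<^sup>2 < e\<^sup>2"
        using dist_sq[of m n] that by (smt (verit) field_sum_of_halves)
      then show ?thesis using e by (simp add: dist_norm power2_less_imp_less)
    qed
    then show "\<exists>N. \<forall>m\<ge>N. \<forall>n\<ge>N. dist (s m) (s n) < e" by blast
  qed
  then obtain m where m: "s \<longlonglongrightarrow> m" using Cauchy_convergent_iff convergent_def by blast
  have mM: "m \<in> M" using closed_sequentially[OF cl _ m] s by blast
  have "(\<lambda>n. (norm (x - s n))\<^sup>2) \<longlonglongrightarrow> (norm (x - m))\<^sup>2"
    by (intro tendsto_intros m)
  moreover have "(\<lambda>n. d + 1 / (real n + 1)) \<longlonglongrightarrow> d + 0"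
    using LIMSEQ_inverse_real_of_nat
    by (intro tendsto_intros) (simp add: inverse_eq_divide add.commute)
  ultimately have dm: "(norm (x - m))\<^sup>2 \<le> d"
    by (rule order_trans[OF LIMSEQ_le]) (use s(2) less_imp_le in auto)
  have "cinner y (x - m) = 0" if y: "y \<in> M" for y
  proof (cases "y = 0")
    case False
    \<comment> \<open>The coefficient of the projection of x - m onto the line of y: moving m by
      this multiple of y would lower the squared distance by the squared norm of that
      multiple.\<close>
    define c where "c = cinner y (x - m) / of_real ((norm y)\<^sup>2)"
    have n0: "norm y \<noteq> 0" using False by simp
    have mem: "m + c *\<^sub>C y \<in> M" using mM y sub by (intro csubspace_add csubspace_scaleC)
    have "(norm (x - m))\<^sup>2 \<le> (norm ((x - m) - c *\<^sub>C y))\<^sup>2"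
      using order_trans[OF dm d_le[OF mem]] by (simp only: diff_diff_eq)
    also have "\<dots> = (norm (x - m))\<^sup>2 + (cmod c * norm y)\<^sup>2 - 2 * Re (cinner (x - m) (c *\<^sub>C y))"
      by (simp add: norm_diff_square norm_scaleC)
    finally have "2 * Re (cinner (x - m) (c *\<^sub>C y)) \<le> (cmod c * norm y)\<^sup>2" by simp
    moreover have "cinner (x - m) (c *\<^sub>C y) = of_real ((cmod c * norm y)\<^sup>2)"
    proof -
      have "cinner (x - m) y = cnj c * of_real ((norm y)\<^sup>2)"
        using n0 cinner_commute[of "x - m" y] by (simp add: c_def)
      then have "cinner (x - m) (c *\<^sub>C y) = c * cnj c * of_real ((norm y)\<^sup>2)"
        by (simp add: cinner_scaleC_right)
      then show ?thesis
        by (simp add: complex_norm_square[symmetric] power_mult_distrib)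
    qed
    ultimately have "(cmod c * norm y)\<^sup>2 \<le> 0" by (simp del: of_real_power of_real_mult)
    then have "c = 0" using n0 by simp
    then show ?thesis using n0 by (simp add: c_def)
  qed simp
  then have "x - m \<in> orth_compl M" by (auto simp: orth_compl_def)
  with mM show ?thesis by blast
qed

lemma orth_compl_inter: "m \<in> M \<Longrightarrow> m \<in> orth_compl M \<Longrightarrow> m = (0::'a::complex_inner)"
  by (auto simp: orth_compl_def)

lemma orth_compl_orth_compl:
  fixes M :: "'a::chilbert_space set"
  assumes M: "closed_csubspace M"
  shows "orth_compl (orth_compl M) = M"
proof
  show "M \<subseteq> orth_compl (orth_compl M)"
    by (auto simp: orth_compl_def) (metis cinner_eq_zero_commute)
  show "orth_compl (orth_compl M) \<subseteq> M"
  proof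
    fix x assume x: "x \<in> orth_compl (orth_compl M)"
    obtain m where m: "m \<in> M" "x - m \<in> orth_compl M"
      using orthogonal_decomposition[OF M] by blast
    have "m \<in> orth_compl (orth_compl M)"
      using m(1) by (auto simp: orth_compl_def) (metis cinner_eq_zero_commute)
    then have "x - m \<in> orth_compl (orth_compl M)"
      using x csubspace_diff csubspace_orth_compl by blast
    then have "x - m = 0" using m(2) orth_compl_inter by blast
    then show "x \<in> M" using m(1) by simp
  qed
qed

text \<open>The representing vector is a multiple of a vector w orthogonal to the kernel of f,
  because every x differs from a multiple of w by a kernel element.\<close>

lemma Riesz_representation:
  fixes f :: "'a::chilbert_space \<Rightarrow> complex"
  assumes f: "bounded_linear f" and fC: "\<And>c x. f (c *\<^sub>C x) = c * f x"
  shows "\<exists>u. \<forall>x. f x = cinner u x"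
proof (cases "\<forall>x. f x = 0")
  case True
  then show ?thesis by (intro exI[of _ 0]) simp
next
  case False
  then obtain z where z: "f z \<noteq> 0" by blast
  interpret bounded_linear f by (rule f)
  define N where "N = {x. f x = 0}"
  have N: "closed_csubspace N"
    unfolding closed_csubspace_def csubspace_def N_def
    by (auto simp: add fC zero intro!: closed_Collect_eq continuous_on continuous_on_id)
  obtain m where m: "m \<in> N" "z - m \<in> orth_compl N"
    using orthogonal_decomposition[OF N] by blast
  define w where "w = z - m"
  have fw: "f w \<noteq> 0" using z m(1) by (simp add: w_def diff N_def)
  then have w0: "w \<noteq> 0" using zero by auto
  have "f x = cinner (cnj (f w / cinner w w) *\<^sub>C w) x" for x
  proof -
    have "x - (f x / f w) *\<^sub>C w \<in> N" using fw by (simp add: N_def diff fC)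
    then have "cinner (x - (f x / f w) *\<^sub>C w) w = 0"
      using m(2) by (auto simp: orth_compl_def w_def)
    then have "cinner w (x - (f x / f w) *\<^sub>C w) = 0" by (simp add: cinner_eq_zero_commute)
    then show ?thesis using fw w0 by (simp add: cinner_simps field_simps)
  qed
  then show ?thesis by blast
qed

section \<open>Bounded and compact operators\<close>

lemma scaleC_blinfun_apply [simp]: "blinfun_apply (c *\<^sub>C T) x = c *\<^sub>C T x"
  by (simp add: scaleC_blinfun.rep_eq)

lemmas blinfun_apply_simps = blinfun.add_left blinfun.diff_left blinfun.minus_left blinfun.zero_left
  blinfun.add_right blinfun.diff_right blinfun.minus_right blinfun.zero_right

lemma clinear_opD: "clinear_op T \<Longrightarrow> T (c *\<^sub>C x) = c *\<^sub>C T x"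
  by (simp add: clinear_op_def)

lemma clinear_op_0: "clinear_op 0"
  and clinear_op_add: "clinear_op S \<Longrightarrow> clinear_op T \<Longrightarrow> clinear_op (S + T)"
  and clinear_op_diff: "clinear_op S \<Longrightarrow> clinear_op T \<Longrightarrow> clinear_op (S - T)"
  and clinear_op_scaleC: "clinear_op T \<Longrightarrow> clinear_op (c *\<^sub>C T)"
  and clinear_op_compose: "clinear_op S \<Longrightarrow> clinear_op T \<Longrightarrow> clinear_op (S o\<^sub>L T)"
  by (simp_all add: clinear_op_def blinfun_apply_simps scaleC_add_right scaleC_diff_right
      scaleC_scaleC mult.commute)

lemma clinear_blinfunI:
  assumes "\<And>x y. f (x + y) = f x + f y" "\<And>c x. f (c *\<^sub>C x) = c *\<^sub>C f x"
    and "\<And>x. norm (f x) \<le> norm x * K"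
  shows "\<exists>T :: 'a::complex_normed_vector \<Rightarrow>\<^sub>L 'a. clinear_op T \<and> (\<forall>x. T x = f x)"
proof -
  have "bounded_linear f"
    by (rule bounded_linear_intro[of _ K]) (simp_all add: assms scaleR_scaleC)
  then show ?thesis
    by (intro exI[of _ "Blinfun f"]) (simp add: clinear_op_def bounded_linear_Blinfun_apply assms)
qed

section \<open>Adjoints\<close>

lemma adj_unique:
  fixes S T :: "'a::chilbert_space \<Rightarrow>\<^sub>L 'a"
  assumes "\<And>x y. cinner (T x) y = cinner x (S y)"
  shows "adj T = S"
  unfolding adj_def
proof (rule the_equality)
  fix S' :: "'a \<Rightarrow>\<^sub>L 'a" assume S': "\<forall>x y. cinner (T x) y = cinner x (S' y)"
  show "S' = S"
    by (rule blinfun_eqI, rule cinner_extensionality) (metis S' assms)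
qed (use assms in blast)

text \<open>Here f is only a function satisfying the adjoint identity. The bound is thus available
  before f is known to be linear, where it makes the adjoint a bounded operator, and again
  afterwards for the norm of \<open>adj\<close>.\<close>

lemma norm_adj_apply_le:
  assumes "\<And>x y. cinner (blinfun_apply T x) y = cinner x (f y)"
  shows "norm (f y) \<le> norm T * norm y"
proof (cases "f y = 0")
  case False
  have "(norm (f y))\<^sup>2 = cmod (cinner (T (f y)) y)"
    by (simp add: assms cinner_self norm_power)
  also have "\<dots> \<le> norm (T (f y)) * norm y" by (rule cinner_cmod_le)
  also have "\<dots> \<le> (norm T * norm (f y)) * norm y"
    by (intro mult_right_mono norm_blinfun) simp
  finally show ?thesis using False by (simp add: power2_eq_square mult_ac)
qed simp

text \<open>\<open>adj\<close> is a definite description; Riesz representation of the functionals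
  sending x to <y|Tx> supplies its witness.\<close>

lemma adj_exists:
  fixes T :: "'a::chilbert_space \<Rightarrow>\<^sub>L 'a"
  assumes T: "clinear_op T"
  shows "\<exists>S. clinear_op S \<and> (\<forall>x y. cinner (T x) y = cinner x (S y))"
proof -
  have "\<exists>u. \<forall>x. cinner y (T x) = cinner u x" for y
    by (rule Riesz_representation)
      (auto intro: bounded_linear_compose[OF cinner.bounded_linear_right blinfun.bounded_linear_right]
        simp: clinear_opD[OF T] cinner_simps)
  then obtain f where f: "cinner y (T x) = cinner (f y) x" for x y by metis
  have f': "cinner (T x) y = cinner x (f y)" for x y
    by (metis cinner_commute f)
  have "\<exists>S. clinear_op S \<and> (\<forall>x. S x = f x)"
  proof (rule clinear_blinfunI)
    show "f (x + y) = f x + f y" for x y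
      by (rule cinner_extensionality) (simp add: f'[symmetric] cinner_simps)
    show "f (c *\<^sub>C x) = c *\<^sub>C f x" for c x
      by (rule cinner_extensionality) (simp add: f'[symmetric] cinner_simps)
    show "norm (f x) \<le> norm x * norm T" for x
      using norm_adj_apply_le[of T f, OF f'] by (simp add: mult.commute)
  qed
  then show ?thesis using f' by auto
qed

lemma
  assumes "clinear_op T"
  shows clinear_op_adj: "clinear_op (adj T)"
    and cinner_adj_right: "cinner (T x) y = cinner x (adj T y)"
    and cinner_adj_left: "cinner (adj T x) y = cinner x (T y)"
proof -
  obtain S where S: "clinear_op S" "\<And>x y. cinner (T x) y = cinner x (S y)"
    using adj_exists[OF assms] by blast
  then have "adj T = S" using adj_unique by blast
  then show "clinear_op (adj T)" and *: "cinner (T x) y = cinner x (adj T y)" for x y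
    using S by auto
  show "cinner (adj T x) y = cinner x (T y)" by (metis * cinner_commute)
qed

lemma norm_adj_le:
  fixes T :: "'a::chilbert_space \<Rightarrow>\<^sub>L 'a"
  assumes "clinear_op T"
  shows "norm (adj T) \<le> norm T"
  using norm_adj_apply_le[of T, OF cinner_adj_right[OF assms]] by (intro norm_blinfun_bound) auto

lemma adj_adj: "clinear_op T \<Longrightarrow> adj (adj T) = T"
  by (rule adj_unique) (simp add: cinner_adj_left)

lemma norm_adj: "clinear_op T \<Longrightarrow> norm (adj T) = norm T"
  by (metis adj_adj antisym clinear_op_adj norm_adj_le)

lemma adj_add: "clinear_op S \<Longrightarrow> clinear_op T \<Longrightarrow> adj (S + T) = adj S + adj T"
  and adj_diff: "clinear_op S \<Longrightarrow> clinear_op T \<Longrightarrow> adj (S - T) = adj S - adj T"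
  and adj_scaleC: "clinear_op T \<Longrightarrow> adj (c *\<^sub>C T) = cnj c *\<^sub>C adj T"
  and adj_compose: "clinear_op S \<Longrightarrow> clinear_op T \<Longrightarrow> adj (S o\<^sub>L T) = adj T o\<^sub>L adj S"
  by (rule adj_unique, simp add: blinfun_apply_simps cinner_simps cinner_adj_right)+

section \<open>Rank-one operators |x><y|\<close>

lift_definition rank_one :: "'a::complex_inner \<Rightarrow> 'a \<Rightarrow> 'a \<Rightarrow>\<^sub>L 'a" is
  "\<lambda>x y z. cinner y z *\<^sub>C x"
proof -
  fix x y :: 'a
  show "bounded_linear (\<lambda>z. cinner y z *\<^sub>C x)"
    by (rule bounded_linear_compose[OF bounded_bilinear.bounded_linear_left[OF bounded_bilinear_scaleC]
          cinner.bounded_linear_right])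
qed

lemma rank_one_apply [simp]: "rank_one x y z = cinner y z *\<^sub>C x"
  by (simp add: rank_one.rep_eq)

lemma cinner_rank_one_self: "cinner z (rank_one w w z) = of_real ((cmod (cinner w z))\<^sup>2)"
  by (simp only: rank_one_apply cinner_component)

lemma clinear_op_rank_one [simp]: "clinear_op (rank_one x y)"
  by (simp add: clinear_op_def cinner_simps scaleC_scaleC)

lemma adj_rank_one [simp]: "adj (rank_one x y) = rank_one y x"
  by (rule adj_unique) (simp add: cinner_simps flip: cinner_commute)

lemma compose_rank_one: "clinear_op T \<Longrightarrow> T o\<^sub>L rank_one x y = rank_one (T x) y"
  by (rule blinfun_eqI) (simp add: clinear_opD)

lemma rank_one_compose: "clinear_op T \<Longrightarrow> rank_one x y o\<^sub>L T = rank_one x (adj T y)"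
  by (rule blinfun_eqI) (simp add: cinner_adj_left)

lemma rank_one_add_left: "rank_one (x + y) z = rank_one x z + rank_one y z"
  and rank_one_scaleC_left: "rank_one (c *\<^sub>C x) z = c *\<^sub>C rank_one x z"
  and rank_one_zero_left [simp]: "rank_one 0 z = 0"
  by (rule blinfun_eqI, simp add: blinfun_apply_simps cinner_simps scaleC_add_left scaleC_add_right
      scaleC_scaleC mult.commute)+

lemma norm_rank_one_le: "norm (rank_one x y) \<le> norm x * norm y"
proof (rule norm_blinfun_bound)
  fix z
  have "norm (rank_one x y z) \<le> (norm y * norm z) * norm x"
    by (simp add: norm_scaleC mult_right_mono[OF cinner_cmod_le])
  then show "norm (rank_one x y z) \<le> norm x * norm y * norm z" by (simp add: mult_ac)
qed simp

lemma tendsto_rank_one_left: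
  assumes "(f \<longlongrightarrow> x) F" shows "((\<lambda>n. rank_one (f n) y) \<longlongrightarrow> rank_one x y) F"
proof (rule Lim_null_comparison[of _ "\<lambda>n. norm (f n - x) * norm y", THEN LIM_zero_cancel])
  have "norm (rank_one (f n) y - rank_one x y) \<le> norm (f n - x) * norm y" for n
    using norm_rank_one_le[of "f n - x" y] rank_one_add_left[of "f n - x" x y] by simp
  then show "\<forall>\<^sub>F n in F. norm (rank_one (f n) y - rank_one x y) \<le> norm (f n - x) * norm y" by simp
  show "((\<lambda>n. norm (f n - x) * norm y) \<longlongrightarrow> 0) F"
    using tendsto_mult_left_zero[OF tendsto_norm_zero[OF LIM_zero[OF assms]]] by simp
qed

section \<open>Closure properties of the compact operators\<close>

lemma compact_opsI:
  assumes "clinear_op T" "blinfun_apply T ` cball 0 1 \<subseteq> K" "compact K"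
  shows "T \<in> compact_ops"
proof -
  have "closure (blinfun_apply T ` cball 0 1) \<subseteq> K"
    using assms by (simp add: closure_minimal compact_imp_closed)
  then have "closure (blinfun_apply T ` cball 0 1) = K \<inter> closure (blinfun_apply T ` cball 0 1)"
    by blast
  then have "compact (closure (blinfun_apply T ` cball 0 1))"
    by (metis assms(3) closed_closure compact_Int_closed)
  then show ?thesis using assms(1) by (simp add: compact_ops_def)
qed

lemma compact_ops_clinear: "T \<in> compact_ops \<Longrightarrow> clinear_op T"
  by (simp add: compact_ops_def)

lemma in_closure_image_ball: "norm x \<le> 1 \<Longrightarrow> blinfun_apply T x \<in> closure (blinfun_apply T ` cball 0 1)"
  by (intro subsetD[OF closure_subset] imageI) simp

lemma compact_ops_subsequence:
  assumes T: "T \<in> compact_ops" and x: "\<And>n::nat. norm (x n) \<le> 1"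
  shows "\<exists>l r. strict_mono (r :: nat \<Rightarrow> nat) \<and> (\<lambda>n. T (x (r n))) \<longlonglongrightarrow> l"
proof -
  have sc: "seq_compact (closure (blinfun_apply T ` cball 0 1))"
    using T by (simp add: compact_ops_def compact_eq_seq_compact_metric)
  have mem: "\<forall>n. T (x n) \<in> closure (blinfun_apply T ` cball 0 1)"
    using x by (simp add: in_closure_image_ball)
  obtain l r where "strict_mono (r :: nat \<Rightarrow> nat)" "((\<lambda>n. T (x n)) \<circ> r) \<longlonglongrightarrow> l"
    using seq_compactE[OF sc mem] by metis
  then show ?thesis by (auto simp: comp_def)
qed

lemma compact_ops_compose_left:
  assumes "clinear_op S" "T \<in> compact_ops" shows "S o\<^sub>L T \<in> compact_ops"
proof (rule compact_opsI)
  let ?K = "closure (blinfun_apply T ` cball 0 1)"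
  show "compact (blinfun_apply S ` ?K)"
    using assms(2) by (intro compact_continuous_image continuous_intros) (simp add: compact_ops_def)
  show "blinfun_apply (S o\<^sub>L T) ` cball 0 1 \<subseteq> blinfun_apply S ` ?K"
    by (auto intro!: imageI in_closure_image_ball)
qed (use assms compact_ops_clinear clinear_op_compose in blast)

lemma compact_ops_scaleC:
  assumes "T \<in> compact_ops" shows "c *\<^sub>C T \<in> compact_ops"
proof (rule compact_opsI)
  let ?K = "closure (blinfun_apply T ` cball 0 1)"
  show "compact ((*\<^sub>C) c ` ?K)"
    using assms by (intro compact_continuous_image continuous_intros) (simp add: compact_ops_def)
  show "blinfun_apply (c *\<^sub>C T) ` cball 0 1 \<subseteq> (*\<^sub>C) c ` ?K"
    by (auto intro!: imageI in_closure_image_ball)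
qed (use assms compact_ops_clinear clinear_op_scaleC in blast)

lemma compact_ops_compose_right:
  assumes "clinear_op S" "T \<in> compact_ops" shows "T o\<^sub>L S \<in> compact_ops"
proof -
  \<comment> \<open>S/k maps the unit ball into itself; the summand 1 keeps k positive when S =
    0.\<close>
  define k where "k = norm S + 1"
  have k: "k > 0" by (simp add: k_def add_nonneg_pos)
  have T: "clinear_op T" using assms compact_ops_clinear by blast
  have "complex_of_real (1 / k) *\<^sub>C (T o\<^sub>L S) \<in> compact_ops"
  proof (rule compact_opsI)
    let ?K = "closure (blinfun_apply T ` cball 0 1)"
    show "compact ?K" using assms by (simp add: compact_ops_def)
    have "(1 / k) *\<^sub>R S x \<in> cball 0 1" if "norm x \<le> 1" for x
    proof -
      have "norm (S x) \<le> norm S * norm x" by (rule norm_blinfun)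
      also have "\<dots> \<le> norm S * 1" using that by (intro mult_left_mono) auto
      finally show ?thesis using k by (simp add: k_def)
    qed
    then have "T ((1 / k) *\<^sub>R S x) \<in> ?K" if "norm x \<le> 1" for x
      using that by (intro subsetD[OF closure_subset] imageI)
    then show "blinfun_apply (complex_of_real (1 / k) *\<^sub>C (T o\<^sub>L S)) ` cball 0 1 \<subseteq> ?K"
      by (auto simp: scaleR_scaleC clinear_opD[OF T])
  qed (intro clinear_op_scaleC clinear_op_compose T assms)
  then have "complex_of_real k *\<^sub>C complex_of_real (1 / k) *\<^sub>C (T o\<^sub>L S) \<in> compact_ops"
    by (rule compact_ops_scaleC)
  then show ?thesis using k by (simp add: scaleC_scaleC scaleC_one flip: of_real_mult)
qed

lemma compact_ops_add:
  assumes "S \<in> compact_ops" "T \<in> compact_ops" shows "S + T \<in> compact_ops"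
proof (rule compact_opsI)
  let ?K = "closure (blinfun_apply S ` cball 0 1)" and ?L = "closure (blinfun_apply T ` cball 0 1)"
  show "compact {x + y |x y. x \<in> ?K \<and> y \<in> ?L}"
    using assms by (intro compact_sums) (auto simp: compact_ops_def)
  show "blinfun_apply (S + T) ` cball 0 1 \<subseteq> {x + y |x y. x \<in> ?K \<and> y \<in> ?L}"
    by (auto simp: blinfun.add_left) (blast intro: in_closure_image_ball)
qed (use assms compact_ops_clinear clinear_op_add in blast)

lemma rank_one_compact: "rank_one x y \<in> compact_ops"
proof (rule compact_opsI)
  show "compact ((\<lambda>c. c *\<^sub>C x) ` cball 0 (norm y))"
    by (intro compact_continuous_image continuous_intros) simp
  have "cmod (cinner y z) \<le> norm y" if "norm z \<le> 1" for z
    using cinner_cmod_le[of y z] mult_left_mono[OF that norm_ge_zero[of y]] by simp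
  then show "blinfun_apply (rank_one x y) ` cball 0 1 \<subseteq> (\<lambda>c. c *\<^sub>C x) ` cball 0 (norm y)"
    by auto
qed simp

lemma csubspace_compact_ops: "csubspace compact_ops"
  using rank_one_compact[of 0 0] by (simp add: csubspace_def compact_ops_add compact_ops_scaleC)

section \<open>Orthogonal projections as operators\<close>

definition is_projection :: "('a::chilbert_space \<Rightarrow>\<^sub>L 'a) \<Rightarrow> bool" where
  "is_projection p \<longleftrightarrow> clinear_op p \<and> p o\<^sub>L p = p \<and> (\<forall>x y. cinner (p x) y = cinner x (p y))"

lemma is_projectionD:
  assumes "is_projection p"
  shows "clinear_op p" "p (p x) = p x" "cinner (p x) y = cinner x (p y)" "adj p = p"
proof -
  show "p (p x) = p x"
    using assms by (metis blinfun_apply_blinfun_compose is_projection_def)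
qed (use assms adj_unique in \<open>auto simp: is_projection_def\<close>)

lemma is_projection_pythagoras:
  assumes "is_projection p"
  shows "(norm x)\<^sup>2 = (norm (p x))\<^sup>2 + (norm (x - p x))\<^sup>2"
proof -
  have "cinner (p x) (x - p x) = 0"
    using assms by (simp add: is_projectionD blinfun_apply_simps)
  then show ?thesis using norm_add_square[of "p x" "x - p x"] by simp
qed

lemma is_projection_norm_apply_le: "is_projection p \<Longrightarrow> norm (p x) \<le> norm x"
  using is_projection_pythagoras[of p x] by (simp add: power2_le_imp_le)

lemma is_projection_norm_le: "is_projection p \<Longrightarrow> norm p \<le> 1"
  by (rule norm_blinfun_bound) (simp_all add: is_projection_norm_apply_le)

lemma is_projection_fixes_unit:
  assumes "is_projection p" "p \<noteq> 0"
  obtains x where "norm x = 1" "p x = x"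
proof -
  obtain y where y: "p y \<noteq> 0" using assms(2) blinfun_eqI[of p 0] by auto
  define x where "x = (1 / norm (p y)) *\<^sub>R p y"
  have "norm x = 1" "p x = x"
    using y assms by (simp_all add: x_def blinfun.scaleR_right is_projectionD)
  then show thesis by (rule that)
qed

lemma is_projection_rank_one: "norm x = 1 \<Longrightarrow> is_projection (rank_one x x)"
  by (auto simp: is_projection_def cinner_simps cinner_self_unit scaleC_one
      intro: blinfun_eqI simp flip: cinner_commute)

text \<open>The decomposition only picks some m for each x. Since M meets its orthogonal complement
  in 0 alone, the pick is unique, and uniqueness gives linearity.\<close>

lemma projection_onto:
  fixes M :: "'a::chilbert_space set"
  assumes M: "closed_csubspace M"
  shows "\<exists>p. is_projection p \<and> (\<forall>x. p x \<in> M) \<and> (\<forall>x\<in>M. p x = x) \<and> (\<forall>x\<in>orth_compl M. p x = 0)"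
proof -
  have sub: "csubspace M" using M by (simp add: closed_csubspace_def)
  obtain f where f: "f x \<in> M" "x - f x \<in> orth_compl M" for x
    using orthogonal_decomposition[OF M] by metis
  have f_eq: "f x = m" if "m \<in> M" "x - m \<in> orth_compl M" for x m
  proof -
    have "f x - m = (x - m) - (x - f x)" by simp
    then have "f x - m \<in> orth_compl M"
      using f that csubspace_diff[OF csubspace_orth_compl] by metis
    moreover have "f x - m \<in> M" using f that sub by (simp add: csubspace_diff)
    ultimately show ?thesis using orth_compl_inter by fastforce
  qed
  have orth: "cinner (f x) (y - f y) = 0" for x y
    using f by (auto simp: orth_compl_def)
  have "\<exists>p. clinear_op p \<and> (\<forall>x. p x = f x)"
  proof (rule clinear_blinfunI)
    show "f (x + y) = f x + f y" for x y
    proof (rule f_eq)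
      have "x + y - (f x + f y) = (x - f x) + (y - f y)" by simp
      then show "x + y - (f x + f y) \<in> orth_compl M"
        using f csubspace_add[OF csubspace_orth_compl] by metis
    qed (use f sub in \<open>simp add: csubspace_add\<close>)
    show "f (c *\<^sub>C x) = c *\<^sub>C f x" for c x
    proof (rule f_eq)
      show "c *\<^sub>C x - c *\<^sub>C f x \<in> orth_compl M"
        using f csubspace_scaleC[OF csubspace_orth_compl] by (metis scaleC_diff_right)
    qed (use f sub in \<open>simp add: csubspace_scaleC\<close>)
    show "norm (f x) \<le> norm x * 1" for x
    proof -
      have "(norm x)\<^sup>2 = (norm (f x))\<^sup>2 + (norm (x - f x))\<^sup>2"
        using norm_add_square[of "f x" "x - f x"] orth[of x x] by simp
      then show ?thesis by (simp add: power2_le_imp_le)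
    qed
  qed
  then obtain p where p: "clinear_op p" "\<And>x. p x = f x" by blast
  have "cinner (f x) y = cinner x (f y)" for x y
    using orth[of x y] orth[of y x] cinner_eq_zero_commute[of "f y" "x - f x"]
    by (simp add: cinner_simps)
  moreover have fM: "f x = x" if "x \<in> M" for x
    using that by (intro f_eq) (auto simp: csubspace_0 csubspace_orth_compl)
  moreover have "f x = 0" if "x \<in> orth_compl M" for x
    using that sub by (intro f_eq) (auto simp: csubspace_0)
  ultimately show ?thesis
    using p f by (intro exI[of _ p]) (auto simp: is_projection_def intro!: blinfun_eqI)
qed

section \<open>Minimal projections in algebras of compact operators\<close>

lemma
  assumes "cstar_subalgebra C A"
  shows cstar_subalgebra_subset: "C \<subseteq> A"
    and cstar_subalgebra_csubspace: "csubspace C"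
    and cstar_subalgebra_closed: "closed C"
    and cstar_subalgebra_compose: "S \<in> C \<Longrightarrow> T \<in> C \<Longrightarrow> S o\<^sub>L T \<in> C"
    and cstar_subalgebra_adj: "T \<in> C \<Longrightarrow> adj T \<in> C"
  using assms by (auto simp: cstar_subalgebra_def)

lemma cinner_adj_self: "clinear_op c \<Longrightarrow> cinner (adj c (c x)) x = of_real ((norm (c x))\<^sup>2)"
  by (simp add: cinner_adj_left cinner_self del: of_real_power)

text \<open>Vectors x_n of the unit ball with norm (c x_n) tending to 1 are approximate fixed points
  of S, the product of \<open>adj c\<close> and c. Compactness of S makes a subsequence of S x_n
  converge, hence also of x_n, and the limit is a true fixed point.\<close>

lemma compact_op_attains_norm:
  fixes c :: "'a::chilbert_space \<Rightarrow>\<^sub>L 'a"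
  assumes c: "c \<in> compact_ops" and nc: "norm c = 1"
  shows "\<exists>y. norm y = 1 \<and> adj c (c y) = y"
proof -
  have lin: "clinear_op c" using c by (rule compact_ops_clinear)
  define S where "S = adj c o\<^sub>L c"
  have S: "S \<in> compact_ops"
    unfolding S_def by (intro compact_ops_compose_left clinear_op_adj lin c)
  have c_le: "norm (c x) \<le> norm x" for x using norm_blinfun[of c x] nc by simp
  have S_le: "norm (S x) \<le> norm x" for x
    using norm_blinfun[of "adj c" "c x"] norm_adj[OF lin] nc c_le[of x] by (simp add: S_def)
  have "\<exists>x. norm x \<le> 1 \<and> norm (c x) > 1 - 1 / (real n + 1)" for n
  proof (rule ccontr)
    assume "\<not> ?thesis"
    then have *: "norm (c x) \<le> 1 - 1 / (real n + 1)" if "norm x \<le> 1" for x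
      using that by (auto simp: not_less)
    have "norm c \<le> 1 - 1 / (real n + 1)"
    proof (rule norm_blinfun_bound)
      show "norm (c x) \<le> (1 - 1 / (real n + 1)) * norm x" for x
      proof (cases "x = 0")
        case False
        then have "norm (c ((1 / norm x) *\<^sub>R x)) \<le> 1 - 1 / (real n + 1)"
          by (intro *) simp
        then show ?thesis using False by (simp add: blinfun.scaleR_right field_simps)
      qed simp
    qed (simp add: field_simps)
    then show False using nc by simp
  qed
  then obtain x where x: "\<And>n. norm (x n) \<le> 1" "\<And>n. norm (c (x n)) > 1 - 1 / (real n + 1)"
    by metis
  have cx: "(\<lambda>n. norm (c (x n))) \<longlonglongrightarrow> 1"
  proof (rule tendsto_sandwich[OF always_eventually always_eventually])
    show "(\<lambda>n. 1 - 1 / (real n + 1)) \<longlonglongrightarrow> 1"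
      using tendsto_diff[OF tendsto_const[of "1::real"] LIMSEQ_inverse_real_of_nat]
      by (simp add: inverse_eq_divide add.commute)
    show "\<forall>n. 1 - 1 / (real n + 1) \<le> norm (c (x n))" using x(2) less_imp_le by blast
    show "\<forall>n. norm (c (x n)) \<le> 1" using x(1) c_le order_trans by blast
  qed simp
  \<comment> \<open>Expand the square: <Sx|x> is the squared norm of c x, and the norms of S x and x
    are at most 1.\<close>
  have approx: "(norm (S (x n) - x n))\<^sup>2 \<le> 2 - 2 * (norm (c (x n)))\<^sup>2" for n
  proof -
    have "(norm (S (x n)))\<^sup>2 \<le> 1" "(norm (x n))\<^sup>2 \<le> 1"
      using S_le[of "x n"] x(1)[of n] by (auto simp: abs_square_le_1)
    moreover have "cinner (S (x n)) (x n) = of_real ((norm (c (x n)))\<^sup>2)"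
      using cinner_adj_self[OF lin, of "x n"] by (simp add: S_def)
    ultimately show ?thesis by (simp add: norm_diff_square del: of_real_power)
  qed
  have "(\<lambda>n. 2 - 2 * (norm (c (x n)))\<^sup>2) \<longlonglongrightarrow> 2 - 2 * 1\<^sup>2"
    by (intro tendsto_intros cx)
  then have "(\<lambda>n. 2 - 2 * (norm (c (x n)))\<^sup>2) \<longlonglongrightarrow> 0" by simp
  then have "(\<lambda>n. (norm (S (x n) - x n))\<^sup>2) \<longlonglongrightarrow> 0"
    by (rule tendsto_sandwich[OF always_eventually always_eventually tendsto_const, rotated 2])
      (use approx in auto)
  then have "(\<lambda>n. sqrt ((norm (S (x n) - x n))\<^sup>2)) \<longlonglongrightarrow> sqrt 0" by (rule tendsto_real_sqrt)
  then have diff: "(\<lambda>n. S (x n) - x n) \<longlonglongrightarrow> 0" by (simp add: tendsto_norm_zero_iff)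
  obtain r y where r: "strict_mono (r :: nat \<Rightarrow> nat)" and y: "(\<lambda>n. S (x (r n))) \<longlonglongrightarrow> y"
    using compact_ops_subsequence[OF S, of x] x(1) by blast
  have "(\<lambda>n. S (x (r n)) - (S (x (r n)) - x (r n))) \<longlonglongrightarrow> y - 0"
    using LIMSEQ_subseq_LIMSEQ[OF diff r] by (intro tendsto_diff y) (simp add: comp_def)
  then have xy: "(\<lambda>n. x (r n)) \<longlonglongrightarrow> y" by simp
  have "S y = y"
    using blinfun.tendsto[OF tendsto_const xy, of S] y LIMSEQ_unique by blast
  moreover have "norm (c y) = 1"
    using tendsto_norm[OF blinfun.tendsto[OF tendsto_const xy, of c]]
      LIMSEQ_subseq_LIMSEQ[OF cx r] LIMSEQ_unique by (auto simp: comp_def)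
  moreover have "norm y \<le> 1"
    using tendsto_norm[OF xy] x(1) by (intro LIMSEQ_le_const2) auto
  ultimately show ?thesis using c_le[of y] by (intro exI[of _ y]) (auto simp: S_def)
qed

text \<open>
  With \<open>\<parallel>b\<parallel> = 1\<close>, the operator \<open>b\<^sup>*b\<close> is the identity on its eigenspace for the eigenvalue 1
  and has norm less than 1 on the orthogonal complement, so its powers converge in norm to the
  projection onto the eigenspace.
\<close>

lemma eigenprojection:
  fixes b :: "'a::chilbert_space \<Rightarrow>\<^sub>L 'a"
  assumes C: "cstar_subalgebra C compact_ops" and b: "b \<in> C" and nb: "norm b = 1"
  shows "\<exists>p\<in>C. is_projection p \<and> p \<noteq> 0 \<and> (\<forall>x. p x = x \<longleftrightarrow> adj b (b x) = x)"
proof -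
  have bK: "b \<in> compact_ops" using b cstar_subalgebra_subset[OF C] by blast
  have lin: "clinear_op b" using bK by (rule compact_ops_clinear)
  define S where "S = adj b o\<^sub>L b"
  have SC: "S \<in> C" unfolding S_def
    using C b by (intro cstar_subalgebra_compose[OF C] cstar_subalgebra_adj[OF C])
  have Slin: "clinear_op S" unfolding S_def by (intro clinear_op_compose clinear_op_adj lin)
  have S_adj: "cinner (S x) y = cinner x (S y)" for x y
    by (simp add: S_def cinner_adj_left lin cinner_adj_right)
  define E where "E = {x. S x = x}"
  have E: "closed_csubspace E"
    unfolding closed_csubspace_def csubspace_def E_def
    by (auto simp: blinfun.add_right clinear_opD[OF Slin] intro!: closed_Collect_eq continuous_intros)
  obtain p where p: "is_projection p" and pE: "\<And>x. p x \<in> E" and p_id: "\<And>x. x \<in> E \<Longrightarrow> p x = x"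
    using projection_onto[OF E] by blast
  note pD = is_projectionD[OF p]
  have Sp: "S (p x) = p x" for x using pE[of x] by (simp add: E_def)
  have pS: "p (S x) = p x" for x
    by (rule cinner_extensionality) (simp add: Sp flip: pD(3) S_adj)
  have fix_iff: "p x = x \<longleftrightarrow> S x = x" for x
    using pE[of x] p_id[of x] by (auto simp: E_def)
  \<comment> \<open>Here b is cut down to the complement of the eigenspace; consequently the product
    of \<open>adj b'\<close> and \<open>b'\<close> is S - p.\<close>
  define b' where "b' = b - (b o\<^sub>L p)"
  have b'K: "b' \<in> compact_ops" unfolding b'_def
    by (intro csubspace_diff[OF csubspace_compact_ops] bK compact_ops_compose_right pD)
  have b'_apply: "b' x = b (x - p x)" for x by (simp add: b'_def blinfun_apply_simps)
  have lin': "clinear_op b'" using b'K by (rule compact_ops_clinear)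
  have adj': "adj b' = adj b - (p o\<^sub>L adj b)"
    unfolding b'_def by (simp add: adj_diff adj_compose clinear_op_compose lin pD)
  have S': "adj b' (b' x) = S x - p x" for x
  proof -
    have "adj b' (b' x) = S (x - p x) - p (S (x - p x))"
      by (simp add: adj' b'_apply blinfun.diff_left S_def)
    then show ?thesis by (simp add: blinfun_apply_simps pS Sp pD)
  qed
  have "norm b' \<le> 1"
  proof (rule norm_blinfun_bound)
    fix x
    have "norm (b' x) \<le> norm b * norm (x - p x)" unfolding b'_apply by (rule norm_blinfun)
    also have "\<dots> \<le> 1 * norm x"
      using is_projection_pythagoras[OF p, of x] nb by (simp add: power2_le_imp_le)
    finally show "norm (b' x) \<le> 1 * norm x" .
  qed simp
  \<comment> \<open>A norm of 1 would be attained at a unit vector y fixed by S - p. Applying p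
    gives p y = 0, so S fixes y and y lies in the eigenspace, on which p is the identity.\<close>
  moreover have "norm b' \<noteq> 1"
  proof
    assume "norm b' = 1"
    then obtain y where y: "norm y = 1" "S y - p y = y"
      using compact_op_attains_norm[OF b'K] S' by auto
    have "p (S y - p y) = p y" using y by simp
    then have "p y = 0" by (simp add: blinfun_apply_simps pS pD)
    then have "y = 0" using y(2) fix_iff[of y] by simp
    then show False using y(1) by simp
  qed
  ultimately have k: "norm b' < 1" by simp
  \<comment> \<open>This is the power S^(n+1). The iteration starts from S because the identity need
    not belong to C.\<close>
  define f where "f n = ((o\<^sub>L) S ^^ n) S" for n
  have f_Suc: "f (Suc n) = S o\<^sub>L f n" for n by (simp add: f_def)
  have fC: "f n \<in> C" for n
  proof (induction n)
    case 0 then show ?case using SC by (simp add: f_def)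
  next
    case (Suc n) then show ?case unfolding f_Suc using cstar_subalgebra_compose[OF C SC] by blast
  qed
  \<comment> \<open>The second conjunct keeps the error in the kernel of p, where S acts as the
    contraction S - p; each step therefore shrinks it.\<close>
  have "norm (f n - p) \<le> norm b' ^ n \<and> (\<forall>x. p (f n x - p x) = 0)" for n
  proof (induction n)
    case 0
    have "norm (S - p) \<le> 1"
    proof (rule norm_blinfun_bound)
      fix x
      have "norm (adj b' (b' x)) \<le> 1 * norm x"
        using norm_blinfun[of "adj b'" "b' x"] norm_blinfun[of b' x] norm_adj[OF lin'] k
          mult_mono[of "norm b'" 1 "norm (b' x)" "norm x"]
          mult_right_mono[of "norm b'" 1 "norm x"]
        by simp
      then show "norm ((S - p) x) \<le> 1 * norm x" by (simp add: S' blinfun.diff_left)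
    qed simp
    then show ?case by (simp add: f_def blinfun_apply_simps pS pD)
  next
    case (Suc n)
    have eq: "f (Suc n) - p = (adj b' o\<^sub>L b') o\<^sub>L (f n - p)"
    proof (rule blinfun_eqI)
      fix x
      have "p (f n x - p x) = 0" using Suc by blast
      then show "(f (Suc n) - p) x = (adj b' o\<^sub>L b' o\<^sub>L (f n - p)) x"
        by (simp add: f_Suc blinfun.diff_left S') (simp add: blinfun.diff_right Sp)
    qed
    have "norm (adj b' o\<^sub>L b') \<le> norm b' * norm b'"
      using norm_blinfun_compose[of "adj b'" b'] norm_adj[OF lin'] by simp
    also have "\<dots> \<le> norm b' * 1" using k by (intro mult_left_mono) auto
    finally have "norm (f (Suc n) - p) \<le> norm b' * norm (f n - p)"
      unfolding eq using norm_blinfun_compose[of "adj b' o\<^sub>L b'" "f n - p"]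
        mult_right_mono[of "norm (adj b' o\<^sub>L b')" "norm b'" "norm (f n - p)"] by simp
    also have "\<dots> \<le> norm b' * norm b' ^ n" using Suc by (intro mult_left_mono) auto
    finally show ?case using Suc
      by (simp add: f_Suc blinfun_apply_simps pS pD)
  qed
  then have bound: "norm (f n - p) \<le> norm b' ^ n" for n by blast
  have "(\<lambda>n. norm b' ^ n) \<longlonglongrightarrow> 0" using k by (intro LIMSEQ_power_zero) simp
  then have "(\<lambda>n. f n - p) \<longlonglongrightarrow> 0"
    by (rule Lim_null_comparison[rotated]) (simp add: bound)
  then have "f \<longlonglongrightarrow> p" by (rule LIM_zero_cancel)
  then have "p \<in> C" using closed_sequentially[OF cstar_subalgebra_closed[OF C]] fC by blast
  moreover have "p \<noteq> 0"
  proof -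
    obtain y where "norm y = 1" "S y = y"
      using compact_op_attains_norm[OF bK nb] by (auto simp: S_def)
    then have "p y \<noteq> 0" using fix_iff[of y] by auto
    then show ?thesis by auto
  qed
  ultimately show ?thesis using p fix_iff by (intro bexI[of _ p]) (auto simp: S_def)
qed

text \<open>Taking adjoints in pq = q gives qp = q.\<close>

lemma is_projection_le_commute:
  assumes "is_projection p" "is_projection q" "\<And>x. p (q x) = q x"
  shows "q (p x) = q x"
  by (rule cinner_extensionality)
    (simp add: assms(3) flip: is_projectionD(3)[OF assms(1)] is_projectionD(3)[OF assms(2)])

text \<open>
  A strictly decreasing sequence of projections yields an orthonormal sequence in the range
  of the first one, which has no convergent subsequence.
\<close>

lemma wf_compact_projections:
  "wf {(q, p :: 'a::chilbert_space \<Rightarrow>\<^sub>L 'a).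
     is_projection q \<and> is_projection p \<and> p \<in> compact_ops \<and> (\<forall>x. p (q x) = q x) \<and> q \<noteq> p}"
  unfolding wf_iff_no_infinite_down_chain
proof
  assume "\<exists>f. \<forall>i. (f (Suc i), f i) \<in> {(q, p :: 'a \<Rightarrow>\<^sub>L 'a).
     is_projection q \<and> is_projection p \<and> p \<in> compact_ops \<and> (\<forall>x. p (q x) = q x) \<and> q \<noteq> p}"
  then obtain f :: "nat \<Rightarrow> 'a \<Rightarrow>\<^sub>L 'a" where f: "\<And>i. is_projection (f i)" "f 0 \<in> compact_ops"
    "\<And>i x. f i (f (Suc i) x) = f (Suc i) x" "\<And>i. f (Suc i) \<noteq> f i"
    by auto
  have chain: "f i (f (i + k) x) = f (i + k) x" for i k x
  proof (induction k arbitrary: x)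
    case 0
    then show ?case by (simp add: is_projectionD[OF f(1)])
  next
    case (Suc k)
    have "f i (f (i + Suc k) x) = f i (f (i + k) (f (i + Suc k) x))" by (simp add: f(3))
    also have "\<dots> = f (i + Suc k) x" unfolding Suc by (simp add: f(3))
    finally show ?case .
  qed
  \<comment> \<open>Each strict descent leaves room for a unit vector in the range of one projection
    and the kernel of the next; these vectors are mutually orthogonal.\<close>
  have "\<exists>x. norm x = 1 \<and> f i x = x \<and> f (Suc i) x = 0" for i
  proof -
    obtain z where z: "f i z - f (Suc i) z \<noteq> 0"
      using f(4)[of i] by (metis blinfun_eqI eq_iff_diff_eq_0)
    define x where "x = (1 / norm (f i z - f (Suc i) z)) *\<^sub>R (f i z - f (Suc i) z)"
    have "norm x = 1" "f i x = x" "f (Suc i) x = 0"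
      using z is_projection_le_commute[OF f(1) f(1) f(3)]
      by (simp_all add: x_def blinfun.scaleR_right blinfun_apply_simps is_projectionD[OF f(1)] f(3))
    then show ?thesis by blast
  qed
  then obtain x where x: "\<And>i. norm (x i) = 1" "\<And>i. f i (x i) = x i" "\<And>i. f (Suc i) (x i) = 0"
    by metis
  have orth: "cinner (x i) (x j) = 0" if "i < j" for i j
  proof -
    obtain k where "j = Suc i + k" using less_imp_Suc_add[OF \<open>i < j\<close>] by auto
    then have "f (Suc i) (x j) = x j" using chain[of "Suc i" k "x j"] x(2)[of j] by simp
    then have "cinner (x i) (x j) = cinner (f (Suc i) (x i)) (x j)"
      by (simp add: is_projectionD(3)[OF f(1)])
    then show ?thesis by (simp add: x(3))
  qed
  have f0: "f 0 (x i) = x i" for i using chain[of 0 i "x i"] x(2)[of i] by simp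
  obtain l r where r: "strict_mono (r :: nat \<Rightarrow> nat)" and l: "(\<lambda>n. f 0 (x (r n))) \<longlonglongrightarrow> l"
    using compact_ops_subsequence[OF f(2), of x] x(1) by auto
  have "Cauchy (\<lambda>n. x (r n))"
    using l unfolding f0 by (intro LIMSEQ_imp_Cauchy)
  then obtain N where "\<And>m n. m \<ge> N \<Longrightarrow> n \<ge> N \<Longrightarrow> dist (x (r m)) (x (r n)) < 1"
    by (metis Cauchy_def zero_less_one)
  then have "dist (x (r N)) (x (r (Suc N))) < 1" by simp
  \<comment> \<open>Orthonormal vectors are sqrt 2 apart.\<close>
  moreover have "(norm (x (r N) - x (r (Suc N))))\<^sup>2 = 2"
    using orth[of "r N" "r (Suc N)"] r by (simp add: norm_diff_square x(1) strict_mono_Suc_iff)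
  ultimately show False
    using power_mono[of "norm (x (r N) - x (r (Suc N)))" 1 2] by (simp add: dist_norm)
qed

text \<open>p is minimal among the nonzero projections of C. If d in C satisfies dp = d, the top
  eigenprojection of d* d lies below p, hence equals p, and d* d is the multiple of p by the squared
  norm of d. This rigidity makes the self-adjoint elements of pCp scalar, and then all elements
  through their real and imaginary parts.\<close>

lemma minimal_projection:
  fixes C :: "('a::chilbert_space \<Rightarrow>\<^sub>L 'a) set"
  assumes C: "cstar_subalgebra C compact_ops" and ne: "C \<noteq> {0}"
  obtains p where "p \<in> C" "is_projection p" "p \<noteq> 0"
    "\<And>b. b \<in> C \<Longrightarrow> \<exists>c. p o\<^sub>L b o\<^sub>L p = c *\<^sub>C p"
proof -
  note sub = cstar_subalgebra_csubspace[OF C]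
  have linC: "clinear_op d" if "d \<in> C" for d
    using that cstar_subalgebra_subset[OF C] compact_ops_clinear by blast
  \<comment> \<open>Rescaling d to norm one turns the eigenvalue 1 of \<open>eigenprojection\<close>
    into the squared norm of d.\<close>
  have eigen: "\<exists>q\<in>C. is_projection q \<and> q \<noteq> 0 \<and> (\<forall>x. q x = x \<longleftrightarrow> adj d (d x) = (norm d)\<^sup>2 *\<^sub>R x)"
    if d: "d \<in> C" "d \<noteq> 0" for d
  proof -
    define b where "b = of_real (1 / norm d) *\<^sub>C d"
    have b: "b \<in> C" "norm b = 1"
      using d sub by (auto simp: b_def norm_scaleC csubspace_scaleC norm_divide)
    have "adj b (b x) = of_real (1 / (norm d)\<^sup>2) *\<^sub>C adj d (d x)" for x
      using linC[OF d(1)]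
      by (simp add: b_def adj_scaleC clinear_opD clinear_op_adj scaleC_scaleC power2_eq_square)
    then have "adj b (b x) = (1 / (norm d)\<^sup>2) *\<^sub>R adj d (d x)" for x
      by (simp only: scaleR_scaleC)
    moreover have "(1 / (norm d)\<^sup>2) *\<^sub>R y = x \<longleftrightarrow> y = (norm d)\<^sup>2 *\<^sub>R x" for x y :: 'a
      using d(2) by auto
    ultimately have "adj b (b x) = x \<longleftrightarrow> adj d (d x) = (norm d)\<^sup>2 *\<^sub>R x" for x
      by simp
    then show ?thesis using eigenprojection[OF C b] by simp
  qed
  let ?R = "{(q, p :: 'a \<Rightarrow>\<^sub>L 'a).
     is_projection q \<and> is_projection p \<and> p \<in> compact_ops \<and> (\<forall>x. p (q x) = q x) \<and> q \<noteq> p}"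
  let ?Q = "{q \<in> C. is_projection q \<and> q \<noteq> 0}"
  obtain d0 where "d0 \<in> C" "d0 \<noteq> 0" using ne csubspace_0[OF sub] by blast
  then obtain q0 where "q0 \<in> ?Q" using eigen by blast
  then obtain p where pQ: "p \<in> ?Q" and p_min: "\<And>q. (q, p) \<in> ?R \<Longrightarrow> q \<notin> ?Q"
    using wfE_min[OF wf_compact_projections \<open>q0 \<in> ?Q\<close>] by blast
  then have p: "is_projection p" and pC: "p \<in> C" and p0: "p \<noteq> 0" by auto
  note pD = is_projectionD[OF p]
  have pK: "p \<in> compact_ops" using pC cstar_subalgebra_subset[OF C] by blast
  have dd: "adj d (d x) = (norm d)\<^sup>2 *\<^sub>R p x" if d: "d \<in> C" "d \<noteq> 0" "\<And>x. d (p x) = d x" for d x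
  proof -
    note lin = linC[OF d(1)]
    obtain q where q: "q \<in> C" "is_projection q" "q \<noteq> 0"
      "\<And>x. q x = x \<longleftrightarrow> adj d (d x) = (norm d)\<^sup>2 *\<^sub>R x"
      using eigen[OF d(1,2)] by blast
    have p_adj: "p (adj d y) = adj d y" for y
      by (rule cinner_extensionality) (simp add: d(3) lin flip: pD(3) cinner_adj_right)
    have pq: "p (q x) = q x" for x
    proof -
      have qx: "q x = (1 / (norm d)\<^sup>2) *\<^sub>R adj d (d (q x))"
        using q(4)[of "q x"] is_projectionD(2)[OF q(2)] d(2) by simp
      have "p (q x) = (1 / (norm d)\<^sup>2) *\<^sub>R p (adj d (d (q x)))"
        by (subst qx) (rule blinfun.scaleR_right)
      then show ?thesis using p_adj qx by simp
    qed
    have "q = p"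
    proof (rule ccontr)
      assume "q \<noteq> p"
      then have "(q, p) \<in> ?R" using p q(2) pK pq by blast
      then show False using p_min q by blast
    qed
    then have "adj d (d (p x)) = (norm d)\<^sup>2 *\<^sub>R p x" using q(4)[of "p x"] pD by simp
    then show ?thesis by (simp add: d(3))
  qed
  have selfadj: "\<exists>t. d = t *\<^sub>C p"
    if d: "d \<in> C" "adj d = d" "\<And>x. d (p x) = d x" "\<And>x. p (d x) = d x" for d
  proof (cases "d = 0")
    case True
    then show ?thesis by (intro exI[of _ 0]) simp
  next
    case False
    define m where "m = complex_of_real (norm d)"
    \<comment> \<open>By \<open>dd\<close>, d^2 = m^2 p, which factors as uv = 0. If u is nonzero,
      u* u is a positive multiple of p, so uv = 0 forces v = pv = 0; hence d is m p or -m p.\<close>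
    define u v where "u = d - m *\<^sub>C p" and "v = d + m *\<^sub>C p"
    have uC: "u \<in> C" and uv: "u (v x) = 0" for x
    proof -
      show "u \<in> C" unfolding u_def using sub d(1) pC by (simp add: csubspace_diff csubspace_scaleC)
      have "d (d x) = (m * m) *\<^sub>C p x"
        using dd[OF d(1) False d(3)] d(2)
        by (simp add: m_def power2_eq_square scaleR_scaleC)
      then show "u (v x) = 0"
        by (simp add: u_def v_def blinfun_apply_simps clinear_opD[OF linC[OF d(1)]] clinear_opD[OF pD(1)]
            d(3,4) pD(2) scaleC_add_right scaleC_scaleC)
    qed
    show ?thesis
    proof (cases "u = 0")
      case True
      then have "d = m *\<^sub>C p" by (simp add: u_def)
      then show ?thesis by blast
    next
      case u0: False
      have up: "u (p x) = u x" for x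
        by (simp add: u_def blinfun_apply_simps d(3) pD(2))
      have pv: "p (v x) = v x" for x
        by (simp add: v_def blinfun_apply_simps d(4) pD(2) clinear_opD[OF pD(1)])
      have "v x = 0" for x
        using dd[OF uC u0 up, of "v x"] u0 by (simp add: uv pv)
      then have "v = 0" by (intro blinfun_eqI) simp
      then have "d = (- m) *\<^sub>C p" by (simp add: v_def add_eq_0_iff2)
      then show ?thesis by blast
    qed
  qed
  have "\<exists>t. p o\<^sub>L b o\<^sub>L p = t *\<^sub>C p" if b: "b \<in> C" for b
  proof -
    define c where "c = p o\<^sub>L b o\<^sub>L p"
    have cC: "c \<in> C" unfolding c_def by (intro cstar_subalgebra_compose[OF C] pC b)
    have c'C: "adj c \<in> C" using cstar_subalgebra_adj[OF C cC] .
    have lin: "clinear_op c" "clinear_op (adj c)" using linC cC c'C by auto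
    have cp: "c (p x) = c x" "p (c x) = c x" for x by (simp_all add: c_def pD(2))
    have adjc: "adj c = p o\<^sub>L adj b o\<^sub>L p"
      unfolding c_def using pD linC[OF b]
      by (intro blinfun_eqI) (simp add: adj_compose clinear_op_compose)
    have c'p: "adj c (p x) = adj c x" "p (adj c x) = adj c x" for x
      unfolding adjc by (simp_all add: pD(2))
    \<comment> \<open>Both \<open>c + adj c\<close> and i times \<open>c - adj c\<close> are
      self-adjoint, and c is recovered from the two.\<close>
    have "\<exists>t. c + adj c = t *\<^sub>C p"
      by (rule selfadj)
        (simp_all add: sub csubspace_add cC c'C adj_add adj_adj lin cp c'p blinfun_apply_simps add.commute)
    moreover have "\<exists>t. \<i> *\<^sub>C (c - adj c) = t *\<^sub>C p"
      by (rule selfadj)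
        (simp_all add: sub csubspace_diff csubspace_scaleC cC c'C adj_diff adj_scaleC clinear_op_diff clinear_op_scaleC
          adj_adj lin cp c'p clinear_opD[OF pD(1)] blinfun_apply_simps scaleC_diff_right)
    ultimately obtain s t where st: "c + adj c = s *\<^sub>C p" "\<i> *\<^sub>C (c - adj c) = t *\<^sub>C p" by blast
    have "c - adj c = (- \<i>) *\<^sub>C \<i> *\<^sub>C (c - adj c)" by (simp only: scaleC_scaleC) (simp add: scaleC_one)
    then have "c - adj c = (- \<i> * t) *\<^sub>C p" by (simp only: st scaleC_scaleC)
    then have "(c + adj c) + (c - adj c) = (s - \<i> * t) *\<^sub>C p"
      by (simp add: st scaleC_diff_left)
    moreover have "(c + adj c) + (c - adj c) = 2 *\<^sub>C c"
      using scaleC_add_left[of 1 1 c] by (simp add: scaleC_one)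
    ultimately have "(1/2) *\<^sub>C 2 *\<^sub>C c = (1/2) *\<^sub>C (s - \<i> * t) *\<^sub>C p" by simp
    then have "c = ((s - \<i> * t) / 2) *\<^sub>C p" by (simp add: scaleC_scaleC scaleC_one)
    then show ?thesis unfolding c_def by blast
  qed
  then show thesis using pC p p0 that by blast
qed

section \<open>Finite-rank approximation and the algebras of compact operators on a subspace\<close>

lemma norm_blinfun_le_on_ball:
  assumes "\<And>x. norm x \<le> 1 \<Longrightarrow> norm (blinfun_apply T x) \<le> k" "0 \<le> k"
  shows "norm T \<le> k"
proof (rule norm_blinfun_bound)
  show "norm (T x) \<le> k * norm x" for x
  proof (cases "x = 0")
    case False
    then have "norm (T ((1 / norm x) *\<^sub>R x)) \<le> k" by (intro assms) simp
    then show ?thesis using False by (simp add: blinfun.scaleR_right field_simps)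
  qed simp
qed fact

text \<open>The projections onto spans of finite orthonormal systems in M, built one vector at a
  time so that a claim about an additive functional of P reduces to a single rank-one
  summand.\<close>

inductive finite_projection :: "'a::chilbert_space set \<Rightarrow> ('a \<Rightarrow>\<^sub>L 'a) \<Rightarrow> bool" for M where
  zero: "finite_projection M 0"
| extend: "finite_projection M P \<Longrightarrow> e \<in> M \<Longrightarrow> norm e = 1 \<Longrightarrow> P e = 0
    \<Longrightarrow> finite_projection M (P + rank_one e e)"

lemma finite_projection_is_projection: "finite_projection M P \<Longrightarrow> is_projection P"
proof (induction rule: finite_projection.induct)
  case zero
  show ?case by (auto simp: is_projection_def clinear_op_0 intro: blinfun_eqI)
next
  case (extend P e)
  note pD = is_projectionD[OF extend.IH]
  have eP: "cinner e (P x) = 0" for x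
    using pD(3)[of e x] extend by simp
  show ?case unfolding is_projection_def
  proof (intro conjI allI)
    show "clinear_op (P + rank_one e e)" by (simp add: clinear_op_add pD)
    show "(P + rank_one e e) o\<^sub>L (P + rank_one e e) = P + rank_one e e"
      using extend(4) by (intro blinfun_eqI)
        (simp add: blinfun_apply_simps cinner_simps pD clinear_opD[OF pD(1)] eP
          cinner_self_unit[OF extend(3)])
    show "cinner ((P + rank_one e e) x) y = cinner x ((P + rank_one e e) y)" for x y
      by (simp add: blinfun_apply_simps cinner_simps pD flip: cinner_commute)
  qed
qed

lemma finite_projection_range:
  assumes "csubspace M" shows "finite_projection M P \<Longrightarrow> P x \<in> M"
  by (induction rule: finite_projection.induct)
    (simp_all add: blinfun.add_left assms csubspace_0 csubspace_add csubspace_scaleC)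

text \<open>One Gram-Schmidt step. That at most one rank-one summand is added matters later: a
  functional that is nonnegative on such summands cannot decrease from P to Q.\<close>

lemma finite_projection_extend:
  assumes M: "csubspace M" and P: "finite_projection M P" and y: "y \<in> M"
  shows "\<exists>Q. finite_projection M Q \<and> Q y = y \<and> (\<forall>x. P x = x \<longrightarrow> Q x = x) \<and>
    (Q = P \<or> (\<exists>e\<in>M. Q = P + rank_one e e))"
proof (cases "P y = y")
  case True
  then show ?thesis using P by blast
next
  case False
  note proj = finite_projection_is_projection[OF P]
  note pD = is_projectionD[OF proj]
  define e where "e = (1 / norm (y - P y)) *\<^sub>R (y - P y)"
  have e: "e \<in> M" "norm e = 1" "P e = 0"
    using False y finite_projection_range[OF M P]
    by (auto simp: e_def csubspace_scaleR csubspace_diff M blinfun.scaleR_right blinfun.diff_right pD)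
  have eP: "cinner e (P x) = 0" for x using pD(3)[of e x] e by simp
  have y_eq: "y - P y = norm (y - P y) *\<^sub>R e" using False by (simp add: e_def)
  have "cinner e y = cinner e (y - P y)" by (simp add: cinner_simps eP)
  also have "\<dots> = norm (y - P y)"
    by (subst y_eq) (simp add: scaleR_scaleC cinner_simps cinner_self_unit e(2) del: of_real_diff)
  finally have "cinner e y *\<^sub>C e = y - P y" using y_eq by (simp add: scaleR_scaleC)
  then have "(P + rank_one e e) y = y" by (simp add: blinfun.add_left)
  moreover have "(P + rank_one e e) x = x" if "P x = x" for x
    using eP[of x] that by (simp add: blinfun.add_left)
  ultimately show ?thesis
    using finite_projection.extend[OF P e(1,2,3)] e(1) by blast
qed

lemma finite_projection_covers:
  assumes M: "csubspace M" and Y: "finite Y" "Y \<subseteq> M"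
  shows "\<exists>P. finite_projection M P \<and> (\<forall>y\<in>Y. P y = y)"
  using Y
proof (induction Y rule: finite_induct)
  case empty
  then show ?case using finite_projection.zero by blast
next
  case (insert y Y)
  then obtain P where "finite_projection M P" "\<forall>y\<in>Y. P y = y" by auto
  then show ?case using finite_projection_extend[OF M, of P y] insert.prems by auto
qed

text \<open>P is chosen to fix a finite e-net of the closed image of the unit ball. Applying 1 - P
  to b x kills the nearby net point, and 1 - P does not increase norms.\<close>

lemma finite_projection_approximates:
  assumes M: "closed_csubspace M" and b: "b \<in> compact_ops" "\<And>x. b x \<in> M" and e: "e > 0"
  shows "\<exists>P. finite_projection M P \<and> norm (b - (P o\<^sub>L b)) \<le> e"
proof -
  let ?K = "closure (blinfun_apply b ` cball 0 1)"
  have "seq_compact ?K" using b by (simp add: compact_ops_def compact_eq_seq_compact_metric)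
  then obtain Y where Y: "finite Y" "Y \<subseteq> ?K" "?K \<subseteq> (\<Union>x\<in>Y. ball x e)"
    using seq_compact_imp_totally_bounded e by metis
  have "?K \<subseteq> M" using M b(2) by (intro closure_minimal) (auto simp: closed_csubspace_def)
  then obtain P where P: "finite_projection M P" "\<And>y. y \<in> Y \<Longrightarrow> P y = y"
    using finite_projection_covers[of M Y] M Y unfolding closed_csubspace_def by blast
  have "norm (b - (P o\<^sub>L b)) \<le> e"
  proof (rule norm_blinfun_le_on_ball)
    fix x :: 'a assume "norm x \<le> 1"
    then obtain y where y: "y \<in> Y" "dist y (b x) < e"
      using Y(3) in_closure_image_ball[of x b] by auto
    have "(b - (P o\<^sub>L b)) x = (b x - y) - P (b x - y)"
      by (simp add: blinfun_apply_simps P(2)[OF y(1)])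
    also have "norm \<dots> \<le> norm (b x - y)"
      using is_projection_pythagoras[OF finite_projection_is_projection[OF P(1)], of "b x - y"]
      by (simp add: power2_le_imp_le)
    finally show "norm ((b - (P o\<^sub>L b)) x) \<le> e"
      using y(2) by (simp add: dist_norm norm_minus_commute)
  qed (use e in simp)
  then show ?thesis using P(1) by blast
qed

text \<open>An operator kills the complement of M exactly when the range of its adjoint lies in M.
  In this form the condition is symmetric in T and \<open>adj T\<close>, which makes closure under
  sums and products immediate.\<close>

lemma compact_ops_on_iff:
  assumes M: "closed_csubspace (M :: 'a::chilbert_space set)"
  shows "T \<in> compact_ops_on M \<longleftrightarrow> T \<in> compact_ops \<and> (\<forall>x. T x \<in> M) \<and> (\<forall>x. adj T x \<in> M)"
    (is "?L \<longleftrightarrow> ?R")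
proof
  assume ?L
  then have T: "T \<in> compact_ops" "\<And>x. x \<in> M \<Longrightarrow> T x \<in> M" "\<And>x. x \<in> orth_compl M \<Longrightarrow> T x = 0"
    by (auto simp: compact_ops_on_def)
  have "T x \<in> M" for x
  proof -
    obtain m where m: "m \<in> M" "x - m \<in> orth_compl M"
      using orthogonal_decomposition[OF M] by blast
    then have "T x - T m = 0" using T(3) by (simp flip: blinfun.diff_right)
    then show ?thesis using T(2) m by simp
  qed
  moreover have "adj T x \<in> M" for x
  proof -
    have "adj T x \<in> orth_compl (orth_compl M)"
      unfolding orth_compl_def
      using cinner_adj_right[OF compact_ops_clinear[OF T(1)], symmetric] T(3)
      by (auto simp: orth_compl_def)
    then show ?thesis using orth_compl_orth_compl[OF M] by simp
  qed
  ultimately show ?R using T(1) by blast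
next
  assume R: ?R
  have "T x = 0" if "x \<in> orth_compl M" for x
  proof -
    have "cinner x (adj T (T x)) = 0"
      using R that by (auto simp: orth_compl_def) (metis cinner_eq_zero_commute)
    moreover have "cinner (T x) (T x) = cinner x (adj T (T x))"
      using R compact_ops_clinear by (intro cinner_adj_right) blast
    ultimately show ?thesis by (metis cinner_eq_zero_iff)
  qed
  then show ?L using R by (auto simp: compact_ops_on_def)
qed

text \<open>Facts proved for \<open>compact_ops_on M\<close> thereby cover the full algebra of
  compact operators.\<close>

lemma compact_ops_on_UNIV: "compact_ops_on UNIV = compact_ops"
proof -
  have "closed_csubspace (UNIV :: 'a set)" by (simp add: closed_csubspace_def csubspace_def)
  then show ?thesis by (auto simp: compact_ops_on_iff)
qed

lemma rank_one_compact_ops_on: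
  assumes "closed_csubspace M" "x \<in> M" "y \<in> M" shows "rank_one x y \<in> compact_ops_on M"
  using assms by (auto simp: compact_ops_on_iff rank_one_compact closed_csubspace_def csubspace_scaleC)

lemma compose_compact_ops_on:
  assumes M: "closed_csubspace M" and S: "S \<in> compact_ops_on M" and T: "T \<in> compact_ops_on M"
  shows "S o\<^sub>L T \<in> compact_ops_on M" "adj S o\<^sub>L T \<in> compact_ops_on M"
proof -
  have "clinear_op S" "clinear_op T" using S T compact_ops_clinear by (auto simp: compact_ops_on_def)
  then show "S o\<^sub>L T \<in> compact_ops_on M" "adj S o\<^sub>L T \<in> compact_ops_on M"
    using S T by (auto simp: compact_ops_on_iff[OF M] compact_ops_compose_left clinear_op_adj
        adj_compose adj_adj)
qed

lemma csubspace_compact_ops_on: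
  assumes "closed_csubspace M" shows "csubspace (compact_ops_on M)"
proof -
  have M: "csubspace M" using assms by (simp add: closed_csubspace_def)
  have "0 \<in> compact_ops_on M"
    using rank_one_compact_ops_on[OF assms, of 0 0] csubspace_0[OF M] by simp
  then show ?thesis using M
    by (auto simp: csubspace_def[of "compact_ops_on M"] compact_ops_on_iff[OF assms] compact_ops_add
        compact_ops_scaleC compact_ops_clinear adj_add adj_scaleC blinfun.add_left csubspace_add
        csubspace_scaleC)
qed

lemma finite_projection_compact_ops_on:
  assumes "closed_csubspace M" shows "finite_projection M P \<Longrightarrow> P \<in> compact_ops_on M"
  by (induction rule: finite_projection.induct)
    (auto intro: csubspace_0 csubspace_add csubspace_compact_ops_on assms rank_one_compact_ops_on)

text \<open>For a finite projection P onto orthonormal vectors e of M, Pb is the finite sum of the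
  operators |e><b* e|, with both vectors in M, and such Pb approximate b in norm.\<close>

lemma compact_ops_on_subset:
  assumes M: "closed_csubspace M" and B: "csubspace B" "closed B"
    and rank_one: "\<And>x y. x \<in> M \<Longrightarrow> y \<in> M \<Longrightarrow> rank_one x y \<in> B"
  shows "compact_ops_on M \<subseteq> B"
proof
  fix b assume b: "b \<in> compact_ops_on M"
  then have bM: "b \<in> compact_ops" "\<And>x. b x \<in> M" "\<And>x. adj b x \<in> M"
    by (auto simp: compact_ops_on_iff[OF M])
  have PB: "P o\<^sub>L b \<in> B" if "finite_projection M P" for P
    using that
  proof (induction rule: finite_projection.induct)
    case zero
    have "0 o\<^sub>L b = 0" by (rule blinfun_eqI) simp
    then show ?case using B csubspace_0 by simp
  next
    case (extend P e)
    have "(P + rank_one e e) o\<^sub>L b = (P o\<^sub>L b) + rank_one e (adj b e)"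
      using rank_one_compose[OF compact_ops_clinear[OF bM(1)], of e e]
      by (simp add: bounded_bilinear.add_left[OF bounded_bilinear_blinfun_compose])
    then show ?case using extend bM B by (simp add: csubspace_add rank_one)
  qed
  have "\<forall>e>0. \<exists>a\<in>B. dist a b < e"
  proof (intro allI impI)
    fix e :: real assume "e > 0"
    obtain P where "finite_projection M P" "norm (b - (P o\<^sub>L b)) \<le> e / 2"
      using finite_projection_approximates[OF M bM(1,2), of "e / 2"] \<open>e > 0\<close> by auto
    then show "\<exists>a\<in>B. dist a b < e" using PB \<open>e > 0\<close>
      by (intro bexI[of _ "P o\<^sub>L b"]) (auto simp: dist_norm norm_minus_commute)
  qed
  then show "b \<in> B" using B(2) by (simp add: closed_approachable)
qed

text \<open>The form <x|ay> is positive but possibly degenerate; its Hermitian symmetry is the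
  self-adjointness of a.\<close>

lemma positive_op_Cauchy_Schwarz:
  fixes a :: "'a::chilbert_space \<Rightarrow>\<^sub>L 'a"
  assumes "clinear_op a" "positive_op a"
  shows "cinner (a x) y = cinner x (a y)"
    and "(cmod (cinner x (a y)))\<^sup>2 \<le> Re (cinner x (a x)) * Re (cinner y (a y))"
proof -
  have sub: "csubspace (UNIV :: 'a set)" by (simp add: csubspace_def)
  note CS = positive_form_Cauchy_Schwarz[where g = "\<lambda>x y. cinner x (a y)" and S = UNIV, OF sub]
  show "(cmod (cinner x (a y)))\<^sup>2 \<le> Re (cinner x (a x)) * Re (cinner y (a y))"
    by (rule CS(2)) (use assms in \<open>auto simp: cinner_simps blinfun_apply_simps clinear_opD positive_op_def\<close>)
  have "cinner y (a x) = cnj (cinner x (a y))"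
    by (rule CS(1)) (use assms in \<open>auto simp: cinner_simps blinfun_apply_simps clinear_opD positive_op_def\<close>)
  then show "cinner (a x) y = cinner x (a y)" by (metis cinner_commute complex_cnj_cnj)
qed

text \<open>For z orthogonal to M, 0 <= <z|az> <= <z|bz> = 0, and Cauchy-Schwarz for the form of a
  upgrades this to az = 0. Self-adjointness of a then puts its range into M.\<close>

lemma hereditary_compact_ops_on:
  assumes M: "closed_csubspace (M :: 'a::chilbert_space set)"
  shows "hereditary (compact_ops_on M) compact_ops"
  unfolding hereditary_def
proof (intro ballI impI, elim conjE)
  fix a b :: "'a \<Rightarrow>\<^sub>L 'a"
  assume a: "a \<in> compact_ops" "positive_op a" and b: "b \<in> compact_ops_on M" "positive_op (b - a)"
  note CS = positive_op_Cauchy_Schwarz[OF compact_ops_clinear[OF a(1)] a(2)]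
  have az: "a z = 0" if z: "z \<in> orth_compl M" for z
  proof -
    have "cinner z ((b - a) z) \<in> \<real>\<^sub>\<ge>\<^sub>0" "cinner z (a z) \<in> \<real>\<^sub>\<ge>\<^sub>0" "b z = 0"
      using a b z by (auto simp: positive_op_def compact_ops_on_def)
    then have "Re (cinner z (a z)) = 0"
      by (simp add: blinfun.diff_left cinner_simps complex_nonneg_Reals_iff)
    then have "cinner (a z) (a z) = 0" using CS(2)[of "a z" z] by simp
    then show ?thesis by simp
  qed
  have "a x \<in> M" for x
  proof -
    have "a x \<in> orth_compl (orth_compl M)"
      by (auto simp: orth_compl_def az simp flip: CS(1))
    then show ?thesis using orth_compl_orth_compl[OF M] by simp
  qed
  then show "a \<in> compact_ops_on M" using a az by (auto simp: compact_ops_on_def)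
qed

section \<open>Pure states\<close>

definition vector_state :: "('a::chilbert_space \<Rightarrow>\<^sub>L 'a) set \<Rightarrow> 'a \<Rightarrow> ('a \<Rightarrow>\<^sub>L 'a) \<Rightarrow> complex" where
  "vector_state B x = restrict (\<lambda>b. cinner x (blinfun_apply b x)) B"

lemma vector_state_apply: "b \<in> B \<Longrightarrow> vector_state B x b = cinner x (b x)"
  by (simp add: vector_state_def)

text \<open>Collects the closure under products ab and a* b on which states and the GNS form rest,
  so that C*-subalgebras and \<open>compact_ops_on M\<close> fall under one notion.\<close>

definition star_closed :: "('a::chilbert_space \<Rightarrow>\<^sub>L 'a) set \<Rightarrow> bool" where
  "star_closed B \<longleftrightarrow> B \<subseteq> compact_ops \<and> csubspace B \<and>
     (\<forall>S\<in>B. \<forall>T\<in>B. S o\<^sub>L T \<in> B \<and> adj S o\<^sub>L T \<in> B)"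

lemma cstar_subalgebra_star_closed:
  "cstar_subalgebra B compact_ops \<Longrightarrow> star_closed B"
  by (simp add: star_closed_def cstar_subalgebra_def)

lemma compact_ops_on_star_closed:
  "closed_csubspace M \<Longrightarrow> star_closed (compact_ops_on M)"
  unfolding star_closed_def
  by (intro conjI ballI csubspace_compact_ops_on compose_compact_ops_on) (auto simp: compact_ops_on_def)

lemma
  assumes "star_closed B"
  shows star_closed_clinear: "b \<in> B \<Longrightarrow> clinear_op b"
    and star_closed_csubspace: "csubspace B"
    and star_closed_compose: "a \<in> B \<Longrightarrow> b \<in> B \<Longrightarrow> a o\<^sub>L b \<in> B"
    and star_closed_adj_compose: "a \<in> B \<Longrightarrow> b \<in> B \<Longrightarrow> adj a o\<^sub>L b \<in> B"
  using assms compact_ops_clinear by (auto simp: star_closed_def)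

lemma
  assumes "\<omega> \<in> states B"
  shows states_add: "a \<in> B \<Longrightarrow> b \<in> B \<Longrightarrow> \<omega> (a + b) = \<omega> a + \<omega> b"
    and states_scaleC: "b \<in> B \<Longrightarrow> \<omega> (c *\<^sub>C b) = c * \<omega> b"
    and states_nonneg: "b \<in> B \<Longrightarrow> \<omega> (adj b o\<^sub>L b) \<in> \<real>\<^sub>\<ge>\<^sub>0"
    and states_extensional: "\<omega> \<in> extensional B"
  using assms by (auto simp: states_def)

lemma cmod_le_if_on_unit_ball:
  fixes \<phi> :: "'v::complex_normed_vector \<Rightarrow> complex"
  assumes B: "csubspace B" and b: "b \<in> B"
    and scale: "\<And>c b. b \<in> B \<Longrightarrow> \<phi> (c *\<^sub>C b) = c * \<phi> b"
    and le: "\<And>a. a \<in> B \<Longrightarrow> norm a \<le> 1 \<Longrightarrow> cmod (\<phi> a) \<le> k"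
  shows "cmod (\<phi> b) \<le> k * norm b"
proof (cases "b = 0")
  case True
  then show ?thesis using scale[OF b, of 0] by simp
next
  case False
  define a where "a = complex_of_real (1 / norm b) *\<^sub>C b"
  have "a \<in> B" "norm a \<le> 1"
    using False b B by (auto simp: a_def csubspace_scaleC norm_scaleC norm_divide)
  then have "cmod (\<phi> a) \<le> k" by (rule le)
  then show ?thesis
    using False by (simp add: a_def scale[OF b] norm_mult norm_divide field_simps)
qed

lemma states_cmod_le:
  assumes \<omega>: "\<omega> \<in> states B" and B: "csubspace B" and b: "b \<in> B"
  shows "cmod (\<omega> b) \<le> norm b"
proof -
  have unit: "cmod (\<omega> a) \<le> 1" if "a \<in> B" "norm a \<le> 1" for a
    using cSUP_upper[of a "{b \<in> B. norm b \<le> 1}" "\<lambda>b. cmod (\<omega> b)"] \<omega> that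
    by (auto simp: states_def)
  show ?thesis
    using cmod_le_if_on_unit_ball[OF B b states_scaleC[OF \<omega>] unit] by simp
qed

lemma states_norm:
  assumes \<omega>: "\<omega> \<in> states B" and B: "csubspace B"
    and k: "\<And>b. b \<in> B \<Longrightarrow> norm b \<le> 1 \<Longrightarrow> cmod (\<omega> b) \<le> k"
  shows "1 \<le> k"
proof -
  have "0 \<in> {b \<in> B. norm b \<le> 1}" using csubspace_0[OF B] by simp
  then have "(SUP b\<in>{b \<in> B. norm b \<le> 1}. cmod (\<omega> b)) \<le> k"
    by (intro cSUP_least) (use k in auto)
  then show ?thesis using \<omega> by (simp add: states_def)
qed

lemma statesI:
  assumes B: "csubspace B" and "\<omega> \<in> extensional B"
    and "\<And>a b. a \<in> B \<Longrightarrow> b \<in> B \<Longrightarrow> \<omega> (a + b) = \<omega> a + \<omega> b"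
    and "\<And>c b. b \<in> B \<Longrightarrow> \<omega> (c *\<^sub>C b) = c * \<omega> b"
    and "\<And>b. b \<in> B \<Longrightarrow> \<omega> (adj b o\<^sub>L b) \<in> \<real>\<^sub>\<ge>\<^sub>0"
    and le: "\<And>b. b \<in> B \<Longrightarrow> cmod (\<omega> b) \<le> norm b"
    and ge: "\<And>k. (\<And>b. b \<in> B \<Longrightarrow> norm b \<le> 1 \<Longrightarrow> cmod (\<omega> b) \<le> k) \<Longrightarrow> 1 \<le> k"
  shows "\<omega> \<in> states B"
proof -
  let ?U = "{b \<in> B. norm b \<le> 1}"
  have bdd: "bdd_above ((\<lambda>b. cmod (\<omega> b)) ` ?U)"
    using le by (intro bdd_aboveI2[of _ _ 1]) force
  have ne: "?U \<noteq> {}" using csubspace_0[OF B] by (auto intro!: exI[of _ 0])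
  have "(SUP b\<in>?U. cmod (\<omega> b)) \<le> 1" using le ne by (intro cSUP_least) force+
  moreover have "1 \<le> (SUP b\<in>?U. cmod (\<omega> b))"
    by (intro ge cSUP_upper[OF _ bdd]) simp
  ultimately show ?thesis using assms bdd by (simp add: states_def)
qed

text \<open>B may lack a unit, so norm one of the functional has to be witnessed by an element p of
  the unit ball that fixes x.\<close>

lemma vector_state_in_states:
  assumes B: "star_closed B" and p: "p \<in> B" "norm p \<le> 1" "p x = x" and x: "norm x = 1"
  shows "vector_state B x \<in> states B"
proof (rule statesI)
  note sub = star_closed_csubspace[OF B]
  show "csubspace B" by (rule sub)
  show "vector_state B x \<in> extensional B" by (simp add: vector_state_def)
  show "vector_state B x (a + b) = vector_state B x a + vector_state B x b" if "a \<in> B" "b \<in> B" for a b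
    using that sub by (simp add: vector_state_apply csubspace_add blinfun.add_left cinner_simps)
  show "vector_state B x (c *\<^sub>C b) = c * vector_state B x b" if "b \<in> B" for b c
    using that sub by (simp add: vector_state_apply csubspace_scaleC cinner_simps)
  show "vector_state B x (adj b o\<^sub>L b) \<in> \<real>\<^sub>\<ge>\<^sub>0" if "b \<in> B" for b
    using that star_closed_clinear[OF B that]
    by (simp add: vector_state_apply star_closed_adj_compose[OF B] cinner_self
        flip: cinner_adj_right)
  show "cmod (vector_state B x b) \<le> norm b" if "b \<in> B" for b
    using that cinner_cmod_le[of x "b x"] norm_blinfun[of b x] x by (simp add: vector_state_apply)
  show "1 \<le> k" if "\<And>b. b \<in> B \<Longrightarrow> norm b \<le> 1 \<Longrightarrow> cmod (vector_state B x b) \<le> k" for k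
    using that[OF p(1,2)] p x by (simp add: vector_state_apply cinner_self_unit)
qed

text \<open>
  If \<open>\<phi> p = 1\<close> and \<open>p\<^sup>*c = 0\<close> or \<open>cp\<^sup>* = 0\<close>, then \<open>\<parallel>p + tc\<parallel>\<close> exceeds 1 only to second order
  in \<open>t\<close>, so a functional of norm one must vanish at \<open>c\<close>.
\<close>

lemma norm_attaining_vanishes:
  fixes \<phi> :: "'v::complex_normed_vector \<Rightarrow> complex"
  assumes B: "csubspace B" and p: "p \<in> B" "\<phi> p = 1" and c: "c \<in> B"
    and add: "\<And>a b. a \<in> B \<Longrightarrow> b \<in> B \<Longrightarrow> \<phi> (a + b) = \<phi> a + \<phi> b"
    and scale: "\<And>c b. b \<in> B \<Longrightarrow> \<phi> (c *\<^sub>C b) = c * \<phi> b"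
    and le: "\<And>b. b \<in> B \<Longrightarrow> cmod (\<phi> b) \<le> norm b"
    and bound: "\<And>t. norm (p + t *\<^sub>C c) \<le> sqrt (1 + (cmod t * k)\<^sup>2)"
  shows "\<phi> c = 0"
proof (rule ccontr)
  assume nz: "\<phi> c \<noteq> 0"
  define \<alpha> where "\<alpha> = (cmod (\<phi> c))\<^sup>2"
  have \<alpha>: "\<alpha> > 0" using nz by (simp add: \<alpha>_def)
  have *: "2 \<le> s * k\<^sup>2" if s: "s > 0" for s :: real
  proof -
    \<comment> \<open>This makes the linear term equal to s times the squared modulus of
      \<open>\<phi> c\<close>: a positive first-order gain, set against a second-order
      bound.\<close>
    define t where "t = complex_of_real s * cnj (\<phi> c)"
    have "\<phi> (p + t *\<^sub>C c) = 1 + t * \<phi> c"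
      using B p c by (simp add: add scale csubspace_scaleC)
    also have "t * \<phi> c = of_real (s * \<alpha>)"
      unfolding t_def \<alpha>_def of_real_mult complex_norm_square by (simp add: mult_ac)
    finally have "cmod (\<phi> (p + t *\<^sub>C c)) = cmod (of_real (1 + s * \<alpha>))" by simp
    also have "\<dots> = 1 + s * \<alpha>" using s \<alpha> by (simp only: norm_of_real) simp
    finally have "1 + s * \<alpha> \<le> sqrt (1 + (cmod t * k)\<^sup>2)"
      using le[of "p + t *\<^sub>C c"] bound[of t] B p c by (simp add: csubspace_add csubspace_scaleC)
    then have "(1 + s * \<alpha>)\<^sup>2 \<le> 1 + (cmod t * k)\<^sup>2"
      using s \<alpha> by (metis add_nonneg_nonneg less_imp_le mult_nonneg_nonneg real_le_rsqrt
          real_sqrt_ge_0_iff real_sqrt_le_iff real_sqrt_unique zero_le_one real_sqrt_abs abs_of_nonneg)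
    moreover have "(cmod t * k)\<^sup>2 = s\<^sup>2 * \<alpha> * k\<^sup>2"
      by (simp add: t_def norm_mult power_mult_distrib \<alpha>_def)
    moreover have "(1 + s * \<alpha>)\<^sup>2 = 1 + 2 * s * \<alpha> + (s * \<alpha>)\<^sup>2" by (simp add: power2_sum)
    ultimately have "2 * s * \<alpha> \<le> s\<^sup>2 * \<alpha> * k\<^sup>2"
      using zero_le_power2[of "s * \<alpha>"] by linarith
    then have "(s * \<alpha>) * 2 \<le> (s * \<alpha>) * (s * k\<^sup>2)" by (simp add: power2_eq_square mult_ac)
    then show ?thesis using s \<alpha> by (simp add: mult_le_cancel_left)
  qed
  \<comment> \<open>At s = 1/(k^2 + 1) the right-hand side of 2 <= s k^2 is less than 1.\<close>
  have pos: "k\<^sup>2 + 1 > 0" by (simp add: add_nonneg_pos)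
  then have "2 \<le> k\<^sup>2 / (k\<^sup>2 + 1)" using *[of "1 / (k\<^sup>2 + 1)"] by simp
  then have "2 * (k\<^sup>2 + 1) \<le> k\<^sup>2" using pos by (simp add: pos_le_divide_eq)
  then show False using zero_le_power2[of k] by (smt (verit))
qed

text \<open>A state with value 1 at a projection attains its norm there, so it sees only the corner
  pBp: b - pb has its range in the kernel of p, and so has the adjoint of pb - pbp; both elements
  are annihilated.\<close>

lemma state_compress:
  assumes B: "star_closed B" and p: "p \<in> B" "is_projection p"
    and \<phi>: "\<phi> \<in> states B" "\<phi> p = 1" and b: "b \<in> B"
  shows "\<phi> b = \<phi> (p o\<^sub>L b o\<^sub>L p)"
proof -
  note sub = star_closed_csubspace[OF B]
  note pD = is_projectionD[OF p(2)]
  note lin = star_closed_clinear[OF B]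
  note vanish = norm_attaining_vanishes[OF sub p(1) \<phi>(2) _ states_add[OF \<phi>(1)] states_scaleC[OF \<phi>(1)]
      states_cmod_le[OF \<phi>(1) sub]]
  \<comment> \<open>The vectors p x and c x are orthogonal, so their squared norms add.\<close>
  have bound: "norm (p + t *\<^sub>C c) \<le> sqrt (1 + (cmod t * norm c)\<^sup>2)"
    if "\<And>x. p (c x) = 0" for c :: "'a \<Rightarrow>\<^sub>L 'a" and t
  proof (rule norm_blinfun_bound)
    fix x
    have "cinner (p x) (t *\<^sub>C c x) = 0" by (simp add: pD(3) cinner_simps that)
    then have "(norm ((p + t *\<^sub>C c) x))\<^sup>2 = (norm (p x))\<^sup>2 + (cmod t * norm (c x))\<^sup>2"
      by (simp add: blinfun.add_left norm_add_square norm_scaleC)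
    also have "\<dots> \<le> (norm x)\<^sup>2 + (cmod t * (norm c * norm x))\<^sup>2"
      by (intro add_mono power_mono mult_left_mono is_projection_norm_apply_le p norm_blinfun) auto
    also have "\<dots> = (sqrt (1 + (cmod t * norm c)\<^sup>2) * norm x)\<^sup>2"
      by (simp add: power_mult_distrib algebra_simps)
    finally show "norm ((p + t *\<^sub>C c) x) \<le> sqrt (1 + (cmod t * norm c)\<^sup>2) * norm x"
      by (rule power2_le_imp_le) simp
  qed simp
  have pb: "p o\<^sub>L b \<in> B" and pbp: "p o\<^sub>L b o\<^sub>L p \<in> B"
    using b p by (auto intro!: star_closed_compose[OF B])
  have "\<phi> (b - (p o\<^sub>L b)) = 0"
  proof (rule vanish)
    show "b - (p o\<^sub>L b) \<in> B" by (intro csubspace_diff sub b pb)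
    show "norm (p + t *\<^sub>C (b - (p o\<^sub>L b))) \<le> sqrt (1 + (cmod t * norm (b - (p o\<^sub>L b)))\<^sup>2)" for t
      by (rule bound) (simp add: blinfun_apply_simps pD)
  qed
  moreover have "\<phi> ((p o\<^sub>L b) - (p o\<^sub>L b o\<^sub>L p)) = 0"
  proof (rule vanish)
    let ?c = "(p o\<^sub>L b) - (p o\<^sub>L b o\<^sub>L p)"
    show cB: "?c \<in> B" by (intro csubspace_diff sub pb pbp)
    \<comment> \<open>This term itself has its range in that of p. Its adjoint has range in the
      kernel of p, and passing to adjoints preserves the norm.\<close>
    have "p (adj ?c x) = 0" for x
      by (rule cinner_extensionality)
        (simp add: blinfun_apply_simps pD flip: pD(3) cinner_adj_right[OF lin[OF cB]])
    then have "norm (p + cnj t *\<^sub>C adj ?c) \<le> sqrt (1 + (cmod (cnj t) * norm (adj ?c))\<^sup>2)" for t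
      by (rule bound)
    moreover have "p + cnj t *\<^sub>C adj ?c = adj (p + t *\<^sub>C ?c)" for t
      using pD lin[OF cB] by (simp only: adj_add adj_scaleC clinear_op_scaleC)
    moreover have "norm (adj (p + t *\<^sub>C ?c)) = norm (p + t *\<^sub>C ?c)" for t
      using pD lin[OF cB] by (intro norm_adj clinear_op_add clinear_op_scaleC)
    ultimately show "norm (p + t *\<^sub>C ?c) \<le> sqrt (1 + (cmod t * norm ?c)\<^sup>2)" for t
      by (simp add: norm_adj[OF lin[OF cB]])
  qed
  moreover have "\<phi> (b - (p o\<^sub>L b)) + \<phi> ((p o\<^sub>L b) - (p o\<^sub>L b o\<^sub>L p)) + \<phi> (p o\<^sub>L b o\<^sub>L p) = \<phi> b"
    using states_add[OF \<phi>(1)] b pb pbp sub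
    by (simp add: csubspace_diff csubspace_add flip: states_add[OF \<phi>(1)])
  ultimately show ?thesis by simp
qed

text \<open>The compression pbp = c p leaves no freedom: both \<open>\<phi> b\<close> and <x|bx> are
  this scalar c.\<close>

lemma state_eq_vector_state:
  assumes B: "star_closed B" and p: "p \<in> B" "is_projection p" "p x = x" "norm x = 1"
    and scalar: "\<And>b. b \<in> B \<Longrightarrow> \<exists>c. p o\<^sub>L b o\<^sub>L p = c *\<^sub>C p"
    and \<phi>: "\<phi> \<in> states B" "\<phi> p = 1"
  shows "\<phi> = vector_state B x"
proof (rule extensionalityI[of _ B])
  fix b assume b: "b \<in> B"
  obtain c where c: "p o\<^sub>L b o\<^sub>L p = c *\<^sub>C p" using scalar[OF b] by blast
  have "\<phi> b = c" using state_compress[OF B p(1,2) \<phi> b] c states_scaleC[OF \<phi>(1) p(1)] \<phi>(2) by simp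
  moreover have "cinner x (b x) = cinner x ((p o\<^sub>L b o\<^sub>L p) x)"
    using p(3) is_projectionD(3)[OF p(2), of x "b x"] by simp
  ultimately show "\<phi> b = vector_state B x b"
    using b p by (simp add: vector_state_apply c cinner_simps cinner_self_unit)
qed (use \<phi> in \<open>auto simp: vector_state_def states_extensional\<close>)

text \<open>In a convex decomposition the two values at p are real, at most 1, and have weighted
  average 1, so both are 1; \<open>state_eq_vector_state\<close> then determines each
  component.\<close>

lemma vector_state_pure:
  assumes B: "star_closed B" and p: "p \<in> B" "is_projection p" "p x = x" "norm x = 1"
    and scalar: "\<And>b. b \<in> B \<Longrightarrow> \<exists>c. p o\<^sub>L b o\<^sub>L p = c *\<^sub>C p"
  shows "vector_state B x \<in> pure_states B"
  unfolding pure_states_def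
proof (intro CollectI conjI ballI allI impI)
  note sub = star_closed_csubspace[OF B]
  show st: "vector_state B x \<in> states B"
    by (rule vector_state_in_states[OF B p(1) is_projection_norm_le p(3,4)]) (rule p)
  fix \<phi> \<psi> and t :: real
  assume \<phi>: "\<phi> \<in> states B" and \<psi>: "\<psi> \<in> states B"
    and t: "0 < t \<and> t < 1 \<and> (\<forall>b\<in>B. vector_state B x b = of_real t * \<phi> b + of_real (1 - t) * \<psi> b)"
  have real: "\<rho> p = of_real (Re (\<rho> p))" "Re (\<rho> p) \<le> 1" if \<rho>: "\<rho> \<in> states B" for \<rho>
  proof -
    have "adj p o\<^sub>L p = p" using p(2) is_projectionD(4)[OF p(2)] by (simp add: is_projection_def)
    then show "\<rho> p = of_real (Re (\<rho> p))"
      using states_nonneg[OF \<rho> p(1)] by (simp add: complex_nonneg_Reals_iff complex_eq_iff)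
    have "cmod (\<rho> p) \<le> 1"
      using states_cmod_le[OF \<rho> sub p(1)] is_projection_norm_le[OF p(2)] by simp
    then show "Re (\<rho> p) \<le> 1" using complex_Re_le_cmod order_trans by blast
  qed
  have "vector_state B x p = of_real t * \<phi> p + of_real (1 - t) * \<psi> p" using t p(1) by blast
  then have "1 = of_real t * \<phi> p + of_real (1 - t) * \<psi> p"
    using p by (simp add: vector_state_apply cinner_self_unit)
  then have "Re 1 = Re (of_real t * \<phi> p + of_real (1 - t) * \<psi> p)" by (rule arg_cong)
  then have conv: "1 = t * Re (\<phi> p) + (1 - t) * Re (\<psi> p)" by (simp del: of_real_diff)
  have "t * (1 - Re (\<phi> p)) \<ge> 0" "(1 - t) * (1 - Re (\<psi> p)) \<ge> 0"
    using t real[OF \<phi>] real[OF \<psi>] by auto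
  moreover have "t * (1 - Re (\<phi> p)) + (1 - t) * (1 - Re (\<psi> p)) = 0"
    using conv by (simp add: algebra_simps)
  ultimately have "t * (1 - Re (\<phi> p)) = 0" "(1 - t) * (1 - Re (\<psi> p)) = 0" by linarith+
  then have "\<phi> p = 1" "\<psi> p = 1" using t real(1)[OF \<phi>] real(1)[OF \<psi>] by auto
  then show "\<phi> = vector_state B x" "\<psi> = vector_state B x"
    using state_eq_vector_state[OF B p scalar] \<phi> \<psi> by auto
qed

lemma rank_one_compress:
  assumes "clinear_op b"
  shows "rank_one x x o\<^sub>L b o\<^sub>L rank_one x x = cinner x (b x) *\<^sub>C rank_one x x"
  by (rule blinfun_eqI) (simp add: clinear_opD[OF assms] cinner_simps scaleC_scaleC mult.commute)

lemma rank_one_vector_state: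
  assumes B: "star_closed B" and x: "norm x = 1" "rank_one x x \<in> B"
  shows "vector_state B x \<in> pure_states B"
    and "\<lbrakk>\<phi> \<in> states B; \<phi> (rank_one x x) = 1\<rbrakk> \<Longrightarrow> \<phi> = vector_state B x"
proof -
  have fx: "rank_one x x x = x" by (simp add: cinner_self_unit x scaleC_one)
  have scalar: "\<exists>c. rank_one x x o\<^sub>L b o\<^sub>L rank_one x x = c *\<^sub>C rank_one x x" if "b \<in> B" for b
    using rank_one_compress[OF star_closed_clinear[OF B that]] by blast
  show "vector_state B x \<in> pure_states B"
    by (rule vector_state_pure[OF B x(2) is_projection_rank_one[OF x(1)] fx x(1) scalar])
  show "\<phi> = vector_state B x" if "\<phi> \<in> states B" "\<phi> (rank_one x x) = 1"
    by (rule state_eq_vector_state[OF B x(2) is_projection_rank_one[OF x(1)] fx x(1) scalar that])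
qed

section \<open>Pure states of the compact operators on a subspace are vector states\<close>

text \<open>Positivity is a premise of individual lemmas rather than a locale assumption: the locale
  is also interpreted for a difference of two positive functionals, whose positivity is derived
  inside it by \<open>f_positive\<close>.\<close>

locale positive_functional =
  fixes M :: "'a::chilbert_space set" and f :: "('a \<Rightarrow>\<^sub>L 'a) \<Rightarrow> complex" and K :: real
  assumes M: "closed_csubspace M"
    and f_add: "\<And>a b. a \<in> compact_ops_on M \<Longrightarrow> b \<in> compact_ops_on M \<Longrightarrow> f (a + b) = f a + f b"
    and f_scaleC: "\<And>c b. b \<in> compact_ops_on M \<Longrightarrow> f (c *\<^sub>C b) = c * f b"
    and f_bounded: "\<And>b. b \<in> compact_ops_on M \<Longrightarrow> cmod (f b) \<le> K * norm b"
    and K: "0 \<le> K"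
begin

abbreviation "B \<equiv> compact_ops_on M"

lemma B_star: "star_closed B"
  using M by (rule compact_ops_on_star_closed)

lemmas sub = star_closed_csubspace[OF B_star]

lemma f_diff: "a \<in> B \<Longrightarrow> b \<in> B \<Longrightarrow> f (a - b) = f a - f b"
  using f_add[of a "(-1) *\<^sub>C b"] f_scaleC[of b "-1"] sub
  by (simp add: csubspace_scaleC csubspace_uminus scaleC_one)

lemma f_zero: "f 0 = 0"
  using f_diff[of 0 0] csubspace_0[OF sub] by simp

lemma approximation:
  assumes b: "b \<in> B"
  obtains P where "\<And>n. finite_projection M (P n)" "(\<lambda>n. P n o\<^sub>L b) \<longlonglongrightarrow> b"
proof -
  have "\<exists>P. finite_projection M P \<and> norm (b - (P o\<^sub>L b)) \<le> inverse (real (Suc n))" for n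
    using b by (intro finite_projection_approximates[OF M]) (auto simp: compact_ops_on_iff[OF M])
  then obtain P where P: "\<And>n. finite_projection M (P n)"
    "\<And>n. norm (b - (P n o\<^sub>L b)) \<le> inverse (real (Suc n))" by metis
  have "(\<lambda>n. b - (P n o\<^sub>L b)) \<longlonglongrightarrow> 0"
    by (rule Lim_null_comparison[OF _ LIMSEQ_inverse_real_of_nat]) (use P in simp)
  then have "(\<lambda>n. b - (b - (P n o\<^sub>L b))) \<longlonglongrightarrow> b - 0" by (intro tendsto_diff tendsto_const)
  then show thesis using that[OF P(1)] by simp
qed

lemma f_tendsto:
  assumes "s \<longlonglongrightarrow> a" "\<And>n. s n \<in> B" "a \<in> B"
  shows "(\<lambda>n. f (s n)) \<longlonglongrightarrow> f a"
proof (rule LIM_zero_cancel, rule Lim_null_comparison)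
  show "\<forall>\<^sub>F n in sequentially. norm (f (s n) - f a) \<le> K * norm (s n - a)"
    using f_bounded assms sub by (simp add: csubspace_diff flip: f_diff)
  show "(\<lambda>n. K * norm (s n - a)) \<longlonglongrightarrow> 0"
    using tendsto_mult_right_zero[OF tendsto_norm_zero[OF LIM_zero[OF assms(1)]]] .
qed

text \<open>b* P b is a finite sum of operators |b* e><b* e| and converges to b* b as Pb approaches
  b, so positivity may be tested on operators |x><x| with x in M.\<close>

lemma f_positive:
  assumes rank_one: "\<And>x. x \<in> M \<Longrightarrow> f (rank_one x x) \<in> \<real>\<^sub>\<ge>\<^sub>0" and b: "b \<in> B"
  shows "f (adj b o\<^sub>L b) \<in> \<real>\<^sub>\<ge>\<^sub>0"
proof -
  have lin: "clinear_op b" using star_closed_clinear[OF B_star b] .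
  have bM: "adj b x \<in> M" for x using b by (simp add: compact_ops_on_iff[OF M])
  have PB: "P \<in> B" if "finite_projection M P" for P
    using that by (rule finite_projection_compact_ops_on[OF M])
  have mem: "adj b o\<^sub>L (P o\<^sub>L b) \<in> B" if "P \<in> B" for P
    using b that by (intro star_closed_adj_compose[OF B_star]
        star_closed_compose[OF B_star])
  have pos: "f (adj b o\<^sub>L (P o\<^sub>L b)) \<in> \<real>\<^sub>\<ge>\<^sub>0" if "finite_projection M P" for P
    using that
  proof (induction rule: finite_projection.induct)
    case zero
    have "adj b o\<^sub>L (0 o\<^sub>L b) = 0" by (rule blinfun_eqI) (simp add: blinfun_apply_simps)
    then show ?case by (simp add: f_zero)
  next
    case (extend P e)
    have rE: "rank_one e e \<in> B" using extend by (intro rank_one_compact_ops_on[OF M])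
    have "adj b o\<^sub>L ((P + rank_one e e) o\<^sub>L b)
        = (adj b o\<^sub>L (P o\<^sub>L b)) + (adj b o\<^sub>L (rank_one e e o\<^sub>L b))"
      by (rule blinfun_eqI) (simp add: blinfun_apply_simps)
    moreover have "adj b o\<^sub>L (rank_one e e o\<^sub>L b) = rank_one (adj b e) (adj b e)"
      using lin by (simp add: rank_one_compose compose_rank_one clinear_op_adj)
    ultimately have "f (adj b o\<^sub>L ((P + rank_one e e) o\<^sub>L b))
        = f (adj b o\<^sub>L (P o\<^sub>L b)) + f (rank_one (adj b e) (adj b e))"
      using f_add mem[OF PB[OF extend(1)]] mem[OF rE] by simp
    then show ?case using extend.IH rank_one[OF bM] by simp
  qed
  obtain P where P: "\<And>n. finite_projection M (P n)" "(\<lambda>n. P n o\<^sub>L b) \<longlonglongrightarrow> b"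
    using approximation[OF b] by blast
  have "(\<lambda>n. f (adj b o\<^sub>L (P n o\<^sub>L b))) \<longlonglongrightarrow> f (adj b o\<^sub>L b)"
  proof (rule f_tendsto)
    show "(\<lambda>n. adj b o\<^sub>L (P n o\<^sub>L b)) \<longlonglongrightarrow> (adj b o\<^sub>L b)"
      by (intro bounded_bilinear.tendsto[OF bounded_bilinear_blinfun_compose] tendsto_const P)
  qed (use mem PB P b star_closed_adj_compose[OF B_star] in auto)
  then show ?thesis
    by (rule closed_sequentially[OF closed_nonneg_Reals_complex, rotated]) (rule pos[OF P(1)])
qed

lemma f_Cauchy_Schwarz:
  assumes pos: "\<And>b. b \<in> B \<Longrightarrow> f (adj b o\<^sub>L b) \<in> \<real>\<^sub>\<ge>\<^sub>0" and ab: "a \<in> B" "b \<in> B"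
  shows "(cmod (f (adj a o\<^sub>L b)))\<^sup>2 \<le> Re (f (adj a o\<^sub>L a)) * Re (f (adj b o\<^sub>L b))"
proof (rule positive_form_Cauchy_Schwarz(2)[where g = "\<lambda>a b. f (adj a o\<^sub>L b)", OF sub])
  note lin = star_closed_clinear[OF B_star]
  note mem = star_closed_adj_compose[OF B_star]
  fix a b c t assume a: "a \<in> B" and b: "b \<in> B"
  have "adj (t *\<^sub>C a) o\<^sub>L b = cnj t *\<^sub>C (adj a o\<^sub>L b)" "adj a o\<^sub>L (t *\<^sub>C b) = t *\<^sub>C (adj a o\<^sub>L b)"
    using lin[OF a] by (auto intro!: blinfun_eqI simp: adj_scaleC clinear_opD[OF clinear_op_adj])
  then show "f (adj (t *\<^sub>C a) o\<^sub>L b) = cnj t * f (adj a o\<^sub>L b)"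
    "f (adj a o\<^sub>L (t *\<^sub>C b)) = t * f (adj a o\<^sub>L b)"
    using f_scaleC[OF mem[OF a b]] by auto
  assume c: "c \<in> B"
  have "adj (a + b) o\<^sub>L c = (adj a o\<^sub>L c) + (adj b o\<^sub>L c)" "adj a o\<^sub>L (b + c) = (adj a o\<^sub>L b) + (adj a o\<^sub>L c)"
    using lin[OF a] lin[OF b] by (auto intro!: blinfun_eqI simp: adj_add blinfun_apply_simps)
  then show "f (adj (a + b) o\<^sub>L c) = f (adj a o\<^sub>L c) + f (adj b o\<^sub>L c)"
    "f (adj a o\<^sub>L (b + c)) = f (adj a o\<^sub>L b) + f (adj a o\<^sub>L c)"
    using f_add mem a b c by auto
qed (use ab pos in auto)

text \<open>Finite projections play the role of the missing unit. Cauchy-Schwarz against P bounds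
  the squared modulus of \<open>f b\<close> by c times the value at b* b, after a limit; with s the
  norm of f this reads s^2 <= c s, so s <= c.\<close>

lemma f_norm_le:
  assumes pos: "\<And>b. b \<in> B \<Longrightarrow> f (adj b o\<^sub>L b) \<in> \<real>\<^sub>\<ge>\<^sub>0"
    and c: "\<And>P. finite_projection M P \<Longrightarrow> Re (f P) \<le> c"
    and b: "b \<in> B"
  shows "cmod (f b) \<le> c * norm b"
proof -
  have c0: "0 \<le> c" using c[OF finite_projection.zero] by (simp add: f_zero)
  have square: "(cmod (f b))\<^sup>2 \<le> c * Re (f (adj b o\<^sub>L b))" if b: "b \<in> B" for b
  proof -
    obtain P where P: "\<And>n. finite_projection M (P n)" "(\<lambda>n. P n o\<^sub>L b) \<longlonglongrightarrow> b"
      using approximation[OF b] by blast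
    have PB: "P n \<in> B" for n using finite_projection_compact_ops_on[OF M P(1)] .
    have "(\<lambda>n. (cmod (f (P n o\<^sub>L b)))\<^sup>2) \<longlonglongrightarrow> (cmod (f b))\<^sup>2"
      by (intro tendsto_power tendsto_norm f_tendsto P star_closed_compose[OF B_star] PB b)
    moreover have "(cmod (f (P n o\<^sub>L b)))\<^sup>2 \<le> c * Re (f (adj b o\<^sub>L b))" for n
    proof -
      note proj = finite_projection_is_projection[OF P(1)[of n]]
      have PP: "adj (P n) = P n" "P n o\<^sub>L P n = P n"
        using is_projectionD(4)[OF proj] proj by (auto simp: is_projection_def)
      have "(cmod (f (P n o\<^sub>L b)))\<^sup>2 \<le> Re (f (P n)) * Re (f (adj b o\<^sub>L b))"
        using f_Cauchy_Schwarz[OF pos PB[of n] b] PP by simp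
      also have "\<dots> \<le> c * Re (f (adj b o\<^sub>L b))"
        using pos[OF b] c[OF P(1)] by (intro mult_right_mono) (auto simp: complex_nonneg_Reals_iff)
      finally show ?thesis .
    qed
    ultimately show ?thesis using LIMSEQ_le_const2 by blast
  qed
  define s where "s = (SUP b\<in>{b \<in> B. norm b \<le> 1}. cmod (f b))"
  have bdd: "bdd_above ((\<lambda>b. cmod (f b)) ` {b \<in> B. norm b \<le> 1})"
  proof (rule bdd_aboveI2)
    fix b assume "b \<in> {b \<in> B. norm b \<le> 1}"
    then show "cmod (f b) \<le> K"
      using f_bounded[of b] mult_left_mono[of "norm b" 1 K] K by simp
  qed
  have s_upper: "cmod (f b) \<le> s" if "b \<in> B" "norm b \<le> 1" for b
    unfolding s_def using that by (intro cSUP_upper[OF _ bdd]) simp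
  have s0: "0 \<le> s" using s_upper[OF csubspace_0[OF sub]] by (simp add: f_zero)
  have "cmod (f b) \<le> sqrt (c * s)" if b: "b \<in> B" "norm b \<le> 1" for b
  proof -
    have "norm (adj b o\<^sub>L b) \<le> norm (adj b) * norm b" by (rule norm_blinfun_compose)
    also have "\<dots> \<le> 1 * 1"
      using b norm_adj[OF star_closed_clinear[OF B_star b(1)]] by (intro mult_mono) auto
    finally have "cmod (f (adj b o\<^sub>L b)) \<le> s"
      using b by (intro s_upper star_closed_adj_compose[OF B_star]) auto
    then have "Re (f (adj b o\<^sub>L b)) \<le> s" using complex_Re_le_cmod order_trans by blast
    then have "(cmod (f b))\<^sup>2 \<le> c * s"
      using square[OF b(1)] mult_left_mono[OF _ c0] order_trans by blast
    then show ?thesis by (rule real_le_rsqrt)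
  qed
  then have "s \<le> sqrt (c * s)"
    unfolding s_def[of] using csubspace_0[OF sub]
    by (intro cSUP_least) (auto simp flip: s_def intro!: exI[of _ 0])
  then have "s\<^sup>2 \<le> c * s" using s0 c0 by (metis mult_nonneg_nonneg power_mono real_sqrt_pow2)
  then have sc: "s \<le> c" using s0 c0 by (cases "s = 0") (auto simp: power2_eq_square)
  show ?thesis
    by (rule cmod_le_if_on_unit_ball[OF sub b f_scaleC]) (use s_upper sc order_trans in blast)+
qed

end

text \<open>
  A state \<open>\<omega>\<close> with \<open>\<omega>(|x\<rangle>\<langle>x|) > 0\<close> dominates the functional of the vector \<open>v\<close> representing the
  normalized functional \<open>y \<mapsto> \<omega>(|y\<rangle>\<langle>x|)\<close>, so a pure state is the vector state of \<open>v\<close>.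
\<close>

lemma pure_state_is_vector_state:
  fixes M :: "'a::chilbert_space set"
  assumes M: "closed_csubspace M" and \<omega>: "\<omega> \<in> pure_states (compact_ops_on M)"
  shows "\<exists>x\<in>M. norm x = 1 \<and> \<omega> = vector_state (compact_ops_on M) x"
proof -
  let ?B = "compact_ops_on M"
  have Ms: "csubspace M" using M by (simp add: closed_csubspace_def)
  have B: "star_closed ?B" using M by (rule compact_ops_on_star_closed)
  note sub = star_closed_csubspace[OF B]
  have st: "\<omega> \<in> states ?B" using \<omega> by (simp add: pure_states_def)
  interpret W: positive_functional M \<omega> 1
    by standard (use M states_add[OF st] states_scaleC[OF st] states_cmod_le[OF st sub] in auto)
  have pos: "\<omega> (adj b o\<^sub>L b) \<in> \<real>\<^sub>\<ge>\<^sub>0" if "b \<in> ?B" for b using states_nonneg[OF st that] .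
  have rB: "rank_one x y \<in> ?B" if "x \<in> M" "y \<in> M" for x y
    using that by (rule rank_one_compact_ops_on[OF M])
  have r_prod: "adj (rank_one x y) o\<^sub>L rank_one x z = rank_one y z" if "norm x = 1" for x y z :: 'a
    by (rule blinfun_eqI) (simp add: that cinner_simps cinner_self_unit)
  have pos_r: "\<omega> (rank_one y y) \<in> \<real>\<^sub>\<ge>\<^sub>0" if x: "x \<in> M" "norm x = 1" and y: "y \<in> M" for x y
    using pos[OF rB[OF x(1) y]] r_prod[OF x(2)] by simp
  \<comment> \<open>Otherwise \<open>\<omega>\<close> vanishes on all finite projections and
    \<open>f_norm_le\<close> gives it norm 0.\<close>
  have "\<exists>x\<in>M. norm x = 1 \<and> \<omega> (rank_one x x) \<noteq> 0"
  proof (rule ccontr)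
    assume *: "\<not> ?thesis"
    have "\<omega> P = 0" if "finite_projection M P" for P
      using that
    proof (induction rule: finite_projection.induct)
      case zero
      show ?case by (rule W.f_zero)
    next
      case (extend P e)
      then show ?case
        using * W.f_add[OF finite_projection_compact_ops_on[OF M] rB] by simp
    qed
    then have "cmod (\<omega> b) \<le> 0 * norm b" if "b \<in> ?B" for b
      using that by (intro W.f_norm_le pos) auto
    then have "1 \<le> (0::real)" by (intro states_norm[OF st sub]) auto
    then show False by simp
  qed
  then obtain x where x: "x \<in> M" "norm x = 1" "\<omega> (rank_one x x) \<noteq> 0" by blast
  define \<tau> where "\<tau> = Re (\<omega> (rank_one x x))"
  have \<tau>: "\<tau> > 0" "\<omega> (rank_one x x) = of_real \<tau>"
    using x pos_r[OF x(1,2,1)] by (auto simp: \<tau>_def complex_nonneg_Reals_iff complex_eq_iff less_le)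
  obtain p where p: "is_projection p" "\<And>y. p y \<in> M" "\<And>y. y \<in> M \<Longrightarrow> p y = y"
    using projection_onto[OF M] by blast
  \<comment> \<open>Composition with the projection p onto M extends the functional from M to the
    whole space, as Riesz representation requires.\<close>
  have "\<exists>u. \<forall>y. \<omega> (rank_one (p y) x) = cinner u y"
  proof (rule Riesz_representation)
    show scale: "\<omega> (rank_one (p (c *\<^sub>C y)) x) = c * \<omega> (rank_one (p y) x)" for c y
      using W.f_scaleC[OF rB[OF p(2) x(1)]]
      by (simp add: clinear_opD[OF is_projectionD(1)[OF p(1)]] rank_one_scaleC_left)
    show "bounded_linear (\<lambda>y. \<omega> (rank_one (p y) x))"
    proof (rule bounded_linear_intro)
      show "\<omega> (rank_one (p (y + z)) x) = \<omega> (rank_one (p y) x) + \<omega> (rank_one (p z) x)" for y z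
        using W.f_add[OF rB[OF p(2) x(1)] rB[OF p(2) x(1)]]
        by (simp add: blinfun.add_right rank_one_add_left)
      show "\<omega> (rank_one (p (r *\<^sub>R y)) x) = r *\<^sub>R \<omega> (rank_one (p y) x)" for r y
        using scale[of "of_real r" y] by (simp add: scaleR_scaleC[symmetric] scaleR_conv_of_real)
      show "norm (\<omega> (rank_one (p y) x)) \<le> norm y * 1" for y
        using W.f_bounded[OF rB[OF p(2)[of y] x(1)]] norm_rank_one_le[of "p y" x]
          is_projection_norm_apply_le[OF p(1), of y] x(2) by simp
    qed
  qed
  then obtain u where u: "\<And>y. \<omega> (rank_one (p y) x) = cinner u y" by blast
  have "p u = u"
    by (rule cinner_extensionality, subst (1 2) cinner_commute)
      (simp add: is_projectionD[OF p(1)] flip: u)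
  then have uM: "u \<in> M" using p(2)[of u] by simp
  have u: "\<omega> (rank_one y x) = cinner u y" if "y \<in> M" for y using u[of y] p(3)[OF that] by simp
  \<comment> \<open>The factor 1 / sqrt \<open>\<tau>\<close> is the scale at which Cauchy-Schwarz
    bounds |<v|y>|^2 exactly by the value of \<open>\<omega>\<close> at |y><y|.\<close>
  define v where "v = (1 / sqrt \<tau>) *\<^sub>R u"
  have vM: "v \<in> M" using uM Ms by (simp add: v_def csubspace_scaleR)
  have v0: "v \<noteq> 0" using u[OF x(1)] \<tau> by (auto simp: v_def)
  define t where "t = (norm v)\<^sup>2"
  have t0: "t > 0" using v0 by (simp add: t_def)
  have dominated: "(cmod (cinner v y))\<^sup>2 \<le> Re (\<omega> (rank_one y y))" if y: "y \<in> M" for y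
  proof -
    have "(cmod (\<omega> (rank_one y x)))\<^sup>2 \<le> Re (\<omega> (rank_one y y)) * \<tau>"
      using W.f_Cauchy_Schwarz[OF pos rB[OF x(1) y] rB[OF x(1,1)]] r_prod[OF x(2)]
      by (simp add: \<tau>(2))
    moreover have "cmod (cinner v y) = cmod (\<omega> (rank_one y x)) / sqrt \<tau>"
      using \<tau>(1) by (simp add: v_def u[OF y] cinner.scaleR_left)
    then have "(cmod (cinner v y))\<^sup>2 = (cmod (\<omega> (rank_one y x)))\<^sup>2 / \<tau>"
      using \<tau>(1) by (simp add: power_divide)
    ultimately show ?thesis using \<tau>(1) by (simp add: pos_divide_le_eq)
  qed
  define f where "f b = \<omega> b - cinner v (b v)" for b
  interpret F: positive_functional M f "1 + norm v * norm v"
  proof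
    fix a b c assume a: "a \<in> ?B"
    show "f (c *\<^sub>C a) = c * f a"
      using a by (simp add: f_def W.f_scaleC cinner_simps algebra_simps)
    have "cmod (cinner v (a v)) \<le> norm v * (norm a * norm v)"
      by (rule order_trans[OF cinner_cmod_le]) (intro mult_left_mono norm_blinfun norm_ge_zero)
    then have "cmod (f a) \<le> 1 * norm a + norm v * (norm a * norm v)"
      unfolding f_def using norm_triangle_ineq4[of "\<omega> a" "cinner v (a v)"] W.f_bounded[OF a] by linarith
    then show "cmod (f a) \<le> (1 + norm v * norm v) * norm a" by (simp add: algebra_simps)
    assume "b \<in> ?B"
    then show "f (a + b) = f a + f b"
      using a by (simp add: f_def W.f_add cinner_simps blinfun.add_left)
  qed (use M in auto)
  have f_r: "f (rank_one y y) \<in> \<real>\<^sub>\<ge>\<^sub>0" if y: "y \<in> M" for y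
  proof -
    have "cinner v (rank_one y y v) = of_real ((cmod (cinner v y))\<^sup>2)"
      unfolding cinner_rank_one_self by (metis cinner_commute complex_mod_cnj)
    then show ?thesis
      using dominated[OF y] pos_r[OF x(1,2) y] by (simp add: f_def complex_nonneg_Reals_iff)
  qed
  have f_pos: "f (adj b o\<^sub>L b) \<in> \<real>\<^sub>\<ge>\<^sub>0" if "b \<in> ?B" for b
    using F.f_positive f_r that by blast
  have "Re (f P) \<le> 1 - t" if P: "finite_projection M P" for P
  proof -
    \<comment> \<open>Enlarging P so that it fixes v makes <v|Qv> equal to t, while f does not
      decrease and \<open>\<omega> Q\<close> stays at most 1 in modulus.\<close>
    obtain Q where Q: "finite_projection M Q" "Q v = v" "Q = P \<or> (\<exists>e\<in>M. Q = P + rank_one e e)"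
      using finite_projection_extend[OF Ms P vM] by blast
    have PB: "P \<in> ?B" "Q \<in> ?B" using finite_projection_compact_ops_on[OF M] P Q by auto
    have "Re (f P) \<le> Re (f Q)"
      using Q(3) F.f_add[OF PB(1) rB] f_r by (auto simp: complex_nonneg_Reals_iff)
    also have "\<dots> = Re (\<omega> Q) - t" by (simp add: f_def Q cinner_self t_def del: of_real_power)
    also have "Re (\<omega> Q) \<le> 1"
      using complex_Re_le_cmod[of "\<omega> Q"] W.f_bounded[OF PB(2)]
        is_projection_norm_le[OF finite_projection_is_projection[OF Q(1)]] by simp
    finally show ?thesis by simp
  qed
  then have f_le: "cmod (f b) \<le> (1 - t) * norm b" if "b \<in> ?B" for b
    using F.f_norm_le[OF f_pos] that by blast
  have t1: "t \<le> 1" using \<open>\<And>P. finite_projection M P \<Longrightarrow> Re (f P) \<le> 1 - t\<close>[OF finite_projection.zero] F.f_zero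
    by simp
  define w where "w = (1 / norm v) *\<^sub>R v"
  have w: "w \<in> M" "norm w = 1" using v0 vM Ms by (auto simp: w_def csubspace_scaleR)
  have vw: "cinner v (b v) = of_real t * cinner w (b w)" for b :: "'a \<Rightarrow>\<^sub>L 'a"
    using v0 by (simp add: w_def t_def blinfun.scaleR_right cinner.scaleR_left cinner.scaleR_right
        scaleR_conv_of_real power2_eq_square)
  let ?\<phi> = "vector_state ?B w"
  have \<phi>: "?\<phi> \<in> states ?B"
    using rank_one_vector_state(1)[OF B w(2) rB[OF w(1,1)]] by (simp add: pure_states_def)
  have "\<omega> = ?\<phi>"
  proof (cases "t = 1")
    case True
    show ?thesis
    proof (rule extensionalityI[of _ ?B])
      fix b assume b: "b \<in> ?B"
      have "f b = 0" using f_le[OF b] True by simp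
      then show "\<omega> b = ?\<phi> b" using b by (simp add: f_def vw True vector_state_apply)
    qed (use st \<phi> states_extensional in auto)
  next
    case False
    then have t1: "t < 1" using t1 by simp
    \<comment> \<open>The normalized remainder is a second state, so \<open>\<omega>\<close> is a
      proper convex combination, and purity identifies it with the vector state.\<close>
    define \<psi> where "\<psi> = restrict (\<lambda>b. f b / of_real (1 - t)) ?B"
    have \<psi>_apply: "\<psi> b = f b / of_real (1 - t)" if "b \<in> ?B" for b
      using that by (simp add: \<psi>_def)
    have conv: "\<omega> b = of_real t * ?\<phi> b + of_real (1 - t) * \<psi> b" if b: "b \<in> ?B" for b
    proof -
      have "complex_of_real (1 - t) * \<psi> b = f b" using t1 by (simp add: \<psi>_apply[OF b] del: of_real_diff)
      then show ?thesis using b by (simp add: f_def vw vector_state_apply del: of_real_diff)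
    qed
    have "\<psi> \<in> states ?B"
    proof (rule statesI[OF sub])
      show "\<psi> \<in> extensional ?B" by (simp add: \<psi>_def)
      show "\<psi> (a + b) = \<psi> a + \<psi> b" if "a \<in> ?B" "b \<in> ?B" for a b
        using that by (simp add: \<psi>_apply csubspace_add[OF sub] F.f_add add_divide_distrib)
      show "\<psi> (c *\<^sub>C b) = c * \<psi> b" if "b \<in> ?B" for b c
        using that by (simp add: \<psi>_apply csubspace_scaleC[OF sub] F.f_scaleC)
      show "\<psi> (adj b o\<^sub>L b) \<in> \<real>\<^sub>\<ge>\<^sub>0" if "b \<in> ?B" for b
        using f_pos[OF that] t1 star_closed_adj_compose[OF B that that]
        by (simp add: \<psi>_apply complex_nonneg_Reals_iff Re_divide_of_real Im_divide_of_real del: of_real_diff)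
      show "cmod (\<psi> b) \<le> norm b" if "b \<in> ?B" for b
      proof -
        have "cmod (\<psi> b) = cmod (f b) / (1 - t)"
          using t1 by (simp add: \<psi>_apply[OF that] norm_divide del: of_real_diff)
        then show ?thesis using f_le[OF that] t1 by (simp add: pos_divide_le_eq mult.commute)
      qed
      show "1 \<le> k" if k: "\<And>b. b \<in> ?B \<Longrightarrow> norm b \<le> 1 \<Longrightarrow> cmod (\<psi> b) \<le> k" for k
      proof -
        \<comment> \<open>A bound k for \<open>\<psi>\<close> on the unit ball bounds
          \<open>\<omega>\<close> by this number, and \<open>\<omega>\<close> has norm one.\<close>
        have "1 \<le> t + (1 - t) * k"
        proof (rule states_norm[OF st sub])
          fix b assume b: "b \<in> ?B" "norm b \<le> 1"
          have "cmod (\<omega> b) \<le> cmod (of_real t * ?\<phi> b) + cmod (of_real (1 - t) * \<psi> b)"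
            unfolding conv[OF b(1)] by (rule norm_triangle_ineq)
          also have "\<dots> = t * cmod (?\<phi> b) + (1 - t) * cmod (\<psi> b)"
            using t0 t1 by (simp add: norm_mult del: of_real_diff)
          also have "\<dots> \<le> t * 1 + (1 - t) * k"
            using t0 t1 k[OF b] states_cmod_le[OF \<phi> sub b(1)] b(2)
            by (intro add_mono mult_left_mono) auto
          finally show "cmod (\<omega> b) \<le> t + (1 - t) * k" by simp
        qed
        then have "(1 - t) * 1 \<le> (1 - t) * k" by simp
        then show ?thesis using t1 by (simp add: mult_le_cancel_left)
      qed
    qed
    then show ?thesis using \<omega> \<phi> conv t0 t1 unfolding pure_states_def by blast
  qed
  then show ?thesis using w by blast
qed

section \<open>GNS representations of vector states\<close>

text \<open>
  The GNS space of the vector state of \<open>x\<close> is identified with the closure of \<open>Bx\<close>; the point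
  \<open>z\<close> corresponds to the class of all sequences \<open>s\<close> in \<open>B\<close> with \<open>s\<^sub>n x \<rightarrow> z\<close>.
\<close>

definition gns_class :: "('a::chilbert_space \<Rightarrow>\<^sub>L 'a) set \<Rightarrow> 'a \<Rightarrow> 'a \<Rightarrow> (nat \<Rightarrow> 'a \<Rightarrow>\<^sub>L 'a) set" where
  "gns_class B x z = {s. (\<forall>n. s n \<in> B) \<and> (\<lambda>n. s n x) \<longlonglongrightarrow> z}"

definition cyclic_space :: "('a::chilbert_space \<Rightarrow>\<^sub>L 'a) set \<Rightarrow> 'a \<Rightarrow> 'a set" where
  "cyclic_space B x = closure ((\<lambda>b. blinfun_apply b x) ` B)"

lemma gns_form_vector_state:
  assumes "star_closed B" "a \<in> B" "b \<in> B"
  shows "gns_form (vector_state B x) a b = cinner (a x) (b x)"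
  using assms by (simp add: gns_form_def vector_state_apply star_closed_adj_compose
      cinner_adj_right[OF star_closed_clinear[OF assms(1,2)]])

lemma gns_form_diff:
  assumes B: "star_closed B" and ab: "a \<in> B" "b \<in> B"
  shows "gns_form (vector_state B x) (a - b) (a - b) = of_real ((norm (a x - b x))\<^sup>2)"
  using gns_form_vector_state[OF B, of "a - b" "a - b" x] ab
    csubspace_diff[OF star_closed_csubspace[OF B]]
  by (simp add: blinfun.diff_left cinner_self)

lemma cyclic_space_iff: "z \<in> cyclic_space B x \<longleftrightarrow> (\<exists>s. s \<in> gns_class B x z)"
proof -
  have "(\<exists>s. s \<in> gns_class B x z) \<longleftrightarrow> (\<exists>t. (\<forall>n. t n \<in> (\<lambda>b. blinfun_apply b x) ` B) \<and> t \<longlonglongrightarrow> z)"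
  proof
    assume "\<exists>t. (\<forall>n. t n \<in> (\<lambda>b. blinfun_apply b x) ` B) \<and> t \<longlonglongrightarrow> z"
    then obtain t where t: "\<And>n. t n \<in> (\<lambda>b. blinfun_apply b x) ` B" "t \<longlonglongrightarrow> z" by blast
    then have "\<forall>n. \<exists>b. b \<in> B \<and> t n = b x" by blast
    then obtain s where s: "\<And>n. s n \<in> B" "\<And>n. t n = s n x" by metis
    show "\<exists>s. s \<in> gns_class B x z"
      using s(1) t(2) by (intro exI[of _ s]) (simp add: gns_class_def flip: s(2))
  next
    assume "\<exists>s. s \<in> gns_class B x z"
    then obtain s where "s \<in> gns_class B x z" by blast
    then show "\<exists>t. (\<forall>n. t n \<in> (\<lambda>b. blinfun_apply b x) ` B) \<and> t \<longlonglongrightarrow> z"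
      by (intro exI[of _ "\<lambda>n. s n x"]) (auto simp: gns_class_def)
  qed
  then show ?thesis by (simp add: cyclic_space_def closure_sequential)
qed

lemma gns_class_unique: "s \<in> gns_class B x z \<Longrightarrow> s \<in> gns_class B x w \<Longrightarrow> z = w"
  unfolding gns_class_def using LIMSEQ_unique by blast

text \<open>For a vector state the GNS seminorm of a is the norm of a x, so completeness of the
  Hilbert space turns Cauchy sequences into those with a limit of s_n x.\<close>

lemma gns_Cauchy_vector_state:
  assumes B: "star_closed B"
  shows "s \<in> gns_Cauchy B (vector_state B x) \<longleftrightarrow> (\<exists>z. s \<in> gns_class B x z)"
proof (cases "\<forall>n. s n \<in> B")
  case True
  then have form: "cmod (gns_form (vector_state B x) (s m - s n) (s m - s n))
      = (norm (s m x - s n x))\<^sup>2" for m n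
    using gns_form_diff[OF B] by (simp add: norm_power)
  have "(\<forall>e>0. \<exists>N. \<forall>m\<ge>N. \<forall>n\<ge>N. (norm (s m x - s n x))\<^sup>2 < e) \<longleftrightarrow> Cauchy (\<lambda>n. s n x)"
  proof (intro iffI metric_CauchyI allI impI)
    fix e :: real
    assume *: "\<forall>e>0. \<exists>N. \<forall>m\<ge>N. \<forall>n\<ge>N. (norm (s m x - s n x))\<^sup>2 < e" and e: "e > 0"
    then obtain N where "\<forall>m\<ge>N. \<forall>n\<ge>N. (norm (s m x - s n x))\<^sup>2 < e\<^sup>2"
      by (meson zero_less_power)
    then have "dist (s m x) (s n x) < e" if "m \<ge> N" "n \<ge> N" for m n
      using power2_less_imp_less[of "norm (s m x - s n x)" e] that e by (simp add: dist_norm)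
    then show "\<exists>N. \<forall>m\<ge>N. \<forall>n\<ge>N. dist (s m x) (s n x) < e" by blast
  next
    fix e :: real
    assume *: "Cauchy (\<lambda>n. s n x)" and e: "e > 0"
    then obtain N where N: "\<forall>m\<ge>N. \<forall>n\<ge>N. dist (s m x) (s n x) < sqrt e"
      using real_sqrt_gt_zero by (meson metric_CauchyD)
    have "(norm (s m x - s n x))\<^sup>2 < (sqrt e)\<^sup>2" if "m \<ge> N" "n \<ge> N" for m n
      using N that by (intro power_strict_mono) (auto simp: dist_norm)
    then show "\<exists>N. \<forall>m\<ge>N. \<forall>n\<ge>N. (norm (s m x - s n x))\<^sup>2 < e"
      using e by auto
  qed
  then show ?thesis
    using True by (simp add: gns_Cauchy_def gns_class_def form Cauchy_convergent_iff convergent_def)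
qed (auto simp: gns_Cauchy_def gns_class_def)

lemma gns_rel_vector_state:
  assumes B: "star_closed B"
  shows "(s, t) \<in> gns_rel B (vector_state B x) \<longleftrightarrow> (\<exists>z. s \<in> gns_class B x z \<and> t \<in> gns_class B x z)"
proof -
  let ?\<omega> = "vector_state B x"
  have "(\<lambda>n. gns_form ?\<omega> (s n - t n) (s n - t n)) \<longlonglongrightarrow> 0 \<longleftrightarrow> z = w"
    if s: "s \<in> gns_class B x z" and t: "t \<in> gns_class B x w" for z w
  proof -
    have "(\<lambda>n. complex_of_real ((norm (s n x - t n x))\<^sup>2)) \<longlonglongrightarrow> of_real ((norm (z - w))\<^sup>2)"
      using s t by (intro tendsto_intros) (auto simp: gns_class_def)
    moreover have "gns_form ?\<omega> (s n - t n) (s n - t n) = of_real ((norm (s n x - t n x))\<^sup>2)" for n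
      using s t by (intro gns_form_diff[OF B]) (auto simp: gns_class_def)
    ultimately have lim: "(\<lambda>n. gns_form ?\<omega> (s n - t n) (s n - t n)) \<longlonglongrightarrow> of_real ((norm (z - w))\<^sup>2)"
      by simp
    show ?thesis
    proof
      assume "(\<lambda>n. gns_form ?\<omega> (s n - t n) (s n - t n)) \<longlonglongrightarrow> 0"
      then have "complex_of_real ((norm (z - w))\<^sup>2) = 0" using lim LIMSEQ_unique by blast
      then show "z = w" by simp
    qed (use lim in simp)
  qed
  then show ?thesis
    unfolding gns_rel_def gns_Cauchy_vector_state[OF B] by blast
qed

lemma gns_rel_Image_class:
  assumes B: "star_closed B" and s: "s \<in> gns_class B x z"
  shows "gns_rel B (vector_state B x) `` {s} = gns_class B x z"
  using s gns_class_unique by (auto simp: gns_rel_vector_state[OF B]) blast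

lemma gns_space_vector_state:
  assumes B: "star_closed B"
  shows "gns_space B (vector_state B x) = gns_class B x ` cyclic_space B x"
proof -
  have "gns_space B (vector_state B x)
      = {gns_rel B (vector_state B x) `` {s} |s z. s \<in> gns_class B x z}"
    unfolding gns_space_def quotient_def using gns_Cauchy_vector_state[OF B] by blast
  also have "\<dots> = {gns_class B x z |s z. s \<in> gns_class B x z}"
    using gns_rel_Image_class[OF B] by (metis (lifting))
  also have "\<dots> = gns_class B x ` cyclic_space B x"
    using cyclic_space_iff by blast
  finally show ?thesis .
qed

lemma inj_on_gns_class: "inj_on (gns_class B x) (cyclic_space B x)"
  by (auto simp: inj_on_def cyclic_space_iff) (metis gns_class_unique)

lemma gns_inner_vector_state:
  assumes B: "star_closed B" and zw: "z \<in> cyclic_space B x" "w \<in> cyclic_space B x"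
  shows "gns_inner (vector_state B x) (gns_class B x z) (gns_class B x w) = cinner z w"
proof -
  have lim: "(\<lambda>n. gns_form (vector_state B x) (s n) (t n)) \<longlonglongrightarrow> cinner z w"
    if "s \<in> gns_class B x z" "t \<in> gns_class B x w" for s t
  proof -
    have "gns_form (vector_state B x) (s n) (t n) = cinner (s n x) (t n x)" for n
      using that by (intro gns_form_vector_state[OF B]) (auto simp: gns_class_def)
    then show ?thesis using that by (auto simp: gns_class_def intro: tendsto_cinner)
  qed
  obtain s t where "s \<in> gns_class B x z" "t \<in> gns_class B x w"
    using zw cyclic_space_iff by blast
  then show ?thesis unfolding gns_inner_def
    using lim LIMSEQ_unique by (intro the_equality) blast+
qed

lemma gns_rep_vector_state:
  assumes B: "star_closed B" and b: "b \<in> B" and z: "z \<in> cyclic_space B x"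
  shows "gns_rep B (vector_state B x) b (gns_class B x z) = gns_class B x (b z)"
    and "b z \<in> cyclic_space B x"
proof -
  have comp: "(\<lambda>n. b o\<^sub>L s n) \<in> gns_class B x (b z)" if "s \<in> gns_class B x z" for s
    using that b star_closed_compose[OF B]
    by (auto simp: gns_class_def intro: blinfun.tendsto)
  obtain s where s: "s \<in> gns_class B x z" using z cyclic_space_iff by blast
  then show "b z \<in> cyclic_space B x" using comp cyclic_space_iff by blast
  have "gns_rel B (vector_state B x) `` ((\<lambda>s n. b o\<^sub>L s n) ` gns_class B x z)
      = (\<Union>s\<in>gns_class B x z. gns_rel B (vector_state B x) `` {\<lambda>n. b o\<^sub>L s n})"
    by blast
  also have "\<dots> = (\<Union>s\<in>gns_class B x z. gns_class B x (b z))"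
    using gns_rel_Image_class[OF B comp] by simp
  finally show "gns_rep B (vector_state B x) b (gns_class B x z) = gns_class B x (b z)"
    using s by (auto simp: gns_rep_def)
qed

lemma gns_equiv_refl: "gns_equiv B \<omega> \<omega>"
  unfolding gns_equiv_def by (intro exI[of _ id]) auto

text \<open>Under the identification with closed orbits the algebra acts on both GNS spaces by plain
  application, so the identity of the common orbit closure is an intertwiner.\<close>

lemma gns_equiv_same_cyclic_space:
  assumes B: "star_closed B" and eq: "cyclic_space B x = cyclic_space B y"
  shows "gns_equiv B (vector_state B x) (vector_state B y)"
proof -
  define V where "V = inv_into (cyclic_space B x) (gns_class B x)"
  define U where "U = gns_class B y \<circ> V"
  have V: "V (gns_class B x z) = z" if "z \<in> cyclic_space B x" for z
    unfolding V_def using inj_on_gns_class that by (rule inv_into_f_f)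
  have "bij_betw V (gns_class B x ` cyclic_space B x) (cyclic_space B x)"
    unfolding V_def by (intro bij_betw_inv_into) (simp add: bij_betw_def inj_on_gns_class)
  moreover have "bij_betw (gns_class B y) (cyclic_space B x) (gns_class B y ` cyclic_space B x)"
    using eq by (simp add: bij_betw_def inj_on_gns_class)
  ultimately have "bij_betw U (gns_space B (vector_state B x)) (gns_space B (vector_state B y))"
    unfolding U_def gns_space_vector_state[OF B] using eq bij_betw_trans by metis
  then show ?thesis
    unfolding gns_equiv_def gns_space_vector_state[OF B]
    by (intro exI[of _ U])
      (auto simp: U_def V gns_inner_vector_state[OF B] gns_rep_vector_state[OF B] simp flip: eq
        intro: gns_inner_vector_state[OF B] gns_rep_vector_state[OF B])
qed

text \<open>An intertwiner would send the class of p z to the class of p w = 0 for some w, although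
  it preserves inner products and p z is nonzero.\<close>

lemma not_gns_equivI:
  assumes B: "star_closed B" and p: "p \<in> B" and z: "z \<in> cyclic_space B x" "p z \<noteq> 0"
    and y: "\<And>w. w \<in> cyclic_space B y \<Longrightarrow> p w = 0"
  shows "\<not> gns_equiv B (vector_state B x) (vector_state B y)"
proof
  let ?X = "gns_class B x" and ?Y = "gns_class B y"
  assume "gns_equiv B (vector_state B x) (vector_state B y)"
  then obtain U where bij: "bij_betw U (?X ` cyclic_space B x) (?Y ` cyclic_space B y)"
    and U: "\<forall>X\<in>?X ` cyclic_space B x. \<forall>Y\<in>?X ` cyclic_space B x.
      gns_inner (vector_state B y) (U X) (U Y) = gns_inner (vector_state B x) X Y"
      "\<forall>b\<in>B. \<forall>X\<in>?X ` cyclic_space B x.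
      U (gns_rep B (vector_state B x) b X) = gns_rep B (vector_state B y) b (U X)"
    unfolding gns_equiv_def gns_space_vector_state[OF B] by (elim exE conjE)
  have inner: "\<And>z w. z \<in> cyclic_space B x \<Longrightarrow> w \<in> cyclic_space B x \<Longrightarrow>
      gns_inner (vector_state B y) (U (?X z)) (U (?X w)) = gns_inner (vector_state B x) (?X z) (?X w)"
    and rep: "\<And>b z. b \<in> B \<Longrightarrow> z \<in> cyclic_space B x \<Longrightarrow>
      U (gns_rep B (vector_state B x) b (?X z)) = gns_rep B (vector_state B y) b (U (?X z))"
    using U by simp_all
  obtain w where w: "w \<in> cyclic_space B y" "U (?X z) = ?Y w"
    using bij z(1) unfolding bij_betw_def by blast
  have "U (?X (p z)) = ?Y (p w)"
    using rep[OF p z(1)] gns_rep_vector_state[OF B p] z(1) w by simp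
  then have Upz: "U (?X (p z)) = ?Y 0" and "0 \<in> cyclic_space B y"
    using y[OF w(1)] gns_rep_vector_state(2)[OF B p w(1)] by simp_all
  then have "cinner (p z) (p z) = 0"
    using inner[of "p z" "p z"] gns_rep_vector_state(2)[OF B p z(1)]
    by (simp add: gns_inner_vector_state[OF B])
  then show False using z(2) by simp
qed

lemma only_fiber_pure_states:
  assumes "only_fiber B X"
  shows "X = pure_states B" and "\<lbrakk>\<omega> \<in> pure_states B; \<omega>' \<in> pure_states B\<rbrakk> \<Longrightarrow> gns_equiv B \<omega> \<omega>'"
proof -
  obtain \<sigma> where \<sigma>: "spectrum B = {\<sigma>}" "X = bundle_fiber B \<sigma>"
    using assms by (auto simp: only_fiber_def)
  have proj: "bundle_proj B \<omega> = \<sigma>" if "\<omega> \<in> pure_states B" for \<omega>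
    using \<sigma>(1) that by (auto simp: spectrum_def)
  then show "X = pure_states B" by (auto simp: \<sigma>(2) bundle_fiber_def)
  assume \<omega>: "\<omega> \<in> pure_states B" "\<omega>' \<in> pure_states B"
  then have "\<omega>' \<in> bundle_proj B \<omega>'" using gns_equiv_refl by (auto simp: bundle_proj_def)
  then have "\<omega>' \<in> bundle_proj B \<omega>" using proj \<omega> by simp
  then show "gns_equiv B \<omega> \<omega>'" by (simp add: bundle_proj_def)
qed

lemma only_fiberI:
  assumes "pure_states B \<noteq> {}"
    and "\<And>\<omega> \<omega>'. \<omega> \<in> pure_states B \<Longrightarrow> \<omega>' \<in> pure_states B \<Longrightarrow> gns_equiv B \<omega> \<omega>'"
  shows "only_fiber B (pure_states B)"
proof -
  have "bundle_proj B \<omega> = pure_states B" if "\<omega> \<in> pure_states B" for \<omega>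
    using assms(2)[OF that] by (auto simp: bundle_proj_def)
  then have "spectrum B = {pure_states B}" "bundle_fiber B (pure_states B) = pure_states B"
    using assms(1) by (auto simp: spectrum_def bundle_fiber_def)
  then show ?thesis by (auto simp: only_fiber_def)
qed

section \<open>Algebras of the form \<open>compact_ops_on M\<close>\<close>

lemma closed_csubspace_rank_one_slice:
  assumes "csubspace B" "closed B"
  shows "closed_csubspace {y. rank_one y x \<in> B}"
proof -
  have "closed {y. rank_one y x \<in> B}"
    unfolding closed_sequential_limits
  proof (intro allI impI, elim conjE)
    fix s and l assume "\<forall>n. s n \<in> {y. rank_one y x \<in> B}" "s \<longlonglongrightarrow> l"
    then have "(\<lambda>n. rank_one (s n) x) \<longlonglongrightarrow> rank_one l x" "\<And>n. rank_one (s n) x \<in> B"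
      by (auto intro: tendsto_rank_one_left)
    then show "l \<in> {y. rank_one y x \<in> B}"
      using closed_sequentially[OF assms(2)] by (metis mem_Collect_eq)
  qed
  then show ?thesis
    using assms(1) by (simp add: closed_csubspace_def csubspace_def[of "Collect _"] csubspace_0
        csubspace_add csubspace_scaleC rank_one_add_left rank_one_scaleC_left)
qed

text \<open>
  The operators of \<open>B\<close> that vanish on \<open>M = {y. |y\<rangle>\<langle>x| \<in> B}\<close> form an ideal complementary to
  \<open>compact_ops_on M\<close>; if it is not zero, it contains a further minimal projection of \<open>B\<close>.
\<close>

lemma rank_one_dichotomy:
  fixes B :: "('a::chilbert_space \<Rightarrow>\<^sub>L 'a) set"
  assumes B: "cstar_subalgebra B compact_ops" and x: "norm x = 1" "rank_one x x \<in> B"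
  defines "M \<equiv> {y. rank_one y x \<in> B}"
  shows "B = compact_ops_on M \<or>
    (\<exists>q\<in>B. is_projection q \<and> q \<noteq> 0 \<and> (\<forall>m\<in>M. q m = 0) \<and> (\<forall>b\<in>B. \<exists>c. q o\<^sub>L b o\<^sub>L q = c *\<^sub>C q))"
proof -
  note sub = cstar_subalgebra_csubspace[OF B] and closed = cstar_subalgebra_closed[OF B]
  note comp = cstar_subalgebra_compose[OF B] and adjB = cstar_subalgebra_adj[OF B]
  have lin: "clinear_op b" if "b \<in> B" for b
    using that cstar_subalgebra_subset[OF B] compact_ops_clinear by blast
  have M: "closed_csubspace M"
    unfolding M_def using sub closed by (rule closed_csubspace_rank_one_slice)
  \<comment> \<open>M is invariant under B because b |m><x| = |b m><x|.\<close>
  have BM: "b m \<in> M" if "b \<in> B" "m \<in> M" for b m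
    using comp[of b "rank_one m x"] that compose_rank_one[OF lin] by (simp add: M_def)
  have rB: "rank_one y z \<in> B" if "y \<in> M" "z \<in> M" for y z
  proof -
    have "rank_one y x o\<^sub>L adj (rank_one z x) \<in> B"
      using that by (intro comp adjB) (auto simp: M_def)
    moreover have "rank_one y x o\<^sub>L adj (rank_one z x) = rank_one y z"
      by (rule blinfun_eqI) (simp add: cinner_simps cinner_self_unit[OF x(1)])
    ultimately show ?thesis by simp
  qed
  have KB: "compact_ops_on M \<subseteq> B" using compact_ops_on_subset[OF M sub closed rB] .
  define C where "C = {b \<in> B. \<forall>m\<in>M. b m = 0}"
  have C: "cstar_subalgebra C compact_ops"
    unfolding cstar_subalgebra_def
  proof (intro conjI ballI)
    show "C \<subseteq> compact_ops" using cstar_subalgebra_subset[OF B] by (auto simp: C_def)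
    show "csubspace C" using sub
      unfolding csubspace_def[of C] by (auto simp: C_def csubspace_0 csubspace_add csubspace_scaleC blinfun.add_left)
    have "C = B \<inter> (\<Inter>m\<in>M. {b. blinfun_apply b m = 0})" by (auto simp: C_def)
    also have "closed \<dots>"
      by (intro closed_Int closed closed_INT ballI closed_Collect_eq continuous_intros)
    finally show "closed C" .
    show "S o\<^sub>L T \<in> C" if "S \<in> C" "T \<in> C" for S T using that comp by (simp add: C_def)
    show "adj T \<in> C" if T: "T \<in> C" for T
    proof -
      have TB: "T \<in> B" using T by (simp add: C_def)
      \<comment> \<open>By invariance T* m stays in M, so T annihilates it, and <T T* m|m> is the
        squared norm of T* m.\<close>
      have "adj T m = 0" if m: "m \<in> M" for m
      proof -
        have "T (adj T m) = 0" using T BM[OF adjB[OF TB] m] by (simp add: C_def)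
        then have "cinner (adj T m) (adj T m) = 0"
          using cinner_adj_right[OF lin[OF TB], of "adj T m" m] by simp
        then show ?thesis by simp
      qed
      then show ?thesis using adjB[OF TB] by (simp add: C_def)
    qed
  qed
  show ?thesis
  proof (cases "C = {0}")
    case True
    obtain p where p: "is_projection p" "\<And>y. p y \<in> M" "\<And>y. y \<in> M \<Longrightarrow> p y = y"
      "\<And>y. y \<in> orth_compl M \<Longrightarrow> p y = 0"
      using projection_onto[OF M] by blast
    have "B \<subseteq> compact_ops_on M"
    proof
      fix b assume b: "b \<in> B"
      have bp: "b o\<^sub>L p \<in> compact_ops_on M"
        unfolding compact_ops_on_def using b p BM cstar_subalgebra_subset[OF B]
        by (auto intro!: compact_ops_compose_right is_projectionD)
      then have "b o\<^sub>L p \<in> B" using KB by blast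
      \<comment> \<open>The two operators agree on M, so their difference lies in C, which is zero
        here.\<close>
      then have "b - (b o\<^sub>L p) \<in> C"
        using b sub p(3) by (simp add: C_def csubspace_diff blinfun.diff_left)
      then have "b = b o\<^sub>L p" using True by simp
      then show "b \<in> compact_ops_on M" using bp by simp
    qed
    then show ?thesis using KB by blast
  next
    case False
    obtain q where q: "q \<in> C" "is_projection q" "q \<noteq> 0"
      "\<And>b. b \<in> C \<Longrightarrow> \<exists>c. q o\<^sub>L b o\<^sub>L q = c *\<^sub>C q"
      using minimal_projection[OF C False] by blast
    have qq: "q o\<^sub>L q = q" using q(2) by (simp add: is_projection_def)
    \<comment> \<open>Minimality within C extends to B because qbq already lies in C.\<close>
    have "\<exists>c. q o\<^sub>L b o\<^sub>L q = c *\<^sub>C q" if b: "b \<in> B" for b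
    proof -
      have "q o\<^sub>L b o\<^sub>L q \<in> C" using q(1) b comp by (simp add: C_def)
      then obtain c where "q o\<^sub>L (q o\<^sub>L b o\<^sub>L q) o\<^sub>L q = c *\<^sub>C q" using q(4) by blast
      moreover have "q o\<^sub>L (q o\<^sub>L b o\<^sub>L q) o\<^sub>L q = q o\<^sub>L b o\<^sub>L q"
        by (rule blinfun_eqI) (simp add: is_projectionD(2)[OF q(2)])
      ultimately show ?thesis by auto
    qed
    then show ?thesis using q by (auto simp: C_def)
  qed
qed

section \<open>From heredity to the algebra of a subspace\<close>

lemma positive_op_rank_one: "positive_op (rank_one y y)"
  by (simp add: positive_op_def cinner_rank_one_self del: rank_one_apply)

lemma hereditary_imp_compact_ops_on:
  fixes B :: "('a::chilbert_space \<Rightarrow>\<^sub>L 'a) set"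
  assumes B: "cstar_subalgebra B compact_ops" and ne: "B \<noteq> {0}" and her: "hereditary B compact_ops"
  shows "\<exists>M x. closed_csubspace M \<and> x \<in> M \<and> norm x = 1 \<and> B = compact_ops_on M"
proof -
  note sub = cstar_subalgebra_csubspace[OF B]
  \<comment> \<open>For a unit vector y fixed by p, the operator |y><y| lies below p, so heredity
    applies.\<close>
  have rank_one_B: "rank_one y y \<in> B" if p: "p \<in> B" "is_projection p" "p y = y" "norm y = 1" for p y
  proof -
    have "positive_op (rank_one y y)" by (rule positive_op_rank_one)
    moreover have "positive_op (p - rank_one y y)"
      unfolding positive_op_def
    proof
      fix z
      note cinner_rank_one_self[of z y]
      moreover have "cinner z (p z) = of_real ((norm (p z))\<^sup>2)"
        using is_projectionD(2,3)[OF p(2)] cinner_self[of "p z"] by metis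
      ultimately have "cinner z ((p - rank_one y y) z)
          = of_real ((norm (p z))\<^sup>2 - (cmod (cinner y z))\<^sup>2)"
        by (simp add: blinfun.diff_left cinner.diff_right)
      moreover have "cmod (cinner y z) \<le> norm (p z)"
        using cinner_cmod_le[of y "p z"] is_projectionD(3)[OF p(2), of y z] p(3,4) by simp
      ultimately show "cinner z ((p - rank_one y y) z) \<in> \<real>\<^sub>\<ge>\<^sub>0"
        by (simp add: power_mono del: of_real_diff)
    qed
    ultimately show ?thesis using her p(1) rank_one_compact unfolding hereditary_def by blast
  qed
  obtain p where p: "p \<in> B" "is_projection p" "p \<noteq> 0"
    by (rule minimal_projection[OF B ne])
  obtain x where x: "norm x = 1" "p x = x" using is_projection_fixes_unit p(2,3) by blast
  have xB: "rank_one x x \<in> B" using rank_one_B p x by blast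
  define M where "M = {y. rank_one y x \<in> B}"
  have M: "closed_csubspace M"
    unfolding M_def using sub cstar_subalgebra_closed[OF B] by (rule closed_csubspace_rank_one_slice)
  have "B = compact_ops_on M"
  proof (rule ccontr)
    assume "B \<noteq> compact_ops_on M"
    then obtain q where q: "q \<in> B" "is_projection q" "q \<noteq> 0" "\<And>m. m \<in> M \<Longrightarrow> q m = 0"
      using rank_one_dichotomy[OF B x(1) xB] by (auto simp: M_def)
    obtain y where y: "norm y = 1" "q y = y" using is_projection_fixes_unit q(2,3) by blast
    have yB: "rank_one y y \<in> B" using rank_one_B q y by blast
    have "q x = 0" using q(4) xB by (simp add: M_def)
    then have xy: "cinner y x = 0" "cinner x y = 0"
      using is_projectionD(3)[OF q(2), of y x] y(2) cinner_eq_zero_commute[of x y] by auto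
    \<comment> \<open>The factor 2 comes from |s + t|^2 <= 2 (|s|^2 + |t|^2), which places
      \<open>?a\<close> below \<open>?b\<close>. Multiplying \<open>?a\<close> by |x><x| then
      produces |x + y><x|, so y would lie in M.\<close>
    let ?a = "rank_one (x + y) (x + y)" and ?b = "2 *\<^sub>C (rank_one x x + rank_one y y)"
    have "positive_op ?a" by (rule positive_op_rank_one)
    moreover have "positive_op (?b - ?a)"
      unfolding positive_op_def
    proof
      fix z
      let ?s = "cmod (cinner x z)" and ?t = "cmod (cinner y z)"
      have "cinner z ((?b - ?a) z) = 2 * (cinner z (rank_one x x z) + cinner z (rank_one y y z)) - cinner z (?a z)"
        by (simp only: blinfun.diff_left blinfun.add_left scaleC_blinfun_apply cinner_simps)
      then have "cinner z ((?b - ?a) z) = of_real (2 * (?s\<^sup>2 + ?t\<^sup>2) - (cmod (cinner (x + y) z))\<^sup>2)"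
        by (simp only: cinner_rank_one_self) simp
      moreover have "(cmod (cinner (x + y) z))\<^sup>2 \<le> (?s + ?t)\<^sup>2"
        by (intro power_mono) (auto simp: cinner_add_left norm_triangle_ineq)
      then have "(cmod (cinner (x + y) z))\<^sup>2 \<le> 2 * (?s\<^sup>2 + ?t\<^sup>2)"
        using sum_squares_bound[of ?s ?t] by (simp add: power2_sum)
      ultimately show "cinner z ((?b - ?a) z) \<in> \<real>\<^sub>\<ge>\<^sub>0"
        by (simp del: of_real_diff)
    qed
    moreover have "?b \<in> B" using xB yB sub by (intro csubspace_scaleC csubspace_add)
    ultimately have "?a \<in> B" using her rank_one_compact unfolding hereditary_def by blast
    then have "?a o\<^sub>L rank_one x x \<in> B" using xB by (intro cstar_subalgebra_compose[OF B])
    moreover have "?a o\<^sub>L rank_one x x = rank_one (x + y) x"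
      by (rule blinfun_eqI) (simp add: cinner_simps xy cinner_self_unit[OF x(1)])
    ultimately have "rank_one (x + y) x - rank_one x x \<in> B" using xB sub by (simp add: csubspace_diff)
    then have "y \<in> M" by (simp add: M_def rank_one_add_left)
    then have "q y = 0" by (rule q(4))
    then show False using y by simp
  qed
  then show ?thesis using M x xB by (auto simp: M_def)
qed

section \<open>From unique extensions to the algebra of a subspace\<close>

lemma cinner_unit_parallel:
  fixes x y :: "'a::complex_inner"
  assumes "norm x = 1" "norm y = 1" "cmod (cinner x y) = 1"
  shows "y = cinner x y *\<^sub>C x"
  using norm_diff_component[OF assms(1), of y] assms(2,3) by simp

lemma vector_state_compact_ops:
  assumes "norm x = 1"
  shows "vector_state compact_ops x \<in> pure_states compact_ops"
    and "vector_state compact_ops x \<in> states compact_ops"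
proof -
  have "star_closed (compact_ops :: ('a \<Rightarrow>\<^sub>L 'a) set)"
    using compact_ops_on_star_closed[of "UNIV :: 'a set"]
    by (simp add: compact_ops_on_UNIV closed_csubspace_def csubspace_def)
  then show "vector_state compact_ops x \<in> pure_states compact_ops"
    using rank_one_vector_state(1) assms rank_one_compact by blast
  then show "vector_state compact_ops x \<in> states compact_ops" by (simp add: pure_states_def)
qed

text \<open>Testing the two states on |x><x| gives |<x|y>|^2 = 1, the equality case of
  Cauchy-Schwarz.\<close>

lemma vector_state_compact_ops_eq:
  assumes "norm x = 1" "norm y = 1" "vector_state compact_ops x = vector_state compact_ops y"
  shows "cmod (cinner x y) = 1" "y = cinner x y *\<^sub>C x"
proof -
  have "cinner x (rank_one x x x) = cinner y (rank_one x x y)"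
    using assms(3) by (metis vector_state_apply rank_one_compact)
  moreover note cinner_rank_one_self[of y x]
  ultimately have "complex_of_real ((cmod (cinner x y))\<^sup>2) = 1"
    using assms by (simp add: cinner_simps cinner_self_unit)
  then have "(cmod (cinner x y))\<^sup>2 = 1" using of_real_eq_1_iff by blast
  then show 1: "cmod (cinner x y) = 1"
    using power2_eq_imp_eq[of "cmod (cinner x y)" 1] by simp
  then show "y = cinner x y *\<^sub>C x" using assms by (intro cinner_unit_parallel)
qed

lemma restrict_vector_state:
  assumes "B \<subseteq> A" shows "restrict (vector_state A x) B = vector_state B x"
  using assms by (auto simp: vector_state_def restrict_def fun_eq_iff)

lemma unique_fiber_imp_compact_ops_on:
  fixes B :: "('a::chilbert_space \<Rightarrow>\<^sub>L 'a) set"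
  assumes B: "cstar_subalgebra B compact_ops" and ne: "B \<noteq> {0}"
    and X: "only_fiber B X" "unique_state_extensions B compact_ops X"
  shows "\<exists>M x. closed_csubspace M \<and> x \<in> M \<and> norm x = 1 \<and> B = compact_ops_on M"
proof -
  note sub = cstar_subalgebra_csubspace[OF B] and BK = cstar_subalgebra_subset[OF B]
  have sB: "star_closed B" using B by (rule cstar_subalgebra_star_closed)
  obtain p where p: "p \<in> B" "is_projection p" "p \<noteq> 0"
    and scalar: "\<And>b. b \<in> B \<Longrightarrow> \<exists>c. p o\<^sub>L b o\<^sub>L p = c *\<^sub>C p"
    using minimal_projection[OF B ne] by blast
  obtain x where x: "norm x = 1" "p x = x" using is_projection_fixes_unit p(2,3) by blast
  have vx: "vector_state B x \<in> pure_states B"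
    using vector_state_pure[OF sB p(1,2) x(2,1) scalar] .
  \<comment> \<open>All unit vectors in the range of p give the same state of B. Unique extension
    makes their vector states on the compact operators coincide as well, so the range of p is a
    line.\<close>
  have parallel: "cmod (cinner x y) = 1" if y: "norm y = 1" "p y = y" for y
  proof -
    have "vector_state B y \<in> states B"
      by (rule vector_state_in_states[OF sB p(1) is_projection_norm_le y(2,1)]) (rule p)
    then have "vector_state B y = vector_state B x"
      using state_eq_vector_state[OF sB p(1,2) x(2,1) scalar] p(1) y
      by (simp add: vector_state_apply cinner_self_unit)
    then have "restrict (vector_state compact_ops y) B = vector_state B x"
      "restrict (vector_state compact_ops x) B = vector_state B x"
      using restrict_vector_state[OF BK] by auto
    moreover have "\<exists>!\<phi>. \<phi> \<in> states compact_ops \<and> restrict \<phi> B = vector_state B x"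
      using X only_fiber_pure_states(1)[OF X(1)] vx by (auto simp: unique_state_extensions_def)
    ultimately have "vector_state compact_ops x = vector_state compact_ops y"
      using vector_state_compact_ops(2) x(1) y(1) by blast
    then show ?thesis using vector_state_compact_ops_eq(1) x(1) y(1) by blast
  qed
  have "p = rank_one x x"
  proof (rule blinfun_eqI)
    fix z
    \<comment> \<open>The part of p z orthogonal to x stays in the range of p; normalized, it would
      contradict \<open>parallel\<close>.\<close>
    define r where "r = p z - cinner x z *\<^sub>C x"
    have pr: "p r = r"
      by (simp add: r_def blinfun.diff_right is_projectionD[OF p(2)] clinear_opD x(2))
    have xr: "cinner x r = 0"
      using is_projectionD(3)[OF p(2), of x z] x by (simp add: r_def cinner_simps cinner_self_unit)
    have "r = 0"
    proof (rule ccontr)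
      assume r0: "r \<noteq> 0"
      have "cmod (cinner x ((1 / norm r) *\<^sub>R r)) = 1"
        using r0 pr by (intro parallel) (auto simp: blinfun.scaleR_right)
      then show False using xr by (simp add: cinner.scaleR_right)
    qed
    then show "p z = rank_one x x z" by (simp add: r_def)
  qed
  then have xB: "rank_one x x \<in> B" using p(1) by simp
  define M where "M = {y. rank_one y x \<in> B}"
  have M: "closed_csubspace M"
    unfolding M_def using sub cstar_subalgebra_closed[OF B] by (rule closed_csubspace_rank_one_slice)
  have xM: "x \<in> M" using xB by (simp add: M_def)
  have "B = compact_ops_on M"
  proof (rule ccontr)
    assume "B \<noteq> compact_ops_on M"
    then obtain q where q: "q \<in> B" "is_projection q" "q \<noteq> 0" "\<And>m. m \<in> M \<Longrightarrow> q m = 0"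
      "\<And>b. b \<in> B \<Longrightarrow> \<exists>c. q o\<^sub>L b o\<^sub>L q = c *\<^sub>C q"
      using rank_one_dichotomy[OF B x(1) xB] by (auto simp: M_def)
    obtain y where y: "norm y = 1" "q y = y" using is_projection_fixes_unit q(2,3) by blast
    have vy: "vector_state B y \<in> pure_states B"
      using vector_state_pure[OF sB q(1,2) y(2,1) q(5)] .
    have "\<not> gns_equiv B (vector_state B x) (vector_state B y)"
    proof (rule not_gns_equivI[OF sB xB])
      have "x \<in> (\<lambda>b. blinfun_apply b x) ` B" using p(1) x(2) by (intro image_eqI[of _ _ p]) auto
      then show "x \<in> cyclic_space B x" unfolding cyclic_space_def by (rule subsetD[OF closure_subset])
      show "rank_one x x x \<noteq> 0" using x by (auto simp: cinner_self_unit)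
      \<comment> \<open>q fixes y and kills b* x, which lies in M; hence <x|by> = <b* x|y> = 0 on
        the whole orbit of y.\<close>
      have "cyclic_space B y \<subseteq> {w. rank_one x x w = 0}"
        unfolding cyclic_space_def
      proof (rule closure_minimal)
        show "(\<lambda>b. blinfun_apply b y) ` B \<subseteq> {w. rank_one x x w = 0}"
        proof (clarify)
          fix b assume b: "b \<in> B"
          have lin: "clinear_op b" using star_closed_clinear[OF sB b] .
          have "rank_one (adj b x) x \<in> B"
            using cstar_subalgebra_compose[OF B cstar_subalgebra_adj[OF B b] xB]
            by (simp add: compose_rank_one clinear_op_adj lin)
          then have "q (adj b x) = 0" by (intro q(4)) (simp add: M_def)
          then have "cinner (adj b x) y = 0"
            using is_projectionD(3)[OF q(2), of "adj b x" y] y(2) by simp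
          then show "rank_one x x (b y) = 0" by (simp add: cinner_adj_left[OF lin])
        qed
        show "closed {w. rank_one x x w = 0}"
          by (intro closed_Collect_eq continuous_intros)
      qed
      then show "rank_one x x w = 0" if "w \<in> cyclic_space B y" for w using that by blast
    qed
    then show False using only_fiber_pure_states(2)[OF X(1) vx vy] by blast
  qed
  then show ?thesis using M x xM by blast
qed

section \<open>Pure states, fiber and extensions for the algebra of a subspace\<close>

context
  fixes M :: "'a::chilbert_space set"
  assumes M: "closed_csubspace M"
begin

lemma pure_states_compact_ops_on:
  "pure_states (compact_ops_on M) = vector_state (compact_ops_on M) ` {x \<in> M. norm x = 1}"
  using pure_state_is_vector_state[OF M] rank_one_vector_state(1)[OF compact_ops_on_star_closed[OF M]]
    rank_one_compact_ops_on[OF M]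
  by fastforce

text \<open>|y><x| moves the unit vector x to any given y in M, so the orbit is all of M even before
  closure.\<close>

lemma cyclic_space_compact_ops_on:
  assumes "x \<in> M" "norm x = 1"
  shows "cyclic_space (compact_ops_on M) x = M"
proof -
  have "(\<lambda>b. blinfun_apply b x) ` compact_ops_on M = M"
  proof (intro equalityI subsetI)
    fix y assume "y \<in> M"
    then show "y \<in> (\<lambda>b. blinfun_apply b x) ` compact_ops_on M"
      using assms rank_one_compact_ops_on[OF M, of y x]
      by (intro image_eqI[of _ _ "rank_one y x"]) (auto simp: cinner_self_unit scaleC_one)
  qed (use M in \<open>auto simp: compact_ops_on_iff\<close>)
  then show ?thesis using M by (simp add: cyclic_space_def closed_csubspace_def closure_closed)
qed

lemma only_fiber_compact_ops_on:
  assumes "x \<in> M" "norm x = 1"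
  shows "only_fiber (compact_ops_on M) (pure_states (compact_ops_on M))"
proof (rule only_fiberI)
  show "pure_states (compact_ops_on M) \<noteq> {}" using assms by (auto simp: pure_states_compact_ops_on)
  fix \<omega> \<omega>' assume "\<omega> \<in> pure_states (compact_ops_on M)" "\<omega>' \<in> pure_states (compact_ops_on M)"
  then show "gns_equiv (compact_ops_on M) \<omega> \<omega>'"
    using gns_equiv_same_cyclic_space[OF compact_ops_on_star_closed[OF M]]
    by (auto simp: pure_states_compact_ops_on cyclic_space_compact_ops_on)
qed

text \<open>The subalgebra contains |x><x|, so every extension takes the value 1 there, which
  determines it.\<close>

lemma state_extension_unique:
  assumes x: "x \<in> M" "norm x = 1"
    and \<phi>: "\<phi> \<in> states compact_ops" "restrict \<phi> (compact_ops_on M) = vector_state (compact_ops_on M) x"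
  shows "\<phi> = vector_state compact_ops x"
proof -
  have r: "rank_one x x \<in> compact_ops_on M" using rank_one_compact_ops_on[OF M x(1,1)] .
  have "\<phi> (rank_one x x) = vector_state (compact_ops_on M) x (rank_one x x)"
    using fun_cong[OF \<phi>(2), of "rank_one x x"] r by simp
  then have "\<phi> (rank_one x x) = 1" using x r by (simp add: vector_state_apply cinner_simps cinner_self_unit)
  then show ?thesis
    using rank_one_vector_state(2)[OF compact_ops_on_star_closed[of UNIV]] \<phi>(1) x(2) rank_one_compact
    by (auto simp: compact_ops_on_UNIV closed_csubspace_def csubspace_def)
qed

lemma restrict_vector_state_compact_ops:
  "restrict (vector_state compact_ops x) (compact_ops_on M) = vector_state (compact_ops_on M) x"
  by (rule restrict_vector_state) (auto simp: compact_ops_on_def)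

lemma unique_state_extensions_compact_ops_on:
  "unique_state_extensions (compact_ops_on M) compact_ops (pure_states (compact_ops_on M))"
  unfolding unique_state_extensions_def pure_states_compact_ops_on
proof (clarify)
  fix x assume x: "x \<in> M" "norm x = 1"
  show "\<exists>!\<phi>. \<phi> \<in> states compact_ops \<and> restrict \<phi> (compact_ops_on M) = vector_state (compact_ops_on M) x"
    using vector_state_compact_ops(2)[OF x(2)] restrict_vector_state_compact_ops state_extension_unique[OF x]
    by (intro ex1I[of _ "vector_state compact_ops x"]) blast+
qed

lemma state_extension_vector_state:
  assumes x: "x \<in> M" "norm x = 1"
  shows "state_extension (compact_ops_on M) compact_ops (vector_state (compact_ops_on M) x)
    = vector_state compact_ops x"
  unfolding state_extension_def
  using vector_state_compact_ops(2)[OF x(2)] restrict_vector_state_compact_ops state_extension_unique[OF x]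
  by (intro the_equality) blast+

lemma state_extension_pure_states:
  "state_extension (compact_ops_on M) compact_ops ` pure_states (compact_ops_on M)
    = vector_state compact_ops ` {x \<in> M. norm x = 1}"
  unfolding pure_states_compact_ops_on image_image
  by (intro image_cong) (auto simp: state_extension_vector_state)

end

section \<open>Lines and their unit representatives\<close>

lemma line_scaleC: "c \<noteq> 0 \<Longrightarrow> line (c *\<^sub>C x) = line (x :: 'a::complex_normed_vector)"
proof -
  assume c: "c \<noteq> 0"
  have "a *\<^sub>C x \<in> range (\<lambda>b. b *\<^sub>C c *\<^sub>C x)" for a
    using c by (intro range_eqI[of _ _ "a / c"]) (simp add: scaleC_scaleC)
  then show ?thesis by (auto simp: line_def scaleC_scaleC)
qed

lemma line_unit_eqD:
  assumes "line x = line (y :: 'a::complex_normed_vector)" "norm x = 1" "norm y = 1"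
  shows "\<exists>c. cmod c = 1 \<and> y = c *\<^sub>C x"
proof -
  have "y \<in> line y" unfolding line_def by (intro range_eqI[of _ _ 1]) (simp add: scaleC_one)
  then have "y \<in> line x" using assms(1) by simp
  then obtain c where "y = c *\<^sub>C x" by (auto simp: line_def)
  then show ?thesis using assms(2,3) by (auto simp: norm_scaleC)
qed

lemma state_to_proj_vector_state:
  assumes x: "norm x = 1"
  shows "state_to_proj (vector_state compact_ops x) = line x"
  unfolding state_to_proj_def
proof (rule the_equality)
  fix p assume "\<exists>y. norm y = 1 \<and> p = line y \<and> (\<forall>a\<in>compact_ops. vector_state compact_ops x a = cinner y (a y))"
  then obtain y where y: "norm y = 1" "p = line y"
    "\<And>a. a \<in> compact_ops \<Longrightarrow> vector_state compact_ops x a = cinner y (a y)" by blast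
  have eq: "vector_state compact_ops x = vector_state compact_ops y"
    using y(3) by (intro extensionalityI[of _ compact_ops]) (auto simp: vector_state_def)
  have "y = cinner x y *\<^sub>C x" "cinner x y \<noteq> 0"
    using vector_state_compact_ops_eq[OF x y(1) eq] by auto
  then show "p = line x" using line_scaleC y(2) by metis
qed (use x in \<open>auto simp: vector_state_apply\<close>)

section \<open>Projective space\<close>

lemma line_normalize: "(x::'a::complex_normed_vector) \<noteq> 0 \<Longrightarrow> line ((1 / norm x) *\<^sub>R x) = line x"
  by (simp add: scaleR_scaleC line_scaleC)

lemma line_mem_proj_of_iff:
  assumes M: "csubspace M" and x: "x \<noteq> 0"
  shows "line x \<in> proj_of M \<longleftrightarrow> x \<in> M"
proof
  assume "line x \<in> proj_of M"
  then obtain y where y: "y \<in> M" "norm y = 1" "line x = line y" by (auto simp: proj_of_def)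
  then have "line y = line ((1 / norm x) *\<^sub>R x)" using x by (simp add: line_normalize)
  then obtain c where "(1 / norm x) *\<^sub>R x = c *\<^sub>C y"
    using line_unit_eqD[of y "(1 / norm x) *\<^sub>R x"] y(2) x by auto
  then have "norm x *\<^sub>R (1 / norm x) *\<^sub>R x \<in> M"
    using y(1) M by (simp only: csubspace_scaleR csubspace_scaleC)
  then show "x \<in> M" using x by simp
next
  assume "x \<in> M"
  then have "(1 / norm x) *\<^sub>R x \<in> M" "norm ((1 / norm x) *\<^sub>R x) = 1"
    using M x by (auto simp: csubspace_scaleR)
  then show "line x \<in> proj_of M"
    unfolding proj_of_def using line_normalize[OF x] by (intro image_eqI[of _ _ "(1 / norm x) *\<^sub>R x"]) auto
qed

section \<open>The Fubini-Study distance\<close>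

lemma fs_dist_line:
  assumes "norm x = 1" "norm y = 1"
  shows "fs_dist (line x) (line y) = sqrt 2 * arccos (cmod (cinner x y))"
proof -
  have "d = sqrt 2 * arccos (cmod (cinner x y))"
    if d: "norm x' = 1" "norm y' = 1" "line x = line x'" "line y = line y'"
      "d = sqrt 2 * arccos (cmod (cinner x' y'))" for d x' y'
  proof -
    obtain a b where "cmod a = 1" "x' = a *\<^sub>C x" "cmod b = 1" "y' = b *\<^sub>C y"
      using line_unit_eqD d assms by metis
    then show ?thesis using d(5) by (simp add: cinner_simps norm_mult)
  qed
  then have "(THE d. \<exists>x' y'. norm x' = 1 \<and> norm y' = 1 \<and> line x = line x' \<and> line y = line y' \<and>
      d = sqrt 2 * arccos (cmod (cinner x' y'))) = sqrt 2 * arccos (cmod (cinner x y))"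
    using assms by (intro the_equality) blast+
  moreover have "line x \<in> proj_space" "line y \<in> proj_space" using assms by (auto simp: proj_of_def)
  ultimately show ?thesis by (simp add: fs_dist_def)
qed

lemma cmod_cinner_unit_le: "norm x = 1 \<Longrightarrow> norm y = 1 \<Longrightarrow> cmod (cinner x y) \<le> 1"
  using cinner_cmod_le[of x y] by simp

lemma neg_one_le_cmod: "- 1 \<le> cmod z"
  by (rule order_trans[OF _ norm_ge_zero]) simp

text \<open>Splitting x and z along y gives <x|z> = <x|y><y|z> + <x'|z'> with x' and z' orthogonal
  to y. Cauchy-Schwarz for the second term leads to the addition formula of the cosine; both angles
  are at most pi/2, so their sum stays in the range of arccos.\<close>

lemma fs_triangle:
  fixes x y z :: "'a::complex_inner"
  assumes u: "norm x = 1" "norm y = 1" "norm z = 1"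
  shows "arccos (cmod (cinner x z)) \<le> arccos (cmod (cinner x y)) + arccos (cmod (cinner y z))"
proof -
  define x' z' where "x' = x - cinner y x *\<^sub>C y" and "z' = z - cinner y z *\<^sub>C y"
  have norm_perp: "norm (w - cinner y w *\<^sub>C y) = sqrt (1 - (cmod (cinner y w))\<^sup>2)"
    if "norm w = 1" for w :: 'a
    using norm_diff_component[OF u(2), of w] that by (metis norm_ge_zero one_power2 real_sqrt_abs abs_of_nonneg)
  let ?a = "cmod (cinner x y)" and ?b = "cmod (cinner y z)" and ?c = "cmod (cinner x z)"
  have sym: "cmod (cinner y x) = ?a" by (metis cinner_commute complex_mod_cnj)
  have "cinner x' z' = cinner x z - cinner x y * cinner y z"
    by (simp add: x'_def z'_def cinner_simps cinner_self_unit u flip: cinner_commute)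
  then have "cinner x y * cinner y z = cinner x z - cinner x' z'" by simp
  then have "?a * ?b \<le> ?c + cmod (cinner x' z')"
    by (metis norm_mult norm_triangle_ineq4)
  also have "cmod (cinner x' z') \<le> norm x' * norm z'" by (rule cinner_cmod_le)
  also have "norm x' * norm z' = sqrt (1 - ?a\<^sup>2) * sqrt (1 - ?b\<^sup>2)"
    unfolding x'_def z'_def using u by (simp add: norm_perp sym)
  finally have le: "?a * ?b - sqrt (1 - ?a\<^sup>2) * sqrt (1 - ?b\<^sup>2) \<le> ?c" by simp
  have ab: "?a \<le> 1" "?b \<le> 1" "?c \<le> 1" using u cmod_cinner_unit_le by auto
  have cos: "cos (arccos ?a + arccos ?b) = ?a * ?b - sqrt (1 - ?a\<^sup>2) * sqrt (1 - ?b\<^sup>2)"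
    using ab by (simp add: cos_add cos_arccos_abs sin_arccos_abs)
  have "arccos ?c \<le> arccos (cos (arccos ?a + arccos ?b))"
    using ab le by (intro arccos_le_arccos) (auto simp flip: cos)
  also have "\<dots> = arccos ?a + arccos ?b"
    using ab arccos_le_pi2[of ?a] arccos_le_pi2[of ?b]
    by (intro arccos_cos add_nonneg_nonneg arccos_lbound neg_one_le_cmod) auto
  finally show ?thesis .
qed

lemma arccos_eq_0: "0 \<le> c \<Longrightarrow> c \<le> 1 \<Longrightarrow> arccos c = 0 \<longleftrightarrow> c = 1"
  using cos_arccos[of c] by (metis arccos_1 cos_zero neg_le_0_iff_le order_trans zero_le_one)

lemma Metric_space_fs_dist: "Metric_space proj_space fs_dist"
proof
  fix p q r :: "'a set"
  have unit: "\<exists>x. norm x = 1 \<and> p = line x" if "p \<in> proj_space" for p :: "'a set"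
    using that by (auto simp: proj_of_def)
  \<comment> \<open>Nonnegativity and symmetry are demanded for all arguments, also off the
    projective space, where \<open>fs_dist\<close> has its default value 0.\<close>
  show "0 \<le> fs_dist p q"
  proof (cases "p \<in> proj_space \<and> q \<in> proj_space")
    case True
    then obtain x y where "norm x = 1" "norm y = 1" "p = line x" "q = line y" using unit by metis
    moreover have "0 \<le> arccos (cmod (cinner x y))"
      using calculation cmod_cinner_unit_le[of x y] by (intro arccos_lbound neg_one_le_cmod) auto
    ultimately show ?thesis by (simp add: fs_dist_line)
  qed (auto simp: fs_dist_def)
  show "fs_dist p q = fs_dist q p"
  proof (cases "p \<in> proj_space \<and> q \<in> proj_space")
    case True
    then obtain x y where "norm x = 1" "norm y = 1" "p = line x" "q = line y" using unit by metis
    then show ?thesis by (simp add: fs_dist_line) (metis cinner_commute complex_mod_cnj)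
  qed (auto simp: fs_dist_def)
  assume pq: "p \<in> proj_space" "q \<in> proj_space"
  then obtain x y where xy: "norm x = 1" "norm y = 1" "p = line x" "q = line y" using unit by metis
  show "fs_dist p q = 0 \<longleftrightarrow> p = q"
  proof
    assume "fs_dist p q = 0"
    then have c: "cmod (cinner x y) = 1"
      using xy arccos_eq_0[of "cmod (cinner x y)"] cmod_cinner_unit_le[of x y] by (simp add: fs_dist_line)
    then have "y = cinner x y *\<^sub>C x" "cinner x y \<noteq> 0" using xy cinner_unit_parallel by auto
    then show "p = q" using xy line_scaleC by metis
  next
    assume "p = q"
    then show "fs_dist p q = 0" using xy by (simp add: fs_dist_line cinner_self_unit)
  qed
  assume "r \<in> proj_space"
  then obtain z where z: "norm z = 1" "r = line z" using unit by metis
  have "sqrt 2 * arccos (cmod (cinner x z))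
      \<le> sqrt 2 * (arccos (cmod (cinner x y)) + arccos (cmod (cinner y z)))"
    using xy z by (intro mult_left_mono fs_triangle) auto
  then show "fs_dist p r \<le> fs_dist p q + fs_dist q r"
    using xy z by (simp add: fs_dist_line distrib_left)
qed

text \<open>A unit vector x outside M has a projection of norm k < 1, and |<x|y>| <= k for every
  unit y in M; so the ball of radius sqrt 2 times arccos k around [x] contains no line of M.\<close>

lemma closedin_proj_of:
  fixes M :: "'a::chilbert_space set"
  assumes M: "closed_csubspace M"
  shows "closedin proj_topology (proj_of M)"
proof -
  interpret FS: Metric_space "proj_space :: 'a set set" fs_dist by (rule Metric_space_fs_dist)
  obtain p where p: "is_projection p" "\<And>y. p y \<in> M" "\<And>y. y \<in> M \<Longrightarrow> p y = y"
    using projection_onto[OF M] by blast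
  show ?thesis unfolding FS.closedin_metric
  proof (intro conjI allI impI)
    show "proj_of M \<subseteq> proj_space" by (auto simp: proj_of_def)
    fix q assume "q \<in> proj_space - proj_of M"
    then obtain x where x: "norm x = 1" "q = line x" "x \<notin> M"
      by (auto simp: proj_of_def)
    define k where "k = norm (p x)"
    have k1: "k \<le> 1" using is_projection_norm_apply_le[OF p(1), of x] x(1) by (simp add: k_def)
    have "k \<noteq> 1"
    proof
      assume "k = 1"
      then have "x = p x" using is_projection_pythagoras[OF p(1), of x] x(1) by (simp add: k_def)
      then show False using p(2)[of x] x(3) by simp
    qed
    then have "k < 1" using k1 by simp
    then have "arccos k \<noteq> 0" using arccos_eq_0[of k] by (simp add: k_def)
    then have pos: "arccos k > 0" using arccos_lbound[of k] k1 norm_ge_zero[of "p x"] by (simp add: k_def)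
    have "r \<notin> FS.mball q (sqrt 2 * arccos k)" if r: "r \<in> proj_of M" for r
    proof -
      obtain y where y: "y \<in> M" "norm y = 1" "r = line y" using r by (auto simp: proj_of_def)
      have "cinner x y = cinner (p x) y" using p(3)[OF y(1)] is_projectionD(3)[OF p(1), of x y] by simp
      then have "cmod (cinner x y) \<le> k" using cinner_cmod_le[of "p x" y] y by (simp add: k_def)
      then have "arccos k \<le> arccos (cmod (cinner x y))"
        using k1 by (intro arccos_le_arccos neg_one_le_cmod)
      then show ?thesis using x y by (simp add: FS.mball_def fs_dist_line not_less)
    qed
    then show "\<exists>r>0. disjnt (proj_of M) (FS.mball q r)"
      using pos by (intro exI[of _ "sqrt 2 * arccos k"]) (auto simp: disjnt_def)
  qed
qed

lemma orth_compl_single: "x \<in> orth_compl {\<xi>} \<longleftrightarrow> cinner \<xi> x = 0"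
  by (simp add: orth_compl_def)

lemma line_mem_std_dom_iff:
  assumes "x \<noteq> 0" shows "line x \<in> std_dom \<xi> \<longleftrightarrow> cinner \<xi> x \<noteq> 0"
proof
  assume "line x \<in> std_dom \<xi>"
  then obtain y where y: "norm y = 1" "cinner \<xi> y \<noteq> 0" "line x = line y" by (auto simp: std_dom_def)
  then obtain c where c: "(1 / norm x) *\<^sub>R x = c *\<^sub>C y" "cmod c = 1"
    using line_unit_eqD[of y "(1 / norm x) *\<^sub>R x"] assms by (auto simp: line_normalize)
  have "cinner \<xi> ((1 / norm x) *\<^sub>R x) \<noteq> 0" unfolding c(1) using c(2) y(2) by (auto simp: cinner_simps)
  then show "cinner \<xi> x \<noteq> 0" by (auto simp: cinner.scaleR_right)
next
  assume "cinner \<xi> x \<noteq> 0"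
  then show "line x \<in> std_dom \<xi>" unfolding std_dom_def using assms
    by (intro image_eqI[of _ _ "(1 / norm x) *\<^sub>R x"]) (auto simp: line_normalize cinner.scaleR_right)
qed

lemma line_mem_std_dom_self: "norm \<xi> = 1 \<Longrightarrow> line \<xi> \<in> std_dom \<xi>"
  using line_mem_std_dom_iff[of \<xi> \<xi>] by (cases "\<xi> = 0") (auto simp: cinner_self_unit)

text \<open>Describes the chart domain as the complement of the lines in a closed subspace, from
  which its openness follows by \<open>closedin_proj_of\<close>.\<close>

lemma std_dom_eq: "std_dom (\<xi> :: 'a::chilbert_space) = proj_space - proj_of (orth_compl {\<xi>})"
proof (intro set_eqI iffI)
  fix p assume "p \<in> std_dom \<xi>"
  then obtain x where x: "norm x = 1" "cinner \<xi> x \<noteq> 0" "p = line x" by (auto simp: std_dom_def)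
  then have "x \<noteq> 0" by auto
  then show "p \<in> proj_space - proj_of (orth_compl {\<xi>})"
    using x line_mem_proj_of_iff[OF csubspace_orth_compl[of "{\<xi>}"], of x]
    by (auto simp: orth_compl_single proj_of_def)
qed (auto simp: proj_of_def std_dom_def orth_compl_single)

lemma openin_std_dom: "openin proj_topology (std_dom (\<xi> :: 'a::chilbert_space))"
proof -
  interpret FS: Metric_space "proj_space :: 'a set set" fs_dist by (rule Metric_space_fs_dist)
  show ?thesis
    using closedin_proj_of[OF closed_csubspace_orth_compl, of "{\<xi>}"] openin_diff[OF openin_topspace]
    by (metis FS.topspace_mtopology std_dom_eq)
qed

section \<open>The standard charts\<close>

text \<open>The defining expression is unchanged when y is multiplied by a nonzero scalar, so the
  chart can be computed from any representative, not only from unit vectors.\<close>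

lemma std_chart_line:
  assumes "cinner \<xi> y \<noteq> 0"
  shows "std_chart \<xi> (line y) = inverse (cinner \<xi> y) *\<^sub>C y - \<xi>"
  unfolding std_chart_def
proof (rule the_equality)
  have y0: "y \<noteq> 0" using assms by auto
  have scale: "inverse (cinner \<xi> (c *\<^sub>C z)) *\<^sub>C (c *\<^sub>C z) = inverse (cinner \<xi> z) *\<^sub>C z"
    if "c \<noteq> 0" for c z
    using that by (simp add: cinner_simps scaleC_scaleC field_simps)
  let ?u = "(1 / norm y) *\<^sub>R y"
  have u: "norm ?u = 1" "line y = line ?u" using y0 by (auto simp: line_normalize)
  have u_eq: "inverse (cinner \<xi> ?u) *\<^sub>C ?u = inverse (cinner \<xi> y) *\<^sub>C y"
    using scale[of "of_real (1 / norm y)" y] y0 by (simp add: scaleR_scaleC)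
  show "\<exists>x. norm x = 1 \<and> line y = line x \<and>
      inverse (cinner \<xi> y) *\<^sub>C y - \<xi> = inverse (cinner \<xi> x) *\<^sub>C x - \<xi>"
    using u u_eq by metis
  fix v assume "\<exists>x. norm x = 1 \<and> line y = line x \<and> v = inverse (cinner \<xi> x) *\<^sub>C x - \<xi>"
  then obtain x where x: "norm x = 1" "line y = line x" "v = inverse (cinner \<xi> x) *\<^sub>C x - \<xi>" by blast
  obtain c where c: "cmod c = 1" "x = c *\<^sub>C ?u" using line_unit_eqD[of ?u x] u x by auto
  then have "c \<noteq> 0" by auto
  then have "inverse (cinner \<xi> x) *\<^sub>C x = inverse (cinner \<xi> ?u) *\<^sub>C ?u"
    unfolding c(2) by (rule scale)
  then show "v = inverse (cinner \<xi> y) *\<^sub>C y - \<xi>" by (simp add: x(3) u_eq)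
qed

context
  fixes \<xi> :: "'a::chilbert_space"
  assumes \<xi>: "norm \<xi> = 1"
begin

lemma cinner_affine: "v \<in> orth_compl {\<xi>} \<Longrightarrow> cinner \<xi> (\<xi> + v) = 1"
  by (simp add: orth_compl_single cinner_simps cinner_self_unit \<xi>)

lemma affine_nonzero: "v \<in> orth_compl {\<xi>} \<Longrightarrow> \<xi> + v \<noteq> 0"
  using cinner_affine by force

text \<open>The inverse of the chart sends v to [\<xi> + v], the representative normalized to have
  inner product 1 with \<xi>.\<close>

lemma std_chart_affine:
  assumes "v \<in> orth_compl {\<xi>}"
  shows "line (\<xi> + v) \<in> std_dom \<xi>" "std_chart \<xi> (line (\<xi> + v)) = v"
  using cinner_affine[OF assms] affine_nonzero[OF assms]
  by (simp_all add: line_mem_std_dom_iff std_chart_line scaleC_one)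

lemma std_chart_range:
  assumes "p \<in> std_dom \<xi>"
  shows "std_chart \<xi> p \<in> orth_compl {\<xi>}" "line (\<xi> + std_chart \<xi> p) = p"
proof -
  obtain x where x: "p = line x" "cinner \<xi> x \<noteq> 0" using assms by (auto simp: std_dom_def)
  show "std_chart \<xi> p \<in> orth_compl {\<xi>}"
    using x by (simp add: std_chart_line orth_compl_single cinner_simps cinner_self_unit \<xi>)
  show "line (\<xi> + std_chart \<xi> p) = p" using x by (simp add: std_chart_line line_scaleC)
qed

lemma inj_on_std_chart: "inj_on (std_chart \<xi>) (std_dom \<xi>)"
  using std_chart_range(2) by (metis inj_onI)

lemma inv_into_std_chart:
  assumes "v \<in> orth_compl {\<xi>}"
  shows "inv_into (std_dom \<xi>) (std_chart \<xi>) v = line (\<xi> + v)"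
  using inv_into_f_f[OF inj_on_std_chart std_chart_affine(1)[OF assms]] std_chart_affine(2)[OF assms] by simp

lemma std_chart_image:
  "std_chart \<xi> ` (std_dom \<xi> \<inter> std_dom \<eta>) = {v \<in> orth_compl {\<xi>}. cinner \<eta> (\<xi> + v) \<noteq> 0}"
proof (intro set_eqI iffI)
  fix v assume "v \<in> std_chart \<xi> ` (std_dom \<xi> \<inter> std_dom \<eta>)"
  then obtain p where p: "p \<in> std_dom \<xi>" "p \<in> std_dom \<eta>" "v = std_chart \<xi> p" by blast
  then have v: "v \<in> orth_compl {\<xi>}" "line (\<xi> + v) = p" using std_chart_range by auto
  then show "v \<in> {v \<in> orth_compl {\<xi>}. cinner \<eta> (\<xi> + v) \<noteq> 0}"
    using p(2) line_mem_std_dom_iff[OF affine_nonzero[OF v(1)]] by auto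
next
  fix v assume "v \<in> {v \<in> orth_compl {\<xi>}. cinner \<eta> (\<xi> + v) \<noteq> 0}"
  then have v: "v \<in> orth_compl {\<xi>}" "line (\<xi> + v) \<in> std_dom \<eta>"
    using line_mem_std_dom_iff[OF affine_nonzero] by auto
  then show "v \<in> std_chart \<xi> ` (std_dom \<xi> \<inter> std_dom \<eta>)"
    using std_chart_affine[OF v(1)] by (intro image_eqI[of _ _ "line (\<xi> + v)"]) auto
qed

lemma std_chart_image_dom: "std_chart \<xi> ` std_dom \<xi> = orth_compl {\<xi>}"
  using std_chart_image[of \<xi>] cinner_affine by auto

lemma openin_std_chart_image: "openin (top_of_set (orth_compl {\<xi>})) (std_chart \<xi> ` (std_dom \<xi> \<inter> std_dom \<eta>))"
proof -
  have "open {v. cinner \<eta> (\<xi> + v) \<noteq> 0}" by (intro open_Collect_neq continuous_intros)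
  moreover have "std_chart \<xi> ` (std_dom \<xi> \<inter> std_dom \<eta>) = orth_compl {\<xi>} \<inter> {v. cinner \<eta> (\<xi> + v) \<noteq> 0}"
    unfolding std_chart_image by blast
  ultimately show ?thesis by (auto simp: openin_open)
qed

lemma std_chart_transition:
  "holomorphic_map_on (std_chart \<eta> \<circ> inv_into (std_dom \<xi>) (std_chart \<xi>))
     (std_chart \<xi> ` (std_dom \<xi> \<inter> std_dom \<eta>))"
  unfolding holomorphic_map_on_def std_chart_image
proof
  let ?S = "{v \<in> orth_compl {\<xi>}. cinner \<eta> (\<xi> + v) \<noteq> 0}"
  fix v assume v: "v \<in> ?S"
  \<comment> \<open>The transition map is (\<xi> + v) / <\<eta>|\<xi> + v> - \<eta>. This is the
    product rule for the scalar inverse and the affine vector; the trailing 0 is the derivative of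
    the constant \<eta>.\<close>
  let ?D = "\<lambda>h. (inverse (cinner \<eta> (\<xi> + v)) *\<^sub>C h
    + (- (inverse (cinner \<eta> (\<xi> + v)) * cinner \<eta> h * inverse (cinner \<eta> (\<xi> + v)))) *\<^sub>C (\<xi> + v)) - 0"
  have aff: "((\<lambda>w. \<xi> + w) has_derivative (\<lambda>h. h)) (at v within ?S)"
    using has_derivative_add[OF has_derivative_const has_derivative_ident] by simp
  have inv: "((\<lambda>w. inverse (cinner \<eta> (\<xi> + w))) has_derivative
      (\<lambda>h. - (inverse (cinner \<eta> (\<xi> + v)) * cinner \<eta> h * inverse (cinner \<eta> (\<xi> + v))))) (at v within ?S)"
    using v by (intro Deriv.has_derivative_inverse
        bounded_linear.has_derivative[OF cinner.bounded_linear_right aff]) simp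
  have "((\<lambda>w. inverse (cinner \<eta> (\<xi> + w)) *\<^sub>C (\<xi> + w) - \<eta>) has_derivative ?D) (at v within ?S)"
    by (intro has_derivative_diff has_derivative_const bounded_bilinear.FDERIV[OF bounded_bilinear_scaleC] inv aff)
  then have "(std_chart \<eta> \<circ> inv_into (std_dom \<xi>) (std_chart \<xi>) has_derivative ?D) (at v within ?S)"
    using v by (rule has_derivative_transform[rotated 2])
      (auto simp: inv_into_std_chart std_chart_line)
  moreover have "?D (c *\<^sub>C h) = c *\<^sub>C ?D h" for c h
    by (simp add: cinner_simps scaleC_add_right scaleC_scaleC mult_ac scaleC_left_commute scaleC_diff_right)
  ultimately show "\<exists>D. (std_chart \<eta> \<circ> inv_into (std_dom \<xi>) (std_chart \<xi>) has_derivative D) (at v within ?S) \<and>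
      (\<forall>c v. D (c *\<^sub>C v) = c *\<^sub>C D v)"
    by blast
qed

end

lemma proj_chart_std:
  assumes \<xi>: "norm \<xi> = 1"
  shows "proj_chart (std_dom \<xi>) (std_chart \<xi>) (orth_compl {\<xi>})"
  unfolding proj_chart_def
proof (intro conjI allI impI)
  show "std_chart \<xi> ` std_dom \<xi> \<subseteq> orth_compl {\<xi>}" using std_chart_image_dom[OF \<xi>] by simp
  fix \<eta> :: 'a assume \<eta>: "norm \<eta> = 1"
  show "openin (top_of_set (orth_compl {\<xi>})) (std_chart \<xi> ` (std_dom \<xi> \<inter> std_dom \<eta>))"
    by (rule openin_std_chart_image[OF \<xi>])
  show "holomorphic_map_on (std_chart \<xi> \<circ> inv_into (std_dom \<eta>) (std_chart \<eta>))
     (std_chart \<eta> ` (std_dom \<xi> \<inter> std_dom \<eta>))"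
    using std_chart_transition[OF \<eta>, of \<xi>] by (simp only: Int_commute)
  show "holomorphic_map_on (std_chart \<eta> \<circ> inv_into (std_dom \<xi>) (std_chart \<xi>))
     (std_chart \<xi> ` (std_dom \<xi> \<inter> std_dom \<eta>))"
    by (rule std_chart_transition[OF \<xi>])
qed (use openin_std_dom closed_csubspace_orth_compl inj_on_std_chart[OF \<xi>] in auto)

lemma closed_csubspace_Int: "closed_csubspace S \<Longrightarrow> closed_csubspace T \<Longrightarrow> closed_csubspace (S \<inter> T)"
  by (auto simp: closed_csubspace_def csubspace_def)

text \<open>As \<xi> belongs to M, the vector \<xi> + v belongs to M exactly when v does.\<close>

lemma straightens_proj_of:
  fixes M :: "'a::chilbert_space set"
  assumes M: "closed_csubspace M" and \<xi>: "\<xi> \<in> M" "norm \<xi> = 1"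
  shows "straightens (proj_of M) (std_dom \<xi>) (std_chart \<xi>) (M \<inter> orth_compl {\<xi>})"
  unfolding straightens_def
proof (intro exI[of _ "orth_compl {\<xi>}"] conjI)
  have sub: "csubspace M" using M by (simp add: closed_csubspace_def)
  show "proj_chart (std_dom \<xi>) (std_chart \<xi>) (orth_compl {\<xi>})" using proj_chart_std[OF \<xi>(2)] .
  show "closed_csubspace (M \<inter> orth_compl {\<xi>})"
    by (intro closed_csubspace_Int M closed_csubspace_orth_compl)
  show "std_chart \<xi> ` (proj_of M \<inter> std_dom \<xi>) = M \<inter> orth_compl {\<xi>} \<inter> std_chart \<xi> ` std_dom \<xi>"
    unfolding std_chart_image_dom[OF \<xi>(2)]
  proof (intro set_eqI iffI)
    fix v assume "v \<in> std_chart \<xi> ` (proj_of M \<inter> std_dom \<xi>)"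
    then obtain p where p: "p \<in> proj_of M" "p \<in> std_dom \<xi>" "v = std_chart \<xi> p" by blast
    then have v: "v \<in> orth_compl {\<xi>}" "line (\<xi> + v) = p" using std_chart_range[OF \<xi>(2)] by auto
    then have "\<xi> + v \<in> M" using p(1) line_mem_proj_of_iff[OF sub affine_nonzero[OF \<xi>(2) v(1)]] by simp
    then have "\<xi> + v - \<xi> \<in> M" using \<xi>(1) sub by (intro csubspace_diff)
    then show "v \<in> M \<inter> orth_compl {\<xi>} \<inter> orth_compl {\<xi>}" using v(1) by simp
  next
    fix v assume "v \<in> M \<inter> orth_compl {\<xi>} \<inter> orth_compl {\<xi>}"
    then have v: "v \<in> M" "v \<in> orth_compl {\<xi>}" by auto
    then have "line (\<xi> + v) \<in> proj_of M"
      using line_mem_proj_of_iff[OF sub affine_nonzero[OF \<xi>(2) v(2)]] \<xi>(1) sub by (simp add: csubspace_add)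
    then show "v \<in> std_chart \<xi> ` (proj_of M \<inter> std_dom \<xi>)"
      using std_chart_affine[OF \<xi>(2) v(2)] by (intro image_eqI[of _ _ "line (\<xi> + v)"]) auto
  qed
qed auto

lemma closed_kaehler_submanifold_proj_of:
  fixes M :: "'a::chilbert_space set"
  assumes M: "closed_csubspace M"
  shows "closed_kaehler_submanifold (proj_of M)"
  unfolding closed_kaehler_submanifold_def
proof (intro conjI ballI closedin_proj_of M)
  fix p assume "p \<in> proj_of M"
  then obtain \<xi> where \<xi>: "\<xi> \<in> M" "norm \<xi> = 1" "p = line \<xi>" by (auto simp: proj_of_def)
  then have "p \<in> std_dom \<xi>" by (simp add: line_mem_std_dom_self)
  then show "\<exists>V b F. p \<in> V \<and> straightens (proj_of M) V b F"
    using straightens_proj_of[OF M \<xi>(1,2)] by blast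
qed

section \<open>Tangent spaces\<close>

lemma std_chart_self: "norm \<xi> = 1 \<Longrightarrow> std_chart \<xi> (line \<xi>) = 0"
  by (simp add: std_chart_line cinner_self_unit scaleC_one)

text \<open>In the chart at \<xi> itself the coordinate change is the identity, so the straightening
  subspace consists of tangent vectors.\<close>

lemma tangent_space_superset:
  fixes M :: "'a::chilbert_space set"
  assumes M: "closed_csubspace M" and \<xi>: "\<xi> \<in> M" "norm \<xi> = 1"
  shows "M \<inter> orth_compl {\<xi>} \<subseteq> tangent_space (proj_of M) \<xi>"
proof
  fix w assume w: "w \<in> M \<inter> orth_compl {\<xi>}"
  have "((\<lambda>v. v) has_derivative (\<lambda>h. h)) (at 0 within orth_compl {\<xi>})" by (rule has_derivative_ident)
  then have "(std_chart \<xi> \<circ> inv_into (std_dom \<xi>) (std_chart \<xi>) has_derivative (\<lambda>h. h)) (at 0 within orth_compl {\<xi>})"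
    by (rule has_derivative_transform[rotated 2])
      (auto simp: inv_into_std_chart[OF \<xi>(2)] std_chart_affine[OF \<xi>(2)] csubspace_0[OF csubspace_orth_compl])
  then show "w \<in> tangent_space (proj_of M) \<xi>"
    unfolding tangent_space_def
    using straightens_proj_of[OF M \<xi>] w line_mem_std_dom_self[OF \<xi>(2)]
    by (intro CollectI exI[of _ "std_dom \<xi>"] exI[of _ "std_chart \<xi>"] exI[of _ "M \<inter> orth_compl {\<xi>}"]
        exI[of _ "\<lambda>h. h"] exI[of _ w])
      (auto simp: std_chart_self[OF \<xi>(2)] std_chart_image_dom[OF \<xi>(2)])
qed

text \<open>\<open>tangent_space\<close> admits every straightening chart, so the derivative of an
  arbitrary coordinate change has to be treated. Points of F near the base point are mapped into M,
  hence so are the difference quotients along w, and M is closed.\<close>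

lemma tangent_space_subset:
  fixes M :: "'a::chilbert_space set"
  assumes M: "closed_csubspace M" and \<xi>: "\<xi> \<in> M" "norm \<xi> = 1"
  shows "tangent_space (proj_of M) \<xi> \<subseteq> M"
proof
  fix v assume "v \<in> tangent_space (proj_of M) \<xi>"
  then obtain V b F D w where V: "line \<xi> \<in> V" "straightens (proj_of M) V b F" "w \<in> F" "v = D w"
    and D: "(std_chart \<xi> \<circ> inv_into V b has_derivative D) (at (b (line \<xi>)) within b ` (V \<inter> std_dom \<xi>))"
    unfolding tangent_space_def by (elim CollectE exE conjE)
  have sub: "csubspace M" using M by (simp add: closed_csubspace_def)
  obtain E where E: "proj_chart V b E" "closed_csubspace F" "F \<subseteq> E" "b ` (proj_of M \<inter> V) = F \<inter> b ` V"
    using V(2) by (auto simp: straightens_def)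
  have Fsub: "csubspace F" using E(2) by (simp add: closed_csubspace_def)
  define g S x where "g = std_chart \<xi> \<circ> inv_into V b" and "S = b ` (V \<inter> std_dom \<xi>)" and "x = b (line \<xi>)"
  have inj: "inj_on b V" and openS: "openin (top_of_set E) S"
    using E(1) \<xi>(2) by (auto simp: proj_chart_def S_def)
  have "line \<xi> \<in> proj_of M" using \<xi> by (auto simp: proj_of_def)
  then have xF: "x \<in> F" using E(4) V(1) by (auto simp: x_def)
  have xS: "x \<in> S" using V(1) line_mem_std_dom_self[OF \<xi>(2)] by (auto simp: S_def x_def)
  have gx: "g x = 0" using V(1) inj by (simp add: g_def x_def std_chart_self[OF \<xi>(2)])
  have gM: "g y \<in> M" if y: "y \<in> F" "y \<in> S" for y
  proof -
    obtain q where q: "q \<in> V" "q \<in> std_dom \<xi>" "y = b q" using y(2) by (auto simp: S_def)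
    then have "b q \<in> b ` (proj_of M \<inter> V)" using y(1) E(4) by auto
    then have "q \<in> proj_of M" using inj q(1) by (auto simp: inj_on_def)
    then obtain z where z: "z \<in> M" "q = line z" "norm z = 1" by (auto simp: proj_of_def)
    then have "z \<noteq> 0" by auto
    then have "cinner \<xi> z \<noteq> 0" using q(2) z line_mem_std_dom_iff by auto
    moreover have "g y = std_chart \<xi> q" using q inj by (simp add: g_def)
    ultimately show ?thesis using z \<xi>(1) sub
      by (simp add: std_chart_line csubspace_diff csubspace_scaleC)
  qed
  show "v \<in> M"
  \<comment> \<open>The points approaching x along w have to differ from x, which fails for w =
    0.\<close>
  proof (cases "w = 0")
    case True
    have "bounded_linear D" using D by (rule has_derivative_bounded_linear)
    then have "v = 0" using True V(4) by (simp add: linear_simps(3))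
    then show ?thesis using sub by (simp add: csubspace_0)
  next
    case False
    \<comment> \<open>S is relatively open in E and F lies in E, so short steps from x along F stay
      in the domain of the coordinate change.\<close>
    obtain e where e: "e > 0" "ball x e \<inter> E \<subseteq> S"
      using openS xS unfolding openin_contains_ball by blast
    \<comment> \<open>The step along w has length e / (n + 2); the offset 2 keeps it strictly below
      e already at n = 0.\<close>
    define t where "t n = e / (norm w * (real n + 2))" for n :: nat
    have t: "t n > 0" for n using e False by (simp add: t_def add_nonneg_pos)
    have tw: "norm (t n *\<^sub>R w) = e / (real n + 2)" for n using e False by (simp add: t_def)
    define y where "y n = x + t n *\<^sub>R w" for n
    have yF: "y n \<in> F" for n
      unfolding y_def using xF V(3) Fsub by (intro csubspace_add csubspace_scaleR)
    have yS: "y n \<in> S" for n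
    proof -
      have "e / (real n + 2) < e" using e by (simp add: field_simps add_pos_nonneg)
      then have "y n \<in> ball x e" using tw[of n] by (simp add: y_def dist_norm)
      then show ?thesis using e(2) yF E(3) by blast
    qed
    have ydiff: "y n - x = t n *\<^sub>R w" for n by (simp add: y_def)
    have "(\<lambda>n. e * inverse (real (Suc (Suc n)))) \<longlonglongrightarrow> e * 0"
      by (rule tendsto_mult[OF tendsto_const LIMSEQ_Suc[OF LIMSEQ_inverse_real_of_nat]])
    moreover have "norm (y n - x) = e * inverse (real (Suc (Suc n)))" for n
      unfolding ydiff tw by (simp add: divide_inverse add.commute)
    ultimately have "(\<lambda>n. norm (y n - x)) \<longlonglongrightarrow> 0" by simp
    then have "y \<longlonglongrightarrow> x" by (rule LIM_zero_cancel[OF tendsto_norm_zero_cancel])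
    moreover have "\<forall>n. y n \<in> S - {x}" using yS False less_imp_neq[OF t] by (auto simp: y_def)
    moreover have "((\<lambda>z. (1 / norm (z - x)) *\<^sub>R (g z - (g x + D (z - x)))) \<longlongrightarrow> 0) (at x within S)"
      using D unfolding has_derivative_within g_def[symmetric] S_def[symmetric] x_def[symmetric] by simp
    ultimately have "((\<lambda>z. (1 / norm (z - x)) *\<^sub>R (g z - (g x + D (z - x)))) \<circ> y) \<longlonglongrightarrow> 0"
      unfolding tendsto_at_iff_sequentially by blast
    moreover have "((\<lambda>z. (1 / norm (z - x)) *\<^sub>R (g z - (g x + D (z - x)))) \<circ> y) n
        = (1 / (t n * norm w)) *\<^sub>R g (y n) - (1 / norm w) *\<^sub>R v" for n
    proof -
      have "D (t n *\<^sub>R w) = t n *\<^sub>R v"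
        using has_derivative_bounded_linear[OF D] V(4) by (simp add: linear_simps)
      then show ?thesis using t[of n] by (simp add: ydiff gx scaleR_diff_right)
    qed
    ultimately have "(\<lambda>n. (1 / (t n * norm w)) *\<^sub>R g (y n) - (1 / norm w) *\<^sub>R v) \<longlonglongrightarrow> 0"
      by (simp add: comp_def)
    then have lim: "(\<lambda>n. (1 / (t n * norm w)) *\<^sub>R g (y n)) \<longlonglongrightarrow> (1 / norm w) *\<^sub>R v"
      by (rule LIM_zero_cancel)
    have mem: "(1 / (t n * norm w)) *\<^sub>R g (y n) \<in> M" for n
      using gM[OF yF yS] sub by (intro csubspace_scaleR)
    have "closed M" using M by (simp add: closed_csubspace_def)
    then have "(1 / norm w) *\<^sub>R v \<in> M" using mem lim by (rule closed_sequentially)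
    then have "norm w *\<^sub>R (1 / norm w) *\<^sub>R v \<in> M" by (rule csubspace_scaleR[OF sub])
    then show ?thesis using False by simp
  qed
qed

lemma tangent_span_subset:
  fixes M :: "'a::chilbert_space set"
  assumes M: "closed_csubspace M"
  shows "tangent_span (proj_of M) \<subseteq> M"
  unfolding tangent_span_def closed_cspan_def
proof (rule hull_minimal)
  have "\<xi> \<in> M" if "norm \<xi> = 1" "line \<xi> \<in> proj_of M" for \<xi>
    using that line_mem_proj_of_iff[of M \<xi>] M by (cases "\<xi> = 0") (auto simp: closed_csubspace_def)
  then show "(\<Union>\<xi>\<in>{\<xi>. norm \<xi> = 1 \<and> line \<xi> \<in> proj_of M}. tangent_space (proj_of M) \<xi>) \<subseteq> M"
    using tangent_space_subset[OF M] by blast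
qed fact

text \<open>The tangent space at [x] supplies every vector of M orthogonal to x, and the missing
  direction x is tangent at [e].\<close>

lemma tangent_span_eq:
  fixes M :: "'a::chilbert_space set"
  assumes M: "closed_csubspace M" and x: "x \<in> M" "norm x = 1" and e: "e \<in> M" "norm e = 1" "cinner x e = 0"
  shows "tangent_span (proj_of M) = M"
proof
  show "tangent_span (proj_of M) \<subseteq> M" by (rule tangent_span_subset[OF M])
  have sub: "csubspace M" using M by (simp add: closed_csubspace_def)
  let ?T = "\<Union>\<xi>\<in>{\<xi>. norm \<xi> = 1 \<and> line \<xi> \<in> proj_of M}. tangent_space (proj_of M) \<xi>"
  have T: "v \<in> ?T" if "v \<in> M" "cinner \<xi> v = 0" "\<xi> \<in> M" "norm \<xi> = 1" for v \<xi>
  proof (rule UN_I[of \<xi>])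
    show "\<xi> \<in> {\<xi>. norm \<xi> = 1 \<and> line \<xi> \<in> proj_of M}" using that by (auto simp: proj_of_def)
    show "v \<in> tangent_space (proj_of M) \<xi>"
      using tangent_space_superset[OF M that(3,4)] that by (auto simp: orth_compl_single)
  qed
  show "M \<subseteq> tangent_span (proj_of M)"
    unfolding tangent_span_def closed_cspan_def
  proof
    fix m assume m: "m \<in> M"
    have "m \<in> S" if S: "closed_csubspace S" "?T \<subseteq> S" for S
    proof -
      have Ssub: "csubspace S" using S(1) by (simp add: closed_csubspace_def)
      have "m - cinner x m *\<^sub>C x \<in> ?T"
        by (rule T[of _ x]) (use m x sub in \<open>auto simp: csubspace_diff csubspace_scaleC cinner_simps cinner_self_unit\<close>)
      moreover have "x \<in> ?T"
        by (rule T[of _ e]) (use x e cinner_eq_zero_commute in auto)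
      ultimately have "(m - cinner x m *\<^sub>C x) + cinner x m *\<^sub>C x \<in> S"
        using S(2) Ssub by (intro csubspace_add csubspace_scaleC) auto
      then show ?thesis by simp
    qed
    then show "m \<in> closed_csubspace hull ?T" unfolding hull_def by blast
  qed
qed

theorem proposition2p14:
  fixes B :: "('a::chilbert_space \<Rightarrow>\<^sub>L 'a) set"
  assumes "cstar_subalgebra B compact_ops"
    and "B \<noteq> {0}"
  shows "(hereditary B compact_ops \<longleftrightarrow>
      (\<exists>X P'. only_fiber B X \<and>
        unique_state_extensions B compact_ops X \<and>
        P' = state_extension B compact_ops ` X \<and>
        closed_kaehler_submanifold (state_to_proj ` P') \<and>
        line ` (tangent_span (state_to_proj ` P') - {0}) \<subseteq> state_to_proj ` P'))
    \<and> (\<forall>X P' M. hereditary B compact_ops \<and> only_fiber B X \<and>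
        P' = state_extension B compact_ops ` X \<and> \<not> is_singleton P' \<and>
        M = tangent_span (state_to_proj ` P') \<longrightarrow>
        P' = {\<phi> \<in> pure_states compact_ops. state_to_proj \<phi> \<in> proj_of M} \<and>
        B = compact_ops_on M)"
proof -
  \<comment> \<open>Through the unique extensions the abstract fiber becomes the set of lines of M,
    where the geometric claims are checked.\<close>
  have extensions: "state_to_proj ` state_extension B compact_ops ` pure_states B = proj_of M"
    if M: "closed_csubspace M" "B = compact_ops_on M" for M
  proof -
    have "state_to_proj ` vector_state compact_ops ` {x \<in> M. norm x = 1} = line ` {x \<in> M. norm x = 1}"
      unfolding image_image by (intro image_cong) (auto simp: state_to_proj_vector_state)
    then show ?thesis using M by (simp add: state_extension_pure_states proj_of_def)
  qed
  show ?thesis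
  proof (intro conjI iffI allI impI)
    assume "hereditary B compact_ops"
    then obtain M x where M: "closed_csubspace M" "x \<in> M" "norm x = 1" "B = compact_ops_on M"
      using hereditary_imp_compact_ops_on assms by blast
    have sub: "csubspace M" using M(1) by (simp add: closed_csubspace_def)
    \<comment> \<open>Only the inclusion of the tangent span in M enters, so a one-dimensional M,
      with tangent span {0}, is covered too.\<close>
    have "line ` (tangent_span (proj_of M) - {0}) \<subseteq> proj_of M"
      using tangent_span_subset[OF M(1)] line_mem_proj_of_iff[OF sub] by auto
    then show "\<exists>X P'. only_fiber B X \<and>
        unique_state_extensions B compact_ops X \<and>
        P' = state_extension B compact_ops ` X \<and>
        closed_kaehler_submanifold (state_to_proj ` P') \<and>
        line ` (tangent_span (state_to_proj ` P') - {0}) \<subseteq> state_to_proj ` P'"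
      using only_fiber_compact_ops_on[OF M(1-3)] unique_state_extensions_compact_ops_on[OF M(1)]
        closed_kaehler_submanifold_proj_of[OF M(1)] extensions[OF M(1,4)] M(4)
      by (intro exI[of _ "pure_states B"] exI[of _ "state_extension B compact_ops ` pure_states B"]) auto
  next
    assume "\<exists>X P'. only_fiber B X \<and>
        unique_state_extensions B compact_ops X \<and>
        P' = state_extension B compact_ops ` X \<and>
        closed_kaehler_submanifold (state_to_proj ` P') \<and>
        line ` (tangent_span (state_to_proj ` P') - {0}) \<subseteq> state_to_proj ` P'"
    then obtain X where X: "only_fiber B X" "unique_state_extensions B compact_ops X" by blast
    obtain M where M: "closed_csubspace M" "B = compact_ops_on M"
      using unique_fiber_imp_compact_ops_on[OF assms X] by blast
    show "hereditary B compact_ops" using hereditary_compact_ops_on[OF M(1)] M(2) by simp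
  next
    fix X P' N
    assume *: "hereditary B compact_ops \<and> only_fiber B X \<and>
        P' = state_extension B compact_ops ` X \<and> \<not> is_singleton P' \<and>
        N = tangent_span (state_to_proj ` P')"
    then obtain M x where M: "closed_csubspace M" "x \<in> M" "norm x = 1" "B = compact_ops_on M"
      using hereditary_imp_compact_ops_on assms by blast
    have sub: "csubspace M" using M(1) by (simp add: closed_csubspace_def)
    have X: "X = pure_states B" using * only_fiber_pure_states(1) by blast
    have P': "P' = vector_state compact_ops ` {x \<in> M. norm x = 1}"
      using * X state_extension_pure_states[OF M(1)] M(4) by simp
    \<comment> \<open>A second point of P' provides a unit vector of M whose state differs from that
      of x; it will yield the direction orthogonal to x.\<close>
    have "\<exists>y\<in>M. norm y = 1 \<and> vector_state compact_ops y \<noteq> vector_state compact_ops x"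
    proof (rule ccontr)
      assume "\<not> ?thesis"
      then have "P' = {vector_state compact_ops x}" unfolding P' using M(2,3) by blast
      then have "is_singleton P'" by (metis is_singletonI)
      then show False using * by blast
    qed
    then obtain y where y: "y \<in> M" "norm y = 1" "vector_state compact_ops y \<noteq> vector_state compact_ops x"
      by blast
    \<comment> \<open>If this component of y orthogonal to x vanished, y would be a phase times x
      and would induce the same state.\<close>
    define r where "r = y - cinner x y *\<^sub>C x"
    have "r \<noteq> 0"
    proof
      assume "r = 0"
      then have y_eq: "y = cinner x y *\<^sub>C x" by (simp add: r_def)
      then have c: "cmod (cinner x y) = 1" using M(3) y(2) by (metis mult.right_neutral norm_scaleC)
      have "cinner y (a y) = cinner x (a x)" if "a \<in> compact_ops" for a
      proof -
        have "cinner y (a y) = cnj (cinner x y) * (cinner x y * cinner x (a x))"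
          by (subst (1 2) y_eq) (simp add: clinear_opD compact_ops_clinear[OF that] cinner_simps)
        then show ?thesis using complex_norm_square[of "cinner x y"] c by (simp add: mult_ac)
      qed
      then have "vector_state compact_ops y = vector_state compact_ops x"
        by (auto simp: vector_state_def restrict_def)
      then show False using y(3) by blast
    qed
    moreover have "r \<in> M" "cinner x r = 0"
      using y(1) M(2,3) sub by (auto simp: r_def csubspace_diff csubspace_scaleC cinner_simps cinner_self_unit)
    ultimately have "tangent_span (proj_of M) = M"
      using sub by (intro tangent_span_eq[OF M(1-3), of "(1 / norm r) *\<^sub>R r"])
        (auto simp: csubspace_scaleR cinner.scaleR_right)
    then have N: "N = M" using * X extensions[OF M(1,4)] by simp
    show "B = compact_ops_on N" using M(4) N by simp
    show "P' = {\<phi> \<in> pure_states compact_ops. state_to_proj \<phi> \<in> proj_of N}"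
    proof (intro set_eqI iffI)
      fix \<phi> assume "\<phi> \<in> P'"
      then show "\<phi> \<in> {\<phi> \<in> pure_states compact_ops. state_to_proj \<phi> \<in> proj_of N}"
        by (auto simp: P' N vector_state_compact_ops state_to_proj_vector_state proj_of_def)
    next
      fix \<phi> assume \<phi>: "\<phi> \<in> {\<phi> \<in> pure_states compact_ops. state_to_proj \<phi> \<in> proj_of N}"
      \<comment> \<open>The full algebra is the case of the whole space, so each of its pure states
        is a vector state.\<close>
      have "closed_csubspace (UNIV :: 'a set)" by (simp add: closed_csubspace_def csubspace_def)
      then obtain z where z: "norm z = 1" "\<phi> = vector_state compact_ops z"
        using \<phi> pure_state_is_vector_state[of UNIV \<phi>] by (auto simp: compact_ops_on_UNIV)
      then have "z \<noteq> 0" "line z \<in> proj_of M"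
        using \<phi> by (auto simp: state_to_proj_vector_state N)
      then have "z \<in> M" using line_mem_proj_of_iff[OF sub] by blast
      then show "\<phi> \<in> P'" using z by (auto simp: P')
    qed
  qed
qed

end
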